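(* Let $m\ge 3$. For every $C>0$ there is a compact subset $K$ of the moduli space of conformal structures of the 2-torus such that, for every smooth immersion $\vec\Phi:\mathbb T^2\to\mathbb R^m$ and every moving frame $\vec e=(\vec e_1,\vec e_2)$ on $\vec\Phi$ with $\mathcal F(\vec\Phi,\vec e)\in[0,C]$, the conformal class of the pullback metric $g=\vec\Phi^*g_{\mathbb R^m}$ belongs to $K$.
   Context: $\mathbb T^2$ is the abstract smooth oriented 2-torus, $g_{\mathbb R^m}$ the Euclidean metric. For an immersion $\vec\Phi:\mathbb T^2\to\mathbb R^m$, a moving frame on $\vec\Phi$ is a pair $\vec e=(\vec e_1,\vec e_2)$ of (smooth) sections of the tangent bundle $T\vec\Phi(\mathbb T^2)$ (i.e. $\mathbb R^m$-valued maps on $\mathbb T^2$) such that for every $x\in\mathbb T^2$ the couple $(\vec e_1(x),\vec e_2(x))$ is a positively oriented orthonormal basis (for the Euclidean scalar product of $\mathbb R^m$) of the tangent plane of $\vec\Phi$ at $x$. The frame energy is $$\mathcal F(\vec\Phi,\vec e):=\frac14\int_{\mathbb T^2}|d\vec e|^2\,dvol_g,\qquad |d\vec e|^2=\sum_{i,j,k=1}^2 g^{ij}\,\partial_{x_i}\vec e_k\cdot\partial_{x_j}\vec e_k ,$$ where $g=\vec\Phi^*g_{\mathbb R^m}$ and $dvol_g$ is its area form. The moduli space of the torus is the space of conformal structures on $\mathbb T^2$ up to diffeomorphism, i.e. $\{\tau\in\mathbb C:\operatorname{Im}\tau>0\}/PSL(2,\mathbb Z)$, where $\tau=\tau_1+i\tau_2$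 corresponds to the flat torus $\mathbb R^2/(\mathbb Z(1,0)+\mathbb Z(\tau_1,\tau_2))$. *)

theory Defs
  imports "HOL-Analysis.Analysis"
begin

section \<open>Smooth maps\<close>

text \<open>
  For a map on all of a Euclidean space, being \<open>C\<^sup>k\<^sup>+\<^sup>1\<close> means being differentiable with
  \<open>C\<^sup>k\<close> directional derivatives in every fixed direction.
\<close>

fun C_k :: "nat \<Rightarrow> ('a::euclidean_space \<Rightarrow> 'b::real_normed_vector) \<Rightarrow> bool" where
  "C_k 0 f \<longleftrightarrow> continuous_on UNIV f"
| "C_k (Suc k) f \<longleftrightarrow>
     f differentiable_on UNIV \<and> (\<forall>v. C_k k (\<lambda>x. frechet_derivative f (at x) v))"

definition smooth :: "('a::euclidean_space \<Rightarrow> 'b::real_normed_vector) \<Rightarrow> bool" where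
  "smooth f \<longleftrightarrow> (\<forall>k. C_k k f)"

definition partial_deriv :: "2 \<Rightarrow> (real^2 \<Rightarrow> 'b::real_normed_vector) \<Rightarrow> real^2 \<Rightarrow> 'b" where
  "partial_deriv i f x = frechet_derivative f (at x) (axis i 1)"


section \<open>Immersed tori, moving frames and the frame energy\<close>

text \<open>
  The abstract smooth oriented torus is \<open>\<real>\<^sup>2 / \<int>\<^sup>2\<close> with the orientation of \<open>\<real>\<^sup>2\<close>; maps and
  tensors on it are represented by their \<open>\<int>\<^sup>2\<close>-periodic lifts to \<open>\<real>\<^sup>2\<close>.
\<close>

definition int_lattice :: "(real^2) set" where
  "int_lattice = {n. \<forall>i. n $ i \<in> \<int>}"

definition periodic :: "(real^2 \<Rightarrow> 'b) \<Rightarrow> bool" where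
  "periodic f \<longleftrightarrow> (\<forall>x. \<forall>n\<in>int_lattice. f (x + n) = f x)"

definition torus_immersion :: "(real^2 \<Rightarrow> real^'m) \<Rightarrow> bool" where
  "torus_immersion \<Phi> \<longleftrightarrow>
     smooth \<Phi> \<and> periodic \<Phi> \<and> (\<forall>x. inj (frechet_derivative \<Phi> (at x)))"

definition pullback_metric :: "(real^2 \<Rightarrow> 'b::real_inner) \<Rightarrow> real^2 \<Rightarrow> real^2^2" where
  "pullback_metric \<Phi> x = (\<chi> i j. partial_deriv i \<Phi> x \<bullet> partial_deriv j \<Phi> x)"

text \<open>
  The tangent plane at \<open>x\<close> is the range of \<open>d\<Phi>\<^sub>x\<close>, oriented by \<open>d\<Phi>\<^sub>x\<close>. As \<open>d\<Phi>\<^sub>x\<close> is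
  injective, vectors \<open>d\<Phi>\<^sub>x v\<^sub>1, d\<Phi>\<^sub>x v\<^sub>2\<close> form a positively oriented basis of it iff
  \<open>det (v\<^sub>1, v\<^sub>2) > 0\<close>.
\<close>

definition moving_frame :: "(real^2 \<Rightarrow> real^'m) \<Rightarrow> (2 \<Rightarrow> real^2 \<Rightarrow> real^'m) \<Rightarrow> bool" where
  "moving_frame \<Phi> e \<longleftrightarrow>
     (\<forall>k. smooth (e k) \<and> periodic (e k)) \<and>
     (\<forall>x. (\<forall>k l. e k x \<bullet> e l x = (if k = l then 1 else 0)) \<and>
          (\<exists>v :: real^2^2. (\<forall>k. e k x = frechet_derivative \<Phi> (at x) (v $ k)) \<and> det v > 0))"

definition frame_norm_sq ::
    "(real^2 \<Rightarrow> real^2^2) \<Rightarrow> (2 \<Rightarrow> real^2 \<Rightarrow> real^'m) \<Rightarrow> real^2 \<Rightarrow> real" where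
  "frame_norm_sq g e x =
     (\<Sum>i\<in>UNIV. \<Sum>j\<in>UNIV. \<Sum>k\<in>UNIV.
        matrix_inv (g x) $ i $ j * (partial_deriv i (e k) x \<bullet> partial_deriv j (e k) x))"

text \<open>The unit square \<open>cbox 0 1\<close> is a fundamental domain of the torus.\<close>

definition frame_energy :: "(real^2 \<Rightarrow> real^'m) \<Rightarrow> (2 \<Rightarrow> real^2 \<Rightarrow> real^'m) \<Rightarrow> real" where
  "frame_energy \<Phi> e =
     1/4 * integral (cbox 0 1)
       (\<lambda>x. frame_norm_sq (pullback_metric \<Phi>) e x * sqrt (det (pullback_metric \<Phi> x)))"


section \<open>The moduli space of the torus\<close>

definition upper_half_plane :: "complex set" where
  "upper_half_plane = {\<tau>. Im \<tau> > 0}"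

definition modular_rel :: "(complex \<times> complex) set" where
  "modular_rel =
     {(\<tau>, \<tau>'). \<tau> \<in> upper_half_plane \<and> \<tau>' \<in> upper_half_plane \<and>
        (\<exists>a b c d :: int. a * d - b * c = 1 \<and>
           \<tau>' = (of_int a * \<tau> + of_int b) / (of_int c * \<tau> + of_int d))}"

text \<open>The set of orbits of \<open>PSL(2,\<int>)\<close> in the upper half plane, with the quotient topology.\<close>

definition moduli_space :: "complex set set" where
  "moduli_space = upper_half_plane // modular_rel"

definition moduli_topology :: "complex set topology" where
  "moduli_topology =
     topology (\<lambda>U. U \<subseteq> moduli_space \<and>
       openin (top_of_set upper_half_plane) {\<tau> \<in> upper_half_plane. modular_rel `` {\<tau>} \<in> U})"

lemma openin_moduli_topology:
  "openin moduli_topology U \<longleftrightarrow>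
     U \<subseteq> moduli_space \<and>
     openin (top_of_set upper_half_plane) {\<tau> \<in> upper_half_plane. modular_rel `` {\<tau>} \<in> U}"
proof -
  let ?p = "\<lambda>U. {\<tau> \<in> upper_half_plane. modular_rel `` {\<tau>} \<in> U}"
  have Int: "?p (S \<inter> T) = ?p S \<inter> ?p T" for S T
    by auto
  have Un: "?p (\<Union>\<K>) = (\<Union>S\<in>\<K>. ?p S)" for \<K>
    by auto
  have "istopology (\<lambda>U. U \<subseteq> moduli_space \<and> openin (top_of_set upper_half_plane) (?p U))"
    unfolding istopology_def Int Un by (auto intro!: openin_Union)
  then show ?thesis
    by (simp add: moduli_topology_def)
qed

lemma topspace_moduli_topology: "topspace moduli_topology = moduli_space"
proof -
  have "{\<tau> \<in> upper_half_plane. modular_rel `` {\<tau>} \<in> moduli_space} = upper_half_plane"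
    by (auto simp: moduli_space_def quotientI)
  then have "openin moduli_topology moduli_space"
    by (simp add: openin_moduli_topology)
  then show ?thesis
    by (metis openin_moduli_topology openin_subset openin_topspace subset_antisym)
qed

definition torus_lattice :: "complex \<Rightarrow> complex set" where
  "torus_lattice \<tau> = {of_int a + of_int b * \<tau> | a b :: int. True}"

text \<open>
  An orientation-preserving diffeomorphism \<open>\<real>\<^sup>2 / \<int>\<^sup>2 \<rightarrow> \<complex> / (\<int> + \<tau>\<int>)\<close>, represented by a lift
  \<open>\<psi> : \<real>\<^sup>2 \<rightarrow> \<complex>\<close> to the universal covers.
\<close>

definition torus_diffeo :: "complex \<Rightarrow> (real^2 \<Rightarrow> complex) \<Rightarrow> bool" where
  "torus_diffeo \<tau> \<psi> \<longleftrightarrow>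
     bij \<psi> \<and> smooth \<psi> \<and> smooth (inv \<psi>) \<and>
     (\<forall>x y. \<psi> x - \<psi> y \<in> torus_lattice \<tau> \<longleftrightarrow> x - y \<in> int_lattice) \<and>
     (\<forall>x. Im (cnj (partial_deriv 1 \<psi> x) * partial_deriv 2 \<psi> x) > 0)"

text \<open>
  The point of the moduli space given by a metric \<open>g\<close> on the torus: all \<open>\<tau>\<close> whose flat torus
  \<open>\<complex> / (\<int> + \<tau>\<int>)\<close> is diffeomorphic to \<open>\<real>\<^sup>2 / \<int>\<^sup>2\<close> by an orientation-preserving map that
  pulls the flat metric back to a positive multiple of \<open>g\<close>. The orientation condition matters:
  with orientation-reversing maps one would also obtain the orbit of \<open>- cnj \<tau>\<close>.
\<close>

definition conformal_modulus :: "(real^2 \<Rightarrow> real^2^2) \<Rightarrow> complex set" where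
  "conformal_modulus g =
     {\<tau> \<in> upper_half_plane.
        \<exists>\<psi>. torus_diffeo \<tau> \<psi> \<and>
          (\<forall>x. \<exists>c>0. pullback_metric \<psi> x = c *\<^sub>R g x)}"

end

theory Submission
  imports Defs "HOL-Complex_Analysis.Cauchy_Integral_Formula"
begin

text \<open>
  The conformal modulus of an immersed torus is a whole orbit only because of uniformization, which
  is obtained from the coframe \<open>\<theta>\<close> dual to the moving frame. Writing
  \<open>\<theta> = \<rho> (dz + \<mu> dz\<^sup>*)\<close> (\<open>z\<^sup>*\<close> the conjugate of \<open>z\<close>) with \<open>\<bar>\<mu>\<bar> \<le> k < 1\<close>, the Beltrami equation for the
  logarithm of \<open>\<partial>\<psi>/\<partial>z\<close> is solved by a Neumann series: on the flat torus the operator sending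
  \<open>\<partial>u/\<partial>z\<^sup>*\<close> to \<open>\<partial>u/\<partial>z\<close> is an \<open>L\<^sup>2\<close> isometry commuting with derivatives, so the series converges in every
  Sobolev norm. The resulting \<open>\<psi>\<close> has local inverses on balls of uniform size, so it is a covering of the plane, i.e. a global flat coordinate.

  For the energy bound let \<open>\<psi>\<close> be a flat coordinate on the torus of modulus \<open>\<tau>\<close> and write
  \<open>\<theta> = \<kappa> d\<psi>\<close>, \<open>\<kappa> = r exp (i \<beta>)\<close>. The structure equation says that \<open>d\<beta> + \<omega>\<close>, with \<open>\<omega>\<close> the
  connection form of the frame, is the Hodge dual of \<open>d (ln r)\<close>; since \<open>\<integral> d (ln r) \<and> d\<beta> = 0\<close>,
  this gives \<open>\<parallel>d\<beta>\<parallel> \<le> \<parallel>\<omega>\<parallel>\<close>, so the coordinate frame has energy controlled by that of the given frame.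
  Its first vector is the unit tangent of the closed image curves of the horizontal circles of length \<open>1\<close>, and the
  unit tangent \<open>T\<close> of a closed curve satisfies \<open>\<integral> \<bar>T'\<bar>\<^sup>2 \<ge> 2\<close> over a parameter interval of length \<open>1\<close>.
  Averaging over all these circles bounds \<open>2 Im \<tau>\<close> by a multiple of the energy.
\<close>

text \<open>The moduli space is noncompact only towards its cusp, so an upper bound on
  \<open>Im \<tau>\<close> valid for every representative \<tau> of the class is enough; a
  representative of nearly maximal height is then, after a translation, also bounded from below. The
  obstacle is that the given frame may rotate arbitrarily against the coordinate frame. The phase
  \<beta> of that rotation is not bounded by itself; it is controlled only because it satisfies a
  first-order equation jointly with ln r, whose cross term is exact. Only d\<beta> ever enters,
  since the phase may be multivalued on the torus. Origin of the constant 6: let E be the total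
  energy of both frame vectors, so E = 4 F. The connection form occurs in the derivative of each of
  the two vectors, whence d\<beta> has energy at most E/2; the unit tangent then costs 2 (E/2) + 2 E
  = 3 E = 12 F, to be compared with 2 Im \<tau>. Uniformization is unavoidable because
  \<open>conformal_modulus\<close> collects all \<tau> that admit a flat coordinate: it is empty
  without one. That it is a single orbit is a separate matter, settled by Liouville's
  theorem.\<close>

declare C_k.simps(2) [simp del]

section \<open>Calculus of smooth maps\<close>

text \<open>\<open>frechet_derivative\<close> is a choice operator; uniqueness of derivatives lets
  every closure proof below supply an explicit formula instead.\<close>

lemma C_k_SucI:
  assumes "\<And>x. (f has_derivative f' x) (at x)" "\<And>v. C_k k (\<lambda>x. f' x v)"
  shows "C_k (Suc k) f"
proof -
  have "frechet_derivative f (at x) = f' x" for x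
    using frechet_derivative_at[OF assms(1)] by simp
  then show ?thesis
    using assms by (auto simp: C_k.simps(2) differentiable_on_def differentiable_def)
qed

lemma C_k_SucD:
  assumes "C_k (Suc k) f"
  shows "(f has_derivative frechet_derivative f (at x)) (at x)" "C_k k (\<lambda>x. frechet_derivative f (at x) v)"
  using assms by (auto simp: C_k.simps(2) differentiable_on_def frechet_derivative_works)

lemma C_k_Suc_imp: "C_k (Suc k) f \<Longrightarrow> C_k k f"
proof (induction k arbitrary: f)
  case 0
  then show ?case using differentiable_imp_continuous_on by (auto simp: C_k.simps(2))
next
  case (Suc k)
  show ?case
  proof (rule C_k_SucI[where f'="\<lambda>x. frechet_derivative f (at x)"])
    show "(f has_derivative frechet_derivative f (at x)) (at x)" for x
      by (rule C_k_SucD(1)[OF Suc.prems])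
    show "C_k k (\<lambda>x. frechet_derivative f (at x) v)" for v
      by (rule Suc.IH) (rule C_k_SucD(2)[OF Suc.prems])
  qed
qed

lemma C_k_bounded_linear:
  assumes "bounded_linear L" shows "C_k k f \<Longrightarrow> C_k k (\<lambda>x. L (f x))"
proof (induction k arbitrary: f)
  case 0
  then show ?case unfolding C_k.simps(1) by (rule bounded_linear.continuous_on[OF assms])
next
  case (Suc k)
  show ?case
  proof (rule C_k_SucI[where f'="\<lambda>x v. L (frechet_derivative f (at x) v)"])
    show "((\<lambda>x. L (f x)) has_derivative (\<lambda>v. L (frechet_derivative f (at x) v))) (at x)" for x
      by (rule bounded_linear.has_derivative[OF assms]) (rule C_k_SucD(1)[OF Suc.prems])
    show "C_k k (\<lambda>x. L (frechet_derivative f (at x) v))" for v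
      by (rule Suc.IH) (rule C_k_SucD(2)[OF Suc.prems])
  qed
qed

lemma C_k_const: "C_k k (\<lambda>x. c)"
proof (induction k arbitrary: c)
  case 0
  show ?case by simp
next
  case (Suc k)
  have 1: "((\<lambda>x. c) has_derivative (\<lambda>v. 0)) (at x)" for x :: 'a by (rule has_derivative_const)
  have 2: "C_k k (\<lambda>x::'a. 0::'b)" by (rule Suc.IH)
  show ?case
    using C_k_SucI[of "\<lambda>x. c" "\<lambda>x v. 0", OF 1 2] .
qed

lemma C_k_linear:
  fixes L :: "'a::euclidean_space \<Rightarrow> 'b::real_normed_vector"
  assumes "bounded_linear L" shows "C_k k L"
proof (cases k)
  case 0
  then show ?thesis using assms by (simp add: linear_continuous_on)
next
  case (Suc j)
  show ?thesis unfolding Suc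
  proof (rule C_k_SucI[where f'="\<lambda>x. L"])
    show "(L has_derivative L) (at x)" for x by (rule bounded_linear_imp_has_derivative[OF assms])
    show "C_k j (\<lambda>x. L v)" for v by (rule C_k_const)
  qed
qed

lemma C_k_add: "C_k k f \<Longrightarrow> C_k k g \<Longrightarrow> C_k k (\<lambda>x. f x + g x)"
proof (induction k arbitrary: f g)
  case 0
  then show ?case unfolding C_k.simps(1) by (rule continuous_on_add)
next
  case (Suc k)
  show ?case
  proof (rule C_k_SucI[where f'="\<lambda>x v. frechet_derivative f (at x) v + frechet_derivative g (at x) v"])
    show "((\<lambda>x. f x + g x) has_derivative
        (\<lambda>v. frechet_derivative f (at x) v + frechet_derivative g (at x) v)) (at x)" for x
      by (rule has_derivative_add) (rule C_k_SucD(1)[OF Suc.prems(1)] C_k_SucD(1)[OF Suc.prems(2)])+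
    show "C_k k (\<lambda>x. frechet_derivative f (at x) v + frechet_derivative g (at x) v)" for v
      by (rule Suc.IH) (rule C_k_SucD(2)[OF Suc.prems(1)] C_k_SucD(2)[OF Suc.prems(2)])+
  qed
qed

lemma C_k_sum: "(\<And>i. i \<in> I \<Longrightarrow> C_k k (f i)) \<Longrightarrow> C_k k (\<lambda>x. \<Sum>i\<in>I. f i x)"
  by (induction I rule: infinite_finite_induct) (auto intro: C_k_add C_k_const)

lemma C_k_bilinear:
  assumes "bounded_bilinear p" shows "C_k k f \<Longrightarrow> C_k k g \<Longrightarrow> C_k k (\<lambda>x. p (f x) (g x))"
proof (induction k arbitrary: f g)
  case 0
  then show ?case unfolding C_k.simps(1) by (rule bounded_bilinear.continuous_on[OF assms])
next
  case (Suc k)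
  show ?case
  proof (rule C_k_SucI[where f'="\<lambda>x v. p (f x) (frechet_derivative g (at x) v) + p (frechet_derivative f (at x) v) (g x)"])
    show "((\<lambda>x. p (f x) (g x)) has_derivative
        (\<lambda>v. p (f x) (frechet_derivative g (at x) v) + p (frechet_derivative f (at x) v) (g x))) (at x)" for x
      by (rule bounded_bilinear.FDERIV[OF assms]) (rule C_k_SucD(1)[OF Suc.prems(1)] C_k_SucD(1)[OF Suc.prems(2)])+
    show "C_k k (\<lambda>x. p (f x) (frechet_derivative g (at x) v) + p (frechet_derivative f (at x) v) (g x))" for v
      using C_k_SucD(2)[OF Suc.prems(1)] C_k_SucD(2)[OF Suc.prems(2)] Suc.prems[THEN C_k_Suc_imp]
      by (intro C_k_add Suc.IH)
  qed
qed

lemmas C_k_scaleR = C_k_bilinear[OF bounded_bilinear_scaleR]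
lemmas C_k_mult = C_k_bilinear[OF bounded_bilinear_mult]
lemmas C_k_inner = C_k_bilinear[OF bounded_bilinear_inner]

text \<open>The chain rule differentiates \<open>g\<close> in the direction
  \<open>frechet_derivative f (at x) v\<close>, which varies with \<open>x\<close>, while
  \<open>C_k\<close> speaks of fixed directions only. Expanding this direction in
  \<open>Basis\<close> restores fixed directions, at the cost of scalar coefficients.\<close>

lemma C_k_compose:
  fixes f :: "'a::euclidean_space \<Rightarrow> 'b::euclidean_space" and g :: "'b \<Rightarrow> 'c::real_normed_vector"
  shows "C_k k g \<Longrightarrow> C_k k f \<Longrightarrow> C_k k (\<lambda>x. g (f x))"
proof (induction k arbitrary: g)
  case 0
  then show ?case unfolding C_k.simps(1) by (rule continuous_on_compose2) auto
next
  case (Suc k)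
  note g = C_k_SucD[OF Suc.prems(1)] and f = C_k_SucD[OF Suc.prems(2)]
  have eq: "frechet_derivative g (at (f x)) w = (\<Sum>b\<in>Basis. (w \<bullet> b) *\<^sub>R frechet_derivative g (at (f x)) b)" for x w
    using has_derivative_linear[OF g(1)]
    by (subst (1) euclidean_representation[of w, symmetric]) (simp add: linear_sum linear_cmul)
  have "((\<lambda>x. g (f x)) has_derivative
     (\<lambda>v. \<Sum>b\<in>Basis. (frechet_derivative f (at x) v \<bullet> b) *\<^sub>R frechet_derivative g (at (f x)) b)) (at x)" for x
    using has_derivative_compose[OF f(1) g(1), of x] unfolding eq[symmetric] .
  then show ?case
  proof (rule C_k_SucI[where f'="\<lambda>x v. \<Sum>b\<in>Basis. (frechet_derivative f (at x) v \<bullet> b) *\<^sub>R frechet_derivative g (at (f x)) b"])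
    fix v
    show "C_k k (\<lambda>x. \<Sum>b\<in>Basis. (frechet_derivative f (at x) v \<bullet> b) *\<^sub>R frechet_derivative g (at (f x)) b)"
      by (intro C_k_sum C_k_scaleR C_k_inner f(2) C_k_const Suc.IH g(2) C_k_Suc_imp[OF Suc.prems(2)])
  qed
qed

lemma C_k_inverse:
  fixes f :: "'a::euclidean_space \<Rightarrow> 'b::real_normed_field"
  assumes "\<And>x. f x \<noteq> 0" shows "C_k k f \<Longrightarrow> C_k k (\<lambda>x. inverse (f x))"
proof (induction k)
  case 0
  then show ?case using assms by (simp add: continuous_on_inverse)
next
  case (Suc k)
  show ?case
  proof (rule C_k_SucI[where f'="\<lambda>x v. - (inverse (f x) * frechet_derivative f (at x) v * inverse (f x))"])
    show "((\<lambda>x. inverse (f x)) has_derivative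
        (\<lambda>v. - (inverse (f x) * frechet_derivative f (at x) v * inverse (f x)))) (at x)" for x
      by (rule Deriv.has_derivative_inverse) (use assms C_k_SucD(1)[OF Suc.prems] in auto)
    fix v
    have "C_k k (\<lambda>x. (- 1) *\<^sub>R (inverse (f x) * frechet_derivative f (at x) v * inverse (f x)))"
      by (intro C_k_scaleR C_k_const C_k_mult Suc.IH C_k_SucD(2)[OF Suc.prems] C_k_Suc_imp[OF Suc.prems])
    then show "C_k k (\<lambda>x. - (inverse (f x) * frechet_derivative f (at x) v * inverse (f x)))" by simp
  qed
qed

lemma C_k_exp:
  fixes f :: "'a::euclidean_space \<Rightarrow> 'b::{banach,real_normed_field}"
  shows "C_k k f \<Longrightarrow> C_k k (\<lambda>x. exp (f x))"
proof (induction k)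
  case 0
  then show ?case by (simp add: continuous_on_exp)
next
  case (Suc k)
  have "((\<lambda>x. exp (f x)) has_derivative (\<lambda>v. exp (f x) * frechet_derivative f (at x) v)) (at x)" for x
    by (rule has_derivative_compose[OF C_k_SucD(1)[OF Suc.prems]])
       (use DERIV_exp in \<open>simp add: has_field_derivative_def\<close>)
  then show ?case
    by (rule C_k_SucI[where f'="\<lambda>x v. exp (f x) * frechet_derivative f (at x) v"])
       (intro C_k_mult Suc.IH C_k_SucD(2)[OF Suc.prems] C_k_Suc_imp[OF Suc.prems])
qed

lemma C_k_ln:
  fixes f :: "'a::euclidean_space \<Rightarrow> real"
  assumes pos: "\<And>x. f x > 0" shows "C_k k f \<Longrightarrow> C_k k (\<lambda>x. ln (f x))"
proof (cases k)
  case 0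
  assume "C_k k f"
  then show ?thesis using 0 pos by (auto intro!: continuous_on_ln simp: less_imp_neq[symmetric])
next
  case (Suc j)
  assume f: "C_k k f"
  have nz: "f x \<noteq> 0" for x using pos[of x] by simp
  have "((\<lambda>x. ln (f x)) has_derivative (\<lambda>v. inverse (f x) * frechet_derivative f (at x) v)) (at x)" for x
    by (rule has_derivative_compose[OF C_k_SucD(1)[OF f[unfolded Suc]]])
       (use DERIV_ln[OF pos[of x]] in \<open>simp add: has_field_derivative_def\<close>)
  then show ?thesis unfolding Suc
    by (rule C_k_SucI[where f'="\<lambda>x v. inverse (f x) * frechet_derivative f (at x) v"])
       (intro C_k_mult C_k_SucD(2)[OF f[unfolded Suc]] C_k_inverse[OF nz] C_k_Suc_imp[OF f[unfolded Suc]])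
qed

section \<open>Closure rules for smooth maps\<close>

named_theorems smooth_intros

lemma smoothI: "(\<And>k. C_k k f) \<Longrightarrow> smooth f" and smoothD: "smooth f \<Longrightarrow> C_k k f"
  by (auto simp: smooth_def)

lemma smooth_const [smooth_intros]: "smooth (\<lambda>x. c)"
  by (simp add: smooth_def C_k_const)

lemma smooth_bounded_linear: "bounded_linear L \<Longrightarrow> smooth f \<Longrightarrow> smooth (\<lambda>x. L (f x))"
  by (simp add: smooth_def C_k_bounded_linear)

lemma smooth_linear: "bounded_linear L \<Longrightarrow> smooth L"
  by (simp add: smooth_def C_k_linear)

lemma smooth_add [smooth_intros]: "smooth f \<Longrightarrow> smooth g \<Longrightarrow> smooth (\<lambda>x. f x + g x)"
  by (simp add: smooth_def C_k_add)

lemma smooth_sum [smooth_intros]: "(\<And>i. i \<in> I \<Longrightarrow> smooth (f i)) \<Longrightarrow> smooth (\<lambda>x. \<Sum>i\<in>I. f i x)"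
  by (simp add: smooth_def C_k_sum)

lemma smooth_bilinear: "bounded_bilinear p \<Longrightarrow> smooth f \<Longrightarrow> smooth g \<Longrightarrow> smooth (\<lambda>x. p (f x) (g x))"
  by (simp add: smooth_def C_k_bilinear)

lemmas smooth_scaleR [smooth_intros] = smooth_bilinear[OF bounded_bilinear_scaleR]
lemmas smooth_mult [smooth_intros] = smooth_bilinear[OF bounded_bilinear_mult]
lemmas smooth_inner [smooth_intros] = smooth_bilinear[OF bounded_bilinear_inner]
lemmas smooth_minus [smooth_intros] = smooth_bounded_linear[OF bounded_linear_minus[OF bounded_linear_ident]]
lemmas smooth_cnj [smooth_intros] = smooth_bounded_linear[OF bounded_linear_cnj]
lemmas smooth_Re [smooth_intros] = smooth_bounded_linear[OF bounded_linear_Re]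
lemmas smooth_Im [smooth_intros] = smooth_bounded_linear[OF bounded_linear_Im]
lemmas smooth_of_real [smooth_intros] = smooth_bounded_linear[OF bounded_linear_of_real]
lemmas smooth_nth [smooth_intros] = smooth_linear[OF bounded_linear_vec_nth]
lemmas smooth_id [smooth_intros] = smooth_linear[OF bounded_linear_ident]

lemma smooth_diff [smooth_intros]: "smooth f \<Longrightarrow> smooth g \<Longrightarrow> smooth (\<lambda>x. f x - g x)"
  using smooth_add[OF _ smooth_minus] by fastforce

lemma smooth_compose:
  fixes f :: "'a::euclidean_space \<Rightarrow> 'b::euclidean_space"
  shows "smooth g \<Longrightarrow> smooth f \<Longrightarrow> smooth (\<lambda>x. g (f x))"
  by (simp add: smooth_def C_k_compose)

lemma smooth_inverse:
  fixes f :: "'a::euclidean_space \<Rightarrow> 'b::real_normed_field"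
  shows "(\<And>x. f x \<noteq> 0) \<Longrightarrow> smooth f \<Longrightarrow> smooth (\<lambda>x. inverse (f x))"
  by (simp add: smooth_def C_k_inverse)

lemma smooth_divide [smooth_intros]:
  fixes f :: "'a::euclidean_space \<Rightarrow> 'b::real_normed_field"
  shows "(\<And>x. g x \<noteq> 0) \<Longrightarrow> smooth f \<Longrightarrow> smooth g \<Longrightarrow> smooth (\<lambda>x. f x / g x)"
  by (simp add: divide_inverse smooth_mult smooth_inverse)

lemma smooth_exp [smooth_intros]:
  fixes f :: "'a::euclidean_space \<Rightarrow> 'b::{banach,real_normed_field}"
  shows "smooth f \<Longrightarrow> smooth (\<lambda>x. exp (f x))"
  by (simp add: smooth_def C_k_exp)

lemma smooth_ln [smooth_intros]:
  fixes f :: "'a::euclidean_space \<Rightarrow> real"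
  shows "(\<And>x. f x > 0) \<Longrightarrow> smooth f \<Longrightarrow> smooth (\<lambda>x. ln (f x))"
  by (simp add: smooth_def C_k_ln)

lemma smooth_power [smooth_intros]:
  fixes f :: "'a::euclidean_space \<Rightarrow> 'b::real_normed_field"
  shows "smooth f \<Longrightarrow> smooth (\<lambda>x. f x ^ n)"
  by (induction n) (auto intro: smooth_intros)

lemma smooth_has_derivative:
  "smooth f \<Longrightarrow> (f has_derivative frechet_derivative f (at x)) (at x)"
  by (rule C_k_SucD(1)) (rule smoothD)

lemma smooth_differentiable: "smooth f \<Longrightarrow> f differentiable at x"
  using smooth_has_derivative differentiable_def by blast

lemma smooth_continuous_on: "smooth f \<Longrightarrow> continuous_on S f"
  using smoothD[of f 0] continuous_on_subset by auto

lemma smooth_continuous_on_compose: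
  "smooth f \<Longrightarrow> continuous_on S g \<Longrightarrow> continuous_on S (\<lambda>x. f (g x))"
  using continuous_on_compose2[OF smooth_continuous_on[of f UNIV]] by auto

lemma smooth_frechet: "smooth f \<Longrightarrow> smooth (\<lambda>x. frechet_derivative f (at x) v)"
  by (rule smoothI, rule C_k_SucD(2), rule smoothD)

abbreviation "pd \<equiv> partial_deriv"

lemma smooth_partial [smooth_intros]: "smooth f \<Longrightarrow> smooth (pd i f)"
  unfolding partial_deriv_def[abs_def] by (rule smooth_frechet)

lemma vec2_axis: "(v::real^2) = v$1 *\<^sub>R axis 1 1 + v$2 *\<^sub>R axis 2 1"
  by (simp add: vec_eq_iff forall_2 axis_def)

lemma frechet_eq_partials:
  fixes f :: "real^2 \<Rightarrow> 'b::real_normed_vector"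
  assumes "f differentiable at x"
  shows "frechet_derivative f (at x) v = v$1 *\<^sub>R pd 1 f x + v$2 *\<^sub>R pd 2 f x"
proof -
  have l: "linear (frechet_derivative f (at x))"
    using assms by (rule linear_frechet_derivative)
  show ?thesis unfolding partial_deriv_def
    by (subst (1) vec2_axis) (simp only: linear_add[OF l] linear_cmul[OF l])
qed

lemma smooth_has_derivative2:
  fixes f :: "real^2 \<Rightarrow> 'b::real_normed_vector"
  assumes "smooth f"
  shows "(f has_derivative (\<lambda>v. v$1 *\<^sub>R pd 1 f x + v$2 *\<^sub>R pd 2 f x)) (at x)"
proof -
  have "frechet_derivative f (at x) = (\<lambda>v. v$1 *\<^sub>R pd 1 f x + v$2 *\<^sub>R pd 2 f x)"
    by (rule ext, rule frechet_eq_partials, rule smooth_differentiable, rule assms)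
  then show ?thesis
    using smooth_has_derivative[OF assms, of x] by simp
qed

lemma partial_derivI:
  "(f has_derivative f') (at x) \<Longrightarrow> partial_deriv i f x = f' (axis i 1)"
  unfolding partial_deriv_def by (metis frechet_derivative_at)

text \<open>A coinduction rule: the class \<open>P\<close> plays the role of an invariant. It serves
  limits of series, whose partial derivatives are again limits of such series.\<close>

lemma smooth_coinduct2:
  fixes f :: "real^2 \<Rightarrow> 'b::real_normed_vector"
  assumes "P f"
    and diff: "\<And>f x. P f \<Longrightarrow> f differentiable at x"
    and P: "\<And>f i. P f \<Longrightarrow> P (pd i f)"
  shows "smooth f"
proof (rule smoothI)
  fix k show "C_k k f" using \<open>P f\<close>
  proof (induction k arbitrary: f)
    case 0
    then show ?case using diff by (simp add: continuous_on_eq_continuous_at differentiable_imp_continuous_within)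
  next
    case (Suc k)
    show ?case
    proof (rule C_k_SucI[where f'="\<lambda>x. frechet_derivative f (at x)"])
      show "(f has_derivative frechet_derivative f (at x)) (at x)" for x
        using diff[OF Suc.prems] by (simp add: frechet_derivative_works)
      show "C_k k (\<lambda>x. frechet_derivative f (at x) v)" for v
        unfolding frechet_eq_partials[OF diff[OF Suc.prems]]
        by (intro C_k_add C_k_scaleR C_k_const Suc.IH P Suc.prems)
    qed
  qed
qed

section \<open>Differentiation rules for partial derivatives\<close>

named_theorems pd_simps

lemma pd_const [pd_simps]: "pd i (\<lambda>x. c) = (\<lambda>x. 0)"
  by (rule ext) (simp add: partial_deriv_def)

lemma pd_linear: "bounded_linear L \<Longrightarrow> partial_deriv i L = (\<lambda>x. L (axis i 1))"
  by (rule ext, rule partial_derivI, rule bounded_linear_imp_has_derivative)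

lemma pd_bounded_linear:
  assumes "bounded_linear L" "smooth f"
  shows "pd i (\<lambda>x. L (f x)) = (\<lambda>x. L (pd i f x))"
proof
  fix x
  show "pd i (\<lambda>x. L (f x)) x = L (pd i f x)"
    using partial_derivI[OF bounded_linear.has_derivative[OF assms(1) smooth_has_derivative[OF assms(2)]], of i x]
    by (simp add: partial_deriv_def)
qed

lemma pd_add [pd_simps]:
  assumes "smooth f" "smooth g"
  shows "pd i (\<lambda>x. f x + g x) = (\<lambda>x. pd i f x + pd i g x)"
proof
  fix x
  show "pd i (\<lambda>x. f x + g x) x = pd i f x + pd i g x"
    using partial_derivI[OF has_derivative_add[OF assms[THEN smooth_has_derivative]], of i x]
    by (simp add: partial_deriv_def)
qed

lemma pd_diff [pd_simps]:
  assumes "smooth f" "smooth g"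
  shows "pd i (\<lambda>x. f x - g x) = (\<lambda>x. pd i f x - pd i g x)"
proof
  fix x
  show "pd i (\<lambda>x. f x - g x) x = pd i f x - pd i g x"
    using partial_derivI[OF has_derivative_diff[OF assms[THEN smooth_has_derivative]], of i x]
    by (simp add: partial_deriv_def)
qed

lemma pd_bilinear:
  assumes "bounded_bilinear p" "smooth f" "smooth g"
  shows "pd i (\<lambda>x. p (f x) (g x)) = (\<lambda>x. p (f x) (pd i g x) + p (pd i f x) (g x))"
proof
  fix x
  show "pd i (\<lambda>x. p (f x) (g x)) x = p (f x) (pd i g x) + p (pd i f x) (g x)"
    using partial_derivI[OF bounded_bilinear.FDERIV[OF assms(1) assms(2,3)[THEN smooth_has_derivative]], of i x]
    by (simp add: partial_deriv_def)
qed

lemmas pd_scaleR [pd_simps] = pd_bilinear[OF bounded_bilinear_scaleR]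
lemmas pd_mult [pd_simps] = pd_bilinear[OF bounded_bilinear_mult]
lemmas pd_inner [pd_simps] = pd_bilinear[OF bounded_bilinear_inner]
lemmas pd_minus [pd_simps] = pd_bounded_linear[OF bounded_linear_minus[OF bounded_linear_ident]]
lemmas pd_Re [pd_simps] = pd_bounded_linear[OF bounded_linear_Re]
lemmas pd_Im [pd_simps] = pd_bounded_linear[OF bounded_linear_Im]
lemmas pd_of_real [pd_simps] = pd_bounded_linear[OF bounded_linear_of_real]

lemma pd_exp [pd_simps]:
  fixes f :: "real^2 \<Rightarrow> 'b::{banach,real_normed_field}"
  assumes "smooth f"
  shows "pd i (\<lambda>x. exp (f x)) = (\<lambda>x. exp (f x) * pd i f x)"
proof
  fix x
  have "((\<lambda>x. exp (f x)) has_derivative (\<lambda>v. exp (f x) * frechet_derivative f (at x) v)) (at x)"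
    by (rule has_derivative_compose[OF smooth_has_derivative[OF assms]])
       (use DERIV_exp in \<open>simp add: has_field_derivative_def\<close>)
  then show "pd i (\<lambda>x. exp (f x)) x = exp (f x) * pd i f x"
    using partial_derivI by (fastforce simp: partial_deriv_def)
qed

lemma pd_ln [pd_simps]:
  fixes f :: "real^2 \<Rightarrow> real"
  assumes "\<And>x. f x > 0" "smooth f"
  shows "pd i (\<lambda>x. ln (f x)) = (\<lambda>x. pd i f x / f x)"
proof
  fix x
  have "((\<lambda>x. ln (f x)) has_derivative (\<lambda>v. inverse (f x) * frechet_derivative f (at x) v)) (at x)"
    by (rule has_derivative_compose[OF smooth_has_derivative[OF assms(2)]])
       (use DERIV_ln[OF assms(1)[of x]] in \<open>simp add: has_field_derivative_def\<close>)
  then show "pd i (\<lambda>x. ln (f x)) x = pd i f x / f x"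
    using partial_derivI by (fastforce simp: partial_deriv_def divide_inverse mult.commute)
qed

lemma pd_divide [pd_simps]:
  fixes f :: "real^2 \<Rightarrow> 'b::real_normed_field"
  assumes "\<And>x. g x \<noteq> 0" "smooth f" "smooth g"
  shows "pd i (\<lambda>x. f x / g x) = (\<lambda>x. (pd i f x * g x - f x * pd i g x) / (g x)\<^sup>2)"
proof
  fix x
  note d = has_derivative_divide[OF smooth_has_derivative[OF assms(2)] smooth_has_derivative[OF assms(3)] assms(1)]
  show "pd i (\<lambda>x. f x / g x) x = (pd i f x * g x - f x * pd i g x) / (g x)\<^sup>2"
    unfolding partial_derivI[OF d] partial_deriv_def[of i f] partial_deriv_def[of i g]
    using assms(1)[of x] by (simp add: power2_eq_square divide_simps)
qed

section \<open>Integration along coordinate lines and symmetry of second derivatives\<close>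

lemma smooth_has_vector_derivative_line:
  fixes f :: "real^2 \<Rightarrow> 'b::real_normed_vector"
  assumes "smooth f"
  shows "((\<lambda>t. f (x + t *\<^sub>R axis i 1)) has_vector_derivative pd i f (x + t *\<^sub>R axis i 1)) (at t within S)"
proof -
  have "((\<lambda>t. x + t *\<^sub>R axis i 1) has_derivative (\<lambda>t. t *\<^sub>R axis i (1::real))) (at t within S)"
    by (auto intro!: derivative_eq_intros)
  then have "((\<lambda>t. f (x + t *\<^sub>R axis i 1)) has_derivative
     (\<lambda>s. frechet_derivative f (at (x + t *\<^sub>R axis i 1)) (s *\<^sub>R axis i 1))) (at t within S)"
    by (rule has_derivative_compose[OF _ smooth_has_derivative[OF assms]])
  moreover have "linear (frechet_derivative f (at (x + t *\<^sub>R axis i 1)))"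
    using smooth_differentiable[OF assms] by (rule linear_frechet_derivative)
  ultimately show ?thesis
    by (simp add: has_vector_derivative_def partial_deriv_def linear_cmul)
qed

lemma integral_partial_line:
  fixes f :: "real^2 \<Rightarrow> 'b::euclidean_space"
  assumes "smooth f" "a \<le> b"
  shows "integral {a..b} (\<lambda>t. pd i f (x + t *\<^sub>R axis i 1))
    = f (x + b *\<^sub>R axis i 1) - f (x + a *\<^sub>R axis i 1)"
  by (rule integral_unique, rule fundamental_theorem_of_calculus[OF assms(2)])
     (rule smooth_has_vector_derivative_line[OF assms(1)])

text \<open>The increment of \<open>f\<close> in direction \<open>i\<close> is the integral of
  \<open>pd i f\<close>. Differentiating it in direction \<open>j\<close> under the integral sign,
  and afterwards in the length \<open>u\<close> of the increment at 0, produces both orders of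
  differentiation.\<close>

lemma pd_swap:
  fixes f :: "real^2 \<Rightarrow> 'b::euclidean_space"
  assumes "smooth f"
  shows "pd i (pd j f) = pd j (pd i f)"
proof
  fix x :: "real^2"
  let ?p = "\<lambda>s t. x + t *\<^sub>R axis j 1 + s *\<^sub>R axis i (1::real)"
  define F where "F = (\<lambda>t. integral {0..1} (\<lambda>s. pd i f (?p s t)))"
  have p1: "?p s t = x + s *\<^sub>R axis i 1 + t *\<^sub>R axis j 1" for s t by (simp add: algebra_simps)
  have D: "integral (cbox 0 u) (\<lambda>s. pd j (pd i f) (?p s 0)) =
      pd j f (x + u *\<^sub>R axis i 1) - pd j f x" if "u \<ge> 0" for u :: real
  proof -
    have "((\<lambda>t. integral (cbox 0 u) (\<lambda>s. pd i f (?p s t))) has_vector_derivative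
       integral (cbox 0 u) (\<lambda>s. pd j (pd i f) (?p s 0))) (at 0 within UNIV)"
    proof (rule leibniz_rule_vector_derivative)
      show "((\<lambda>t. pd i f (?p s t)) has_vector_derivative pd j (pd i f) (?p s t)) (at t within UNIV)" for t s
        unfolding p1 by (rule smooth_has_vector_derivative_line) (intro smooth_intros assms)
      show "(\<lambda>s. pd i f (?p s t)) integrable_on cbox 0 u" for t
        by (rule integrable_continuous, rule smooth_continuous_on_compose)
           (intro smooth_intros assms continuous_intros)+
      show "continuous_on (UNIV \<times> cbox 0 u) (\<lambda>(t, s). pd j (pd i f) (?p s t))"
        unfolding split_def
        by (rule smooth_continuous_on_compose)
           (intro smooth_intros assms continuous_intros)+
    qed auto
    moreover have "(\<lambda>t. integral (cbox 0 u) (\<lambda>s. pd i f (?p s t))) =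
        (\<lambda>t. f (x + u *\<^sub>R axis i 1 + t *\<^sub>R axis j 1) - f (x + t *\<^sub>R axis j 1))"
      using integral_partial_line[OF assms \<open>u \<ge> 0\<close>] by (simp add: cbox_interval p1[symmetric])
    moreover have "((\<lambda>t. f (x + u *\<^sub>R axis i 1 + t *\<^sub>R axis j 1) - f (x + t *\<^sub>R axis j 1)) has_vector_derivative
       pd j f (x + u *\<^sub>R axis i 1 + 0 *\<^sub>R axis j 1) - pd j f (x + 0 *\<^sub>R axis j 1)) (at 0 within UNIV)"
      by (intro has_vector_derivative_diff smooth_has_vector_derivative_line assms)
    ultimately show ?thesis
      using vector_derivative_unique_at by fastforce
  qed
  have "((\<lambda>u. integral {0..u} (\<lambda>s. pd j (pd i f) (?p s 0))) has_vector_derivative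
      pd j (pd i f) (?p 0 0)) (at 0 within {0..1})"
    by (rule integral_has_vector_derivative, rule smooth_continuous_on_compose)
       (intro smooth_intros assms continuous_intros | simp)+
  then have I: "((\<lambda>u. integral {0..u} (\<lambda>s. pd j (pd i f) (?p s 0))) has_vector_derivative
      pd j (pd i f) x) (at 0 within {0..1})" by simp
  \<comment> \<open>The formula \<open>D\<close> holds for \<open>u \<ge> 0\<close> only, hence the
    one-sided derivative at the end point of \<open>{0..1}\<close>, which is still unique.\<close>
  have "((\<lambda>u. pd j f (x + u *\<^sub>R axis i 1) - pd j f x) has_vector_derivative
      pd j (pd i f) x) (at 0 within {0..1})"
    by (rule has_vector_derivative_transform[OF _ _ I]) (use D in \<open>auto simp: cbox_interval\<close>)
  moreover have "((\<lambda>u. pd j f (x + u *\<^sub>R axis i 1) - pd j f x) has_vector_derivative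
      pd i (pd j f) (x + 0 *\<^sub>R axis i 1) - 0) (at 0 within {0..1})"
    by (intro has_vector_derivative_diff smooth_has_vector_derivative_line smooth_intros assms has_vector_derivative_const)
  ultimately show "pd i (pd j f) x = pd j (pd i f) x"
    using vector_derivative_unique_within[of 0 "{0..1::real}"] by (auto simp: trivial_limit_within)
qed

section \<open>Integration of periodic functions\<close>

definition torus_smooth :: "(real^2 \<Rightarrow> 'b::real_normed_vector) \<Rightarrow> bool" where
  "torus_smooth f \<longleftrightarrow> smooth f \<and> periodic f"

named_theorems torus_intros

lemma torus_smoothD: "torus_smooth f \<Longrightarrow> smooth f" "torus_smooth f \<Longrightarrow> periodic f"
  by (auto simp: torus_smooth_def)

lemma periodicD: "periodic f \<Longrightarrow> n \<in> int_lattice \<Longrightarrow> f (x + n) = f x"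
  by (simp add: periodic_def)

lemma axis_in_int_lattice: "axis i 1 \<in> int_lattice"
  by (auto simp: int_lattice_def axis_def)

lemma pd_shift:
  fixes f :: "real^2 \<Rightarrow> 'b::real_normed_vector"
  assumes "smooth f"
  shows "pd i (\<lambda>x. f (x + n)) x = pd i f (x + n)"
proof -
  have "((\<lambda>x. x + n) has_derivative (\<lambda>v. v)) (at x)"
    by (auto intro!: derivative_eq_intros)
  from has_derivative_compose[OF this smooth_has_derivative[OF assms]]
  have "((\<lambda>x. f (x + n)) has_derivative frechet_derivative f (at (x + n))) (at x)" by simp
  from partial_derivI[OF this] show ?thesis by (simp add: partial_deriv_def)
qed

lemma torus_partial [torus_intros]:
  assumes "torus_smooth f" shows "torus_smooth (pd i f)"
proof -
  have "pd i f (x + n) = pd i f x" if "n \<in> int_lattice" for x n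
  proof -
    have "(\<lambda>x. f (x + n)) = f"
      using assms that by (auto simp: torus_smooth_def periodic_def)
    then show ?thesis using pd_shift[OF torus_smoothD(1)[OF assms], of i n x] by simp
  qed
  then show ?thesis using assms by (auto simp: torus_smooth_def periodic_def intro: smooth_intros)
qed

lemma torus_const [torus_intros]: "torus_smooth (\<lambda>x. c)"
  by (auto simp: torus_smooth_def periodic_def intro: smooth_intros)
lemma torus_add [torus_intros]: "torus_smooth f \<Longrightarrow> torus_smooth g \<Longrightarrow> torus_smooth (\<lambda>x. f x + g x)"
  by (auto simp: torus_smooth_def periodic_def intro: smooth_intros)
lemma torus_diff [torus_intros]: "torus_smooth f \<Longrightarrow> torus_smooth g \<Longrightarrow> torus_smooth (\<lambda>x. f x - g x)"
  by (auto simp: torus_smooth_def periodic_def intro: smooth_intros)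
lemma torus_minus [torus_intros]: "torus_smooth f \<Longrightarrow> torus_smooth (\<lambda>x. - f x)"
  by (auto simp: torus_smooth_def periodic_def intro: smooth_intros)
lemma torus_scaleR [torus_intros]: "torus_smooth f \<Longrightarrow> torus_smooth g \<Longrightarrow> torus_smooth (\<lambda>x. f x *\<^sub>R g x)"
  by (auto simp: torus_smooth_def periodic_def intro: smooth_intros)
lemma torus_mult [torus_intros]:
  fixes f g :: "real^2 \<Rightarrow> 'b::real_normed_algebra"
  shows "torus_smooth f \<Longrightarrow> torus_smooth g \<Longrightarrow> torus_smooth (\<lambda>x. f x * g x)"
  by (auto simp: torus_smooth_def periodic_def intro: smooth_intros)
lemma torus_inner [torus_intros]: "torus_smooth f \<Longrightarrow> torus_smooth g \<Longrightarrow> torus_smooth (\<lambda>x. f x \<bullet> g x)"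
  by (auto simp: torus_smooth_def periodic_def intro: smooth_intros)
lemma torus_divide [torus_intros]:
  fixes f g :: "real^2 \<Rightarrow> 'b::real_normed_field"
  shows "(\<And>x. g x \<noteq> 0) \<Longrightarrow> torus_smooth f \<Longrightarrow> torus_smooth g \<Longrightarrow> torus_smooth (\<lambda>x. f x / g x)"
  by (auto simp: torus_smooth_def periodic_def intro: smooth_intros)
lemma torus_ln [torus_intros]:
  fixes f :: "real^2 \<Rightarrow> real"
  shows "(\<And>x. f x > 0) \<Longrightarrow> torus_smooth f \<Longrightarrow> torus_smooth (\<lambda>x. ln (f x))"
  by (auto simp: torus_smooth_def periodic_def intro: smooth_intros)
lemma torus_exp [torus_intros]:
  fixes f :: "real^2 \<Rightarrow> 'b::{banach,real_normed_field}"
  shows "torus_smooth f \<Longrightarrow> torus_smooth (\<lambda>x. exp (f x))"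
  by (auto simp: torus_smooth_def periodic_def intro: smooth_intros)
lemma torus_cnj [torus_intros]: "torus_smooth f \<Longrightarrow> torus_smooth (\<lambda>x. cnj (f x))"
  by (auto simp: torus_smooth_def periodic_def intro: smooth_intros)
lemma torus_Re [torus_intros]: "torus_smooth f \<Longrightarrow> torus_smooth (\<lambda>x. Re (f x))"
  by (auto simp: torus_smooth_def periodic_def intro: smooth_intros)
lemma torus_Im [torus_intros]: "torus_smooth f \<Longrightarrow> torus_smooth (\<lambda>x. Im (f x))"
  by (auto simp: torus_smooth_def periodic_def intro: smooth_intros)
lemma torus_of_real [torus_intros]: "torus_smooth f \<Longrightarrow> torus_smooth (\<lambda>x. complex_of_real (f x))"
  by (auto simp: torus_smooth_def periodic_def intro: smooth_intros)
lemma torus_power [torus_intros]: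
  fixes f :: "real^2 \<Rightarrow> 'b::real_normed_field"
  shows "torus_smooth f \<Longrightarrow> torus_smooth (\<lambda>x. f x ^ n)"
  by (auto simp: torus_smooth_def periodic_def intro: smooth_intros)
lemma torus_sum [torus_intros]: "(\<And>i. i \<in> I \<Longrightarrow> torus_smooth (f i)) \<Longrightarrow> torus_smooth (\<lambda>x. \<Sum>i\<in>I. f i x)"
  by (auto simp: torus_smooth_def periodic_def intro!: smooth_intros)

section \<open>Integrals over the fundamental square\<close>

definition plane_pt :: "real \<Rightarrow> real \<Rightarrow> real^2" where
  "plane_pt s t = s *\<^sub>R axis 1 1 + t *\<^sub>R axis 2 1"

lemma plane_pt_nth [simp]: "plane_pt s t $ 1 = s" "plane_pt s t $ 2 = t"
  by (simp_all add: plane_pt_def axis_def)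

lemma plane_pt_eta [simp]: "plane_pt (v$1) (v$2) = v"
  using vec2_axis[of v] by (simp add: plane_pt_def)

lemma plane_pt_in_cbox [simp]: "plane_pt s t \<in> cbox (plane_pt a b) (plane_pt c d) \<longleftrightarrow> s \<in> {a..c} \<and> t \<in> {b..d}"
  by (auto simp: mem_box_cart forall_2)

lemma continuous_on_plane_pt [continuous_intros]:
  "continuous_on S f \<Longrightarrow> continuous_on S g \<Longrightarrow> continuous_on S (\<lambda>x. plane_pt (f x) (g x))"
  unfolding plane_pt_def by (intro continuous_intros)

lemma int_lattice_reduce:
  fixes x :: "real^2"
  obtains n where "n \<in> int_lattice" "x + n \<in> cbox 0 1"
proof
  let ?n = "(\<chi> i. - of_int \<lfloor>x $ i\<rfloor>) :: real^2"
  show "?n \<in> int_lattice" by (simp add: int_lattice_def)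
  show "x + ?n \<in> cbox 0 1"
    unfolding mem_box_cart by auto linarith
qed

definition tint :: "(real^2 \<Rightarrow> 'b::euclidean_space) \<Rightarrow> 'b" where
  "tint f = integral (cbox 0 1) f"

text \<open>The volume-preserving map \<open>plane_pt\<close> transports the integral from
  \<open>real^2\<close> to a product of two lines, where iterated integration applies.\<close>

lemma tint_fubini:
  fixes f :: "real^2 \<Rightarrow> 'b::euclidean_space"
  assumes f: "continuous_on UNIV f"
  shows "tint f = integral {0..1} (\<lambda>s. integral {0..1} (\<lambda>t. f (plane_pt s t)))"
proof -
  let ?g = "\<lambda>(s, t). plane_pt s t" and ?h = "\<lambda>v::real^2. (v$1, v$2)"
  have g: "?g ` cbox (a, b) (c, d) = cbox (plane_pt a b) (plane_pt c d)" for a b c d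
  proof (intro equalityI subsetI)
    fix v assume "v \<in> cbox (plane_pt a b) (plane_pt c d)"
    then have "v = ?g (?h v)" "?h v \<in> cbox (a, b) (c, d)"
      by (auto simp: mem_box_cart forall_2)
    then show "v \<in> ?g ` cbox (a, b) (c, d)" by blast
  qed auto
  have h: "?h ` cbox u v = cbox (?h u) (?h v)" for u v
    using arg_cong[where f="image ?h", OF g[of "u$1" "u$2" "v$1" "v$2"]] by (auto simp: image_image split_def)
  have content: "measure lborel (?g ` cbox u v) = 1 * measure lborel (cbox u v)" for u v
  proof -
    obtain a b c d where uv: "u = (a, b)" "v = (c, d)" by (cases u, cases v)
    have ex2: "(\<exists>i::2. P i) \<longleftrightarrow> P 1 \<or> P 2" for P by (metis exhaust_2)
    show ?thesis unfolding uv g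
      by (auto simp: content_Pair content_cbox_if_cart interval_ne_empty_cart interval_eq_empty_cart UNIV_2 ex2 forall_2 not_less content_real_if)
  qed
  have "(f has_integral tint f) (cbox 0 1)"
    using integrable_continuous[OF continuous_on_subset[OF f]] by (auto simp: tint_def has_integral_integral)
  then have "((\<lambda>x. f (?g x)) has_integral (1 / 1) *\<^sub>R tint f) (?h ` cbox 0 1)"
  proof (rule has_integral_twiddle[rotated -1])
    show "isCont ?g x" for x
    proof -
      have "continuous_on UNIV ?g" unfolding split_def by (intro continuous_intros)
      then show ?thesis using continuous_on_eq_continuous_at[OF open_UNIV, of ?g] by blast
    qed
    show "\<exists>w z. ?g ` cbox u v = cbox w z" for u v
      using g by (cases u, cases v) blast
    show "\<exists>w z. ?h ` cbox u v = cbox w z" for u v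
      using h by blast
    show "measure lborel (?g ` cbox u v) = 1 * measure lborel (cbox u v)" for u v
      by (rule content)
  qed auto
  then have "integral (cbox (0,0) (1,1)) (\<lambda>x. f (?g x)) = tint f"
    unfolding h by (simp add: integral_unique)
  moreover have "continuous_on (cbox (0,0) (1,1)) (\<lambda>x. f (?g x))"
    unfolding split_def by (rule continuous_on_compose2[OF f]) (auto intro!: continuous_intros)
  ultimately show ?thesis
    using integral_prod_continuous[of 0 0 1 1 "\<lambda>x. f (?g x)"] by (simp add: cbox_interval)
qed

lemma tint_fubini':
  fixes f :: "real^2 \<Rightarrow> 'b::euclidean_space"
  assumes f: "continuous_on UNIV f"
  shows "tint f = integral {0..1} (\<lambda>t. integral {0..1} (\<lambda>s. f (plane_pt s t)))"
proof -
  have "continuous_on (cbox (0,0) (1,1)) (\<lambda>(s,t). f (plane_pt s t))"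
    unfolding split_def by (rule continuous_on_compose2[OF f]) (auto intro!: continuous_intros)
  from integral_swap_continuous[OF this] show ?thesis
    by (simp add: tint_fubini[OF f] cbox_interval)
qed

text \<open>Integrating first in direction \<open>i\<close> leaves the difference of two values one
  period apart. This is Stokes' theorem on the torus and the source of every integration by parts
  below.\<close>

lemma tint_partial:
  fixes f :: "real^2 \<Rightarrow> 'b::euclidean_space"
  assumes "torus_smooth f"
  shows "tint (pd i f) = 0"
proof -
  note sm = torus_smoothD(1)[OF assms]
  have c: "continuous_on UNIV (pd i f)"
    by (intro smooth_continuous_on smooth_intros sm)
  have per: "f (x + axis j 1) = f x" for x j
    using periodicD[OF torus_smoothD(2)[OF assms] axis_in_int_lattice] .
  have p: "plane_pt s t = t *\<^sub>R axis 2 1 + s *\<^sub>R axis 1 1" "plane_pt s t = s *\<^sub>R axis 1 1 + t *\<^sub>R axis 2 1" for s t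
    by (simp_all add: plane_pt_def)
  consider "i = 1" | "i = 2" using exhaust_2 by blast
  then show ?thesis
  proof cases
    case 1
    have "integral {0..1} (\<lambda>s. pd 1 f (plane_pt s t)) = 0" for t
      unfolding p(1) by (subst integral_partial_line[OF sm]) (auto simp: per)
    then show ?thesis using tint_fubini'[OF c] by (simp add: 1)
  next
    case 2
    have "integral {0..1} (\<lambda>t. pd 2 f (plane_pt s t)) = 0" for s
      unfolding p(2) by (subst integral_partial_line[OF sm]) (auto simp: per)
    then show ?thesis using tint_fubini[OF c] by (simp add: 2)
  qed
qed

lemma tint_integrable: "continuous_on UNIV f \<Longrightarrow> f integrable_on cbox (0::real^2) 1"
  for f :: "real^2 \<Rightarrow> 'b::euclidean_space"
  by (rule integrable_continuous) (auto intro: continuous_on_subset)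

lemma content_unit_square: "measure lborel (cbox (0::real^2) 1) = 1"
  by (simp add: content_cbox_if_cart interval_eq_empty_cart)

lemma tint_const [simp]: "tint (\<lambda>x. c) = c"
  by (simp add: tint_def content_unit_square)

lemma tint_add: "continuous_on UNIV f \<Longrightarrow> continuous_on UNIV g \<Longrightarrow> tint (\<lambda>x. f x + g x) = tint f + tint g"
  unfolding tint_def by (intro integral_add tint_integrable)

lemma tint_diff: "continuous_on UNIV f \<Longrightarrow> continuous_on UNIV g \<Longrightarrow> tint (\<lambda>x. f x - g x) = tint f - tint g"
  unfolding tint_def by (intro integral_diff tint_integrable)

lemma tint_bounded_linear:
  fixes f :: "real^2 \<Rightarrow> 'b::euclidean_space" and L :: "'b \<Rightarrow> 'c::euclidean_space"
  assumes "bounded_linear L" "continuous_on UNIV f" shows "tint (\<lambda>x. L (f x)) = L (tint f)"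
  unfolding tint_def using integral_linear[OF tint_integrable[OF assms(2)] assms(1)] by (simp add: o_def)

lemma tint_cmult: "continuous_on UNIV f \<Longrightarrow> tint (\<lambda>x. c * f x) = c * tint f" for c :: complex
  by (rule tint_bounded_linear) (auto intro: bounded_linear_mult_right)

lemma tint_cmult_real: "tint (\<lambda>x. c * f x) = c * tint f" for c :: real
  by (simp add: tint_def)

lemma tint_mono:
  "continuous_on UNIV f \<Longrightarrow> continuous_on UNIV g \<Longrightarrow> (\<And>x. f x \<le> g x) \<Longrightarrow> tint f \<le> tint g"
  for f g :: "real^2 \<Rightarrow> real"
  unfolding tint_def by (intro integral_le tint_integrable)

lemma tint_nonneg: "continuous_on UNIV f \<Longrightarrow> (\<And>x. 0 \<le> f x) \<Longrightarrow> 0 \<le> tint f"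
  for f :: "real^2 \<Rightarrow> real"
  using tint_mono[of "\<lambda>x. 0" f] by simp

lemma tint_pos:
  fixes f :: "real^2 \<Rightarrow> real"
  assumes "continuous_on UNIV f" "\<And>x. 0 < f x" shows "0 < tint f"
proof -
  have "compact (cbox (0::real^2) 1)" "cbox (0::real^2) 1 \<noteq> {}"
    by (auto simp: interval_eq_empty_cart)
  from continuous_attains_inf[OF this continuous_on_subset[OF assms(1)]]
  obtain x0 where x0: "\<And>y. y \<in> cbox 0 1 \<Longrightarrow> f x0 \<le> f y" by auto
  have "integral (cbox 0 1) (\<lambda>x::real^2. f x0) \<le> integral (cbox 0 1) f"
    by (rule integral_le) (use assms(1) x0 in \<open>auto intro: tint_integrable\<close>)
  then show ?thesis using assms(2)[of x0] by (simp add: tint_def content_unit_square)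
qed

text \<open>Producing a point where the maximum is attained, and not merely a bound, preserves
  strict inequalities: a pointwise \<open>cmod (\<mu> x) < 1\<close> becomes a uniform bound below
  1.\<close>

lemma torus_bounded:
  fixes f :: "real^2 \<Rightarrow> 'b::real_normed_vector"
  assumes "continuous_on UNIV f" "periodic f"
  obtains x0 where "\<And>x. norm (f x) \<le> norm (f x0)"
proof -
  have "compact (cbox (0::real^2) 1)" "cbox (0::real^2) 1 \<noteq> {}"
    by (auto simp: interval_eq_empty_cart)
  moreover have "continuous_on (cbox 0 1) (\<lambda>x. norm (f x))"
    using assms(1) by (intro continuous_intros) (auto intro: continuous_on_subset)
  ultimately obtain x0 where x0: "\<And>y. y \<in> cbox 0 1 \<Longrightarrow> norm (f y) \<le> norm (f x0)"
    using continuous_attains_sup by metis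
  have "norm (f x) \<le> norm (f x0)" for x
    using int_lattice_reduce[of x] x0 periodicD[OF assms(2)] by metis
  then show ?thesis using that by blast
qed

section \<open>The mean square norm and Sobolev bounds on the torus\<close>

definition l2norm :: "(real^2 \<Rightarrow> complex) \<Rightarrow> real" where
  "l2norm f = sqrt (tint (\<lambda>x. (cmod (f x))\<^sup>2))"

lemma l2norm_nonneg: "continuous_on UNIV f \<Longrightarrow> 0 \<le> l2norm f"
  unfolding l2norm_def by (intro real_sqrt_ge_zero tint_nonneg continuous_intros) auto

lemma l2norm_sq: "continuous_on UNIV f \<Longrightarrow> (l2norm f)\<^sup>2 = tint (\<lambda>x. (cmod (f x))\<^sup>2)"
  unfolding l2norm_def by (intro real_sqrt_pow2 tint_nonneg continuous_intros) auto

lemma l2norm_mult_le: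
  assumes "continuous_on UNIV a" "continuous_on UNIV f" "\<And>x. cmod (a x) \<le> k"
  shows "l2norm (\<lambda>x. a x * f x) \<le> k * l2norm f"
proof -
  have k: "0 \<le> k" using assms(3)[of 0] norm_ge_zero order_trans by blast
  have "(l2norm (\<lambda>x. a x * f x))\<^sup>2 \<le> tint (\<lambda>x. k\<^sup>2 * (cmod (f x))\<^sup>2)"
    using assms by (subst l2norm_sq)
      (auto simp: norm_mult power_mult_distrib intro!: continuous_intros tint_mono mult_right_mono power_mono)
  also have "\<dots> = (k * l2norm f)\<^sup>2"
    using assms by (simp add: tint_cmult_real power_mult_distrib l2norm_sq)
  finally show ?thesis
    by (rule power2_le_imp_le) (use k l2norm_nonneg[OF assms(2)] in simp)
qed

text \<open>Integrating the weighted inequality \<open>pt\<close> is sharp when \<open>A\<close> and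
  \<open>B\<close> are in the ratio of the two norms. The added \<open>e/2\<close> keeps both
  weights positive, so that no norm has to be assumed nonzero.\<close>

lemma l2norm_triangle:
  assumes f: "continuous_on UNIV f" and g: "continuous_on UNIV g"
  shows "l2norm (\<lambda>x. f x + g x) \<le> l2norm f + l2norm g"
proof (rule field_le_epsilon)
  fix e :: real assume e: "e > 0"
  define A B where "A = l2norm f + e/2" and "B = l2norm g + e/2"
  have AB: "A > 0" "B > 0" using e l2norm_nonneg[OF f] l2norm_nonneg[OF g] by (auto simp: A_def B_def)
  have pt: "(cmod (f x + g x))\<^sup>2 \<le> (1 + B/A) * (cmod (f x))\<^sup>2 + (1 + A/B) * (cmod (g x))\<^sup>2" for x
  proof -
    have "(cmod (f x + g x))\<^sup>2 \<le> (cmod (f x) + cmod (g x))\<^sup>2"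
      by (simp add: norm_triangle_ineq power_mono)
    moreover have "0 \<le> (B * cmod (f x) - A * cmod (g x))\<^sup>2 / (A * B)" using AB by simp
    moreover have "(B * cmod (f x) - A * cmod (g x))\<^sup>2 / (A * B) =
       B/A * (cmod (f x))\<^sup>2 + A/B * (cmod (g x))\<^sup>2 - 2 * cmod (f x) * cmod (g x)"
      using AB by (simp add: field_simps power2_eq_square)
    ultimately show ?thesis by (simp add: algebra_simps power2_sum)
  qed
  have "(l2norm (\<lambda>x. f x + g x))\<^sup>2 \<le> tint (\<lambda>x. (1 + B/A) * (cmod (f x))\<^sup>2 + (1 + A/B) * (cmod (g x))\<^sup>2)"
    using f g by (subst l2norm_sq) (intro continuous_intros tint_mono pt | assumption)+
  also have "\<dots> = (1 + B/A) * (l2norm f)\<^sup>2 + (1 + A/B) * (l2norm g)\<^sup>2"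
    using f g by (subst tint_add) (auto simp: tint_cmult_real l2norm_sq intro!: continuous_intros)
  also have "\<dots> \<le> (1 + B/A) * A\<^sup>2 + (1 + A/B) * B\<^sup>2"
    using AB e l2norm_nonneg[OF f] l2norm_nonneg[OF g]
    by (intro add_mono mult_left_mono power_mono) (auto simp: A_def B_def)
  also have "\<dots> = (A + B)\<^sup>2" using AB by (simp add: field_simps power2_eq_square)
  finally have "l2norm (\<lambda>x. f x + g x) \<le> A + B"
    by (rule power2_le_imp_le) (use AB in simp)
  then show "l2norm (\<lambda>x. f x + g x) \<le> l2norm f + l2norm g + e" by (simp add: A_def B_def)
qed

text \<open>Cauchy-Schwarz against the constant 1, obtained by integrating the square of
  \<open>cmod (f x) - c\<close> with \<open>c\<close> the mean of \<open>cmod (f x)\<close>.\<close>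

lemma l1_le_l2norm:
  assumes f: "continuous_on UNIV f"
  shows "tint (\<lambda>x. cmod (f x)) \<le> l2norm f"
proof -
  let ?c = "tint (\<lambda>x. cmod (f x))"
  have c: "continuous_on UNIV (\<lambda>x. cmod (f x))" using f by (intro continuous_intros)
  have "2 * ?c * ?c - ?c\<^sup>2 = tint (\<lambda>x. 2 * ?c * cmod (f x) - ?c\<^sup>2)"
    using c by (subst tint_diff) (auto simp: tint_cmult_real intro!: continuous_intros)
  also have "\<dots> \<le> tint (\<lambda>x. (cmod (f x))\<^sup>2)"
  proof (intro tint_mono continuous_intros c)
    fix x show "2 * ?c * cmod (f x) - ?c\<^sup>2 \<le> (cmod (f x))\<^sup>2"
      using zero_le_power2[of "cmod (f x) - ?c"] by (simp add: power2_diff algebra_simps)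
  qed (rule f)+
  finally have "?c\<^sup>2 \<le> (l2norm f)\<^sup>2" unfolding l2norm_sq[OF f] by (simp add: power2_eq_square)
  then show ?thesis using l2norm_nonneg[OF f] power2_le_imp_le by blast
qed

text \<open>By the fundamental theorem, \<open>cmod (h s)\<close> exceeds \<open>cmod (h t)\<close>
  by at most the integral of \<open>cmod (h' t)\<close>, for every \<open>t\<close>; averaging over
  \<open>t\<close> gives the bound.\<close>

lemma sobolev_1d:
  fixes h h' :: "real \<Rightarrow> complex"
  assumes h: "\<And>t. (h has_vector_derivative h' t) (at t)" and h': "continuous_on UNIV h'" and s: "s \<in> {0..1}"
  shows "cmod (h s) \<le> integral {0..1} (\<lambda>t. cmod (h t) + cmod (h' t))"
proof -
  have ch: "continuous_on S h" for S
    using h by (meson continuous_at_imp_continuous_on has_vector_derivative_continuous)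
  have ch': "continuous_on S h'" for S using h' continuous_on_subset by blast
  let ?I = "integral {0..1} (\<lambda>t. cmod (h' t))"
  have sub: "cmod (h b - h a) \<le> ?I" if "0 \<le> a" "a \<le> b" "b \<le> 1" for a b
  proof -
    have "(h' has_integral h b - h a) {a..b}"
      by (rule fundamental_theorem_of_calculus) (use that h in \<open>auto intro: has_vector_derivative_at_within\<close>)
    then have "h b - h a = integral {a..b} h'" by (simp add: integral_unique)
    also have "cmod \<dots> \<le> integral {a..b} (\<lambda>t. cmod (h' t))"
      by (rule integral_norm_bound_integral) (auto intro!: integrable_continuous_interval continuous_intros ch')
    also have "\<dots> \<le> ?I"
      by (rule integral_subset_le) (use that in \<open>auto intro!: integrable_continuous_interval continuous_intros ch'\<close>)
    finally show ?thesis .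
  qed
  have "cmod (h s) \<le> cmod (h t) + ?I" if t: "t \<in> {0..1}" for t
  proof -
    have "cmod (h s - h t) \<le> ?I"
      using sub[of s t] sub[of t s] s t by (cases "s \<le> t") (auto simp: norm_minus_commute)
    then show ?thesis using norm_triangle_ineq2[of "h s" "h t"] by linarith
  qed
  then have "integral {0..1::real} (\<lambda>t. cmod (h s)) \<le> integral {0..1} (\<lambda>t. cmod (h t) + ?I)"
    by (intro integral_le) (auto intro!: integrable_continuous_interval continuous_intros ch)
  also have "\<dots> = integral {0..1} (\<lambda>t. cmod (h t)) + ?I"
    by (subst integral_add) (auto intro!: integrable_continuous_interval continuous_intros ch)
  also have "\<dots> = integral {0..1} (\<lambda>t. cmod (h t) + cmod (h' t))"
    by (subst integral_add) (auto intro!: integrable_continuous_interval continuous_intros ch ch')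
  finally show ?thesis by simp
qed

text \<open>The one-dimensional bound is applied in each variable in turn. Only one mixed second
  derivative appears, so norms of order 2 control the supremum.\<close>

lemma sobolev_2d:
  assumes f: "torus_smooth f"
  shows "cmod (f x) \<le> l2norm f + l2norm (pd 1 f) + l2norm (pd 2 f)
    + l2norm (pd 1 (pd 2 f))"
proof -
  define D where "D = pd 2 f"
  have sD: "smooth D" and sf: "smooth f" using f by (auto simp: D_def torus_smooth_def intro: smooth_intros)
  have cont: "continuous_on S (\<lambda>y. g (k y))" if "smooth g" "continuous_on S k" for S :: "'a::topological_space set" and g :: "real^2 \<Rightarrow> complex" and k
    using that by (rule smooth_continuous_on_compose)
  obtain n where n: "n \<in> int_lattice" "x + n \<in> cbox 0 1" by (rule int_lattice_reduce)
  define s t where "s = (x + n) $ 1" and "t = (x + n) $ 2"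
  have st: "s \<in> {0..1}" "t \<in> {0..1}" using n(2) by (auto simp: s_def t_def mem_box_cart)
  have pp: "plane_pt u v = v *\<^sub>R axis 2 1 + u *\<^sub>R axis 1 1" "plane_pt u v = u *\<^sub>R axis 1 1 + v *\<^sub>R axis 2 1" for u v
    by (simp_all add: plane_pt_def)
  have d1: "((\<lambda>u. g (plane_pt u v)) has_vector_derivative pd 1 g (plane_pt u v)) (at u)"
    if "smooth g" for g :: "real^2 \<Rightarrow> complex" and u v
    unfolding pp(1) by (rule smooth_has_vector_derivative_line[OF that])
  have d2: "((\<lambda>v. g (plane_pt u v)) has_vector_derivative pd 2 g (plane_pt u v)) (at v)"
    if "smooth g" for g :: "real^2 \<Rightarrow> complex" and u v
    unfolding pp(2) by (rule smooth_has_vector_derivative_line[OF that])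
  have b1: "cmod (g (plane_pt s v)) \<le> integral {0..1} (\<lambda>u. cmod (g (plane_pt u v)) + cmod (pd 1 g (plane_pt u v)))"
    if "smooth g" for g v
    by (rule sobolev_1d[OF d1[OF that] _ st(1)]) (intro cont continuous_intros smooth_intros that)
  let ?F = "\<lambda>g y. cmod (g y) + cmod (pd 1 g y)"
  have cF: "continuous_on UNIV (?F g)" if "smooth g" for g
    using cont[OF that continuous_on_id] cont[OF smooth_partial[OF that] continuous_on_id] by (intro continuous_intros) auto
  have cF': "continuous_on S (\<lambda>y. ?F g (k y))" if "smooth g" "continuous_on S k" for S :: "real set" and g k
    using cont[OF that] cont[OF smooth_partial[OF that(1)] that(2)] by (intro continuous_intros) auto
  have cI: "continuous_on {0..1} (\<lambda>v. integral {0..1} (\<lambda>u. ?F g (plane_pt u v)))" if "smooth g" for g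
  proof -
    have "continuous_on (cbox 0 1) (\<lambda>v. integral (cbox 0 1) (\<lambda>u. ?F g (plane_pt u v)))"
      by (rule integral_continuous_on_param)
         (unfold split_def, rule continuous_on_compose2[OF cF[OF that]], auto intro!: continuous_intros)
    then show ?thesis by (simp add: cbox_interval)
  qed
  have "cmod (f x) = cmod (f (plane_pt s t))"
    using periodicD[OF torus_smoothD(2)[OF f] n(1)] by (simp add: s_def t_def del: vector_add_component)
  also have "\<dots> \<le> integral {0..1} (\<lambda>v. cmod (f (plane_pt s v)) + cmod (D (plane_pt s v)))"
    unfolding D_def
    by (rule sobolev_1d[OF d2[OF sf] _ st(2)]) (intro cont continuous_intros smooth_intros sf)
  also have "\<dots> \<le> integral {0..1} (\<lambda>v. integral {0..1} (\<lambda>u. ?F f (plane_pt u v)) + integral {0..1} (\<lambda>u. ?F D (plane_pt u v)))"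
    by (intro integral_le integrable_continuous_interval continuous_intros add_mono b1 sf sD cI cont)
  also have "\<dots> = tint (?F f) + tint (?F D)"
    using tint_fubini'[OF cF[OF sf]] tint_fubini'[OF cF[OF sD]]
    by (subst integral_add) (auto intro!: integrable_continuous_interval cI sf sD)
  also have "tint (?F f) \<le> l2norm f + l2norm (pd 1 f)"
    using sf by (subst tint_add) (intro add_mono l1_le_l2norm smooth_continuous_on smooth_intros continuous_on_norm | assumption)+
  also have "tint (?F D) \<le> l2norm D + l2norm (pd 1 D)"
    using sD by (subst tint_add) (intro add_mono l1_le_l2norm smooth_continuous_on smooth_intros continuous_on_norm | assumption)+
  finally show ?thesis by (simp add: D_def)
qed

section \<open>Fourier series and the Cauchy-Riemann operator on the flat torus\<close>

fun iter_partial :: "2 list \<Rightarrow> (real^2 \<Rightarrow> 'b::real_normed_vector) \<Rightarrow> real^2 \<Rightarrow> 'b" where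
  "iter_partial [] f = f"
| "iter_partial (i # is) f = iter_partial is (pd i f)"

text \<open>Each list of derivatives may have its own Weierstrass majorant. This makes the condition
  stable under differentiating all terms, and it allows contraction rates that depend on the order
  of differentiation.\<close>

definition C_inf_summable :: "(nat \<Rightarrow> real^2 \<Rightarrow> complex) \<Rightarrow> bool" where
  "C_inf_summable u \<longleftrightarrow> (\<forall>n. smooth (u n)) \<and>
     (\<forall>is. \<exists>M. summable M \<and> (\<forall>n x. norm (iter_partial is (u n) x) \<le> M n))"

lemma C_inf_summable_partial:
  assumes "C_inf_summable u" shows "C_inf_summable (\<lambda>n. pd i (u n))"
  unfolding C_inf_summable_def
proof (intro conjI allI)
  show "smooth (pd i (u n))" for n
    using assms by (auto simp: C_inf_summable_def intro: smooth_intros)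
  show "\<exists>M. summable M \<and> (\<forall>n x. norm (iter_partial is (pd i (u n)) x) \<le> M n)" for "is"
    using assms unfolding C_inf_summable_def by (metis iter_partial.simps(2))
qed

lemma C_inf_summable_uniform_limit:
  assumes "C_inf_summable u"
  shows "uniform_limit UNIV (\<lambda>n x. \<Sum>k<n. u k x) (\<lambda>x. \<Sum>k. u k x) sequentially"
proof -
  obtain M where "summable M" "\<forall>n x. norm (iter_partial [] (u n) x) \<le> M n"
    using assms unfolding C_inf_summable_def by blast
  then show ?thesis by (intro Weierstrass_m_test) auto
qed

lemma C_inf_summable_summable:
  assumes "C_inf_summable u"
  shows "summable (\<lambda>k. u k x)"
proof -
  obtain M where M: "summable M" "\<forall>n x. norm (iter_partial [] (u n) x) \<le> M n"
    using assms unfolding C_inf_summable_def by blast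
  show ?thesis by (rule summable_comparison_test'[OF M(1)]) (use M(2) in auto)
qed

lemma C_inf_summable_has_derivative:
  assumes u: "C_inf_summable u"
  shows "((\<lambda>x. \<Sum>k. u k x) has_derivative
    (\<lambda>v. v$1 *\<^sub>R (\<Sum>k. pd 1 (u k) x) + v$2 *\<^sub>R (\<Sum>k. pd 2 (u k) x))) (at x)"
proof -
  let ?D = "\<lambda>i x. \<Sum>k. pd i (u k) x"
  let ?g = "\<lambda>x v::real^2. v$1 *\<^sub>R ?D 1 x + v$2 *\<^sub>R ?D 2 x"
  have "\<exists>g. \<forall>x\<in>UNIV. (\<lambda>n. u n x) sums g x \<and> (g has_derivative ?g x) (at x within UNIV)"
  proof (rule has_derivative_series[where x=0 and f=u and g'="?g" and l="\<Sum>n. u n 0" and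
        f'="\<lambda>n x v. v$1 *\<^sub>R pd 1 (u n) x + v$2 *\<^sub>R pd 2 (u n) x"])
    fix e :: real assume e: "e > 0"
    have "\<forall>\<^sub>F n in sequentially. \<forall>x\<in>UNIV. dist (\<Sum>k<n. pd i (u k) x) (?D i x) < e/2" for i
      by (rule uniform_limitD[OF C_inf_summable_uniform_limit[OF C_inf_summable_partial[OF u]]]) (use e in simp)
    from eventually_conj[OF this[of 1] this[of 2]]
    show "\<forall>\<^sub>F n in sequentially. \<forall>x\<in>UNIV. \<forall>h::real^2.
      norm ((\<Sum>i<n. h$1 *\<^sub>R pd 1 (u i) x + h$2 *\<^sub>R pd 2 (u i) x) - ?g x h) \<le> e * norm h"
    proof (rule eventually_mono, intro ballI allI)
      fix n x and h :: "real^2"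
      assume n: "(\<forall>x\<in>UNIV. dist (\<Sum>k<n. pd 1 (u k) x) (?D 1 x) < e/2) \<and>
                 (\<forall>x\<in>UNIV. dist (\<Sum>k<n. pd 2 (u k) x) (?D 2 x) < e/2)"
      let ?A = "(\<Sum>k<n. pd 1 (u k) x) - ?D 1 x" and ?B = "(\<Sum>k<n. pd 2 (u k) x) - ?D 2 x"
      have AB: "norm ?A \<le> e/2" "norm ?B \<le> e/2"
        using n by (auto simp: dist_norm intro: less_imp_le)
      have "(\<Sum>i<n. h$1 *\<^sub>R pd 1 (u i) x + h$2 *\<^sub>R pd 2 (u i) x) - ?g x h = h$1 *\<^sub>R ?A + h$2 *\<^sub>R ?B"
        by (simp add: sum.distrib scaleR_sum_right[symmetric] algebra_simps)
      also have "norm \<dots> \<le> \<bar>h$1\<bar> * norm ?A + \<bar>h$2\<bar> * norm ?B"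
        by (metis norm_triangle_ineq norm_scaleR)
      also have "\<dots> \<le> norm h * (e/2) + norm h * (e/2)"
        using AB component_le_norm_cart[of h 1] component_le_norm_cart[of h 2] by (intro add_mono mult_mono) auto
      finally show "norm ((\<Sum>i<n. h$1 *\<^sub>R pd 1 (u i) x + h$2 *\<^sub>R pd 2 (u i) x) - ?g x h) \<le> e * norm h"
        by (simp add: algebra_simps)
    qed
  next
    show "(u n has_derivative (\<lambda>v. v$1 *\<^sub>R pd 1 (u n) x + v$2 *\<^sub>R pd 2 (u n) x)) (at x within UNIV)" for n x
      using u by (intro smooth_has_derivative2) (auto simp: C_inf_summable_def)
    show "(\<lambda>n. u n 0) sums (\<Sum>n. u n 0)"
      by (rule summable_sums[OF C_inf_summable_summable[OF u]])
  qed auto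
  then obtain g where g: "\<And>x. (\<lambda>n. u n x) sums g x" "\<And>x. (g has_derivative ?g x) (at x)" by auto
  have "g = (\<lambda>x. \<Sum>k. u k x)" using g(1) sums_unique by blast
  then show ?thesis using g(2) by blast
qed

lemma pd_series:
  assumes "C_inf_summable u"
  shows "pd i (\<lambda>x. \<Sum>k. u k x) = (\<lambda>x. \<Sum>k. pd i (u k) x)"
proof
  fix x
  consider "i = 1" | "i = 2" using exhaust_2 by blast
  then show "pd i (\<lambda>x. \<Sum>k. u k x) x = (\<Sum>k. pd i (u k) x)"
    by cases (auto simp: partial_derivI[OF C_inf_summable_has_derivative[OF assms]] axis_def)
qed

lemma smooth_series:
  assumes "C_inf_summable u" shows "smooth (\<lambda>x. \<Sum>k. u k x)"
proof (rule smooth_coinduct2[where P="\<lambda>f. \<exists>u. C_inf_summable u \<and> f = (\<lambda>x. \<Sum>k. u k x)"])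
  show "\<exists>u'. C_inf_summable u' \<and> (\<lambda>x. \<Sum>k. u k x) = (\<lambda>x. \<Sum>k. u' k x)" using assms by blast
  show "f differentiable at x" if "\<exists>u. C_inf_summable u \<and> f = (\<lambda>x. \<Sum>k. u k x)" for f :: "real^2 \<Rightarrow> complex" and x
    using that C_inf_summable_has_derivative unfolding differentiable_def by blast
  show "\<exists>u. C_inf_summable u \<and> pd i f = (\<lambda>x. \<Sum>k. u k x)" if "\<exists>u. C_inf_summable u \<and> f = (\<lambda>x. \<Sum>k. u k x)" for f :: "real^2 \<Rightarrow> complex" and i
    using that pd_series C_inf_summable_partial by blast
qed

lemma torus_series:
  assumes "C_inf_summable u" "\<And>n. periodic (u n)" shows "torus_smooth (\<lambda>x. \<Sum>k. u k x)"
  using smooth_series[OF assms(1)] assms(2) by (auto simp: torus_smooth_def periodic_def)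

section \<open>Characters, Fourier coefficients and their decay\<close>

definition torus_char :: "int \<Rightarrow> int \<Rightarrow> real^2 \<Rightarrow> complex" where
  "torus_char a b x = exp (2 * pi * \<i> * (of_int a * of_real (x$1) + of_int b * of_real (x$2)))"

lemma torus_char_smooth: "smooth (torus_char a b)"
  unfolding torus_char_def[abs_def] by (intro smooth_intros)

lemma torus_char_mult: "torus_char a b x * torus_char c d x = torus_char (a + c) (b + d) x"
  by (simp add: torus_char_def exp_add[symmetric] algebra_simps)

lemma torus_char_0: "torus_char 0 0 x = 1"
  by (simp add: torus_char_def)

lemma norm_torus_char: "cmod (torus_char a b x) = 1"
  by (simp add: torus_char_def norm_exp)

lemma torus_char_cis: "torus_char a b x = cis (2 * pi * (of_int a * x$1 + of_int b * x$2))"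
  by (simp add: torus_char_def cis_conv_exp algebra_simps)

lemma torus_char_torus [torus_intros]: "torus_smooth (torus_char a b)"
proof -
  have "torus_char a b (x + n) = torus_char a b x" if n: "n \<in> int_lattice" for x n
  proof -
    obtain k l where kl: "n$1 = of_int k" "n$2 = of_int l"
      using n unfolding int_lattice_def by (metis (mono_tags) Ints_cases mem_Collect_eq)
    have "torus_char a b (x + n) = torus_char a b x * cis (2 * pi * of_int (a * k + b * l))"
      by (simp add: torus_char_cis kl cis_mult algebra_simps)
    also have "cis (2 * pi * of_int (a * k + b * l)) = 1"
      by (metis cis_multiple_2pi Ints_of_int)
    finally show ?thesis by simp
  qed
  then show ?thesis by (simp add: torus_smooth_def periodic_def torus_char_smooth)
qed

lemma pd_torus_char:
  "pd 1 (torus_char a b) = (\<lambda>x. 2 * pi * \<i> * of_int a * torus_char a b x)"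
  "pd 2 (torus_char a b) = (\<lambda>x. 2 * pi * \<i> * of_int b * torus_char a b x)"
proof -
  define L where "L x = 2 * pi * \<i> * (of_int a * of_real (x$1) + of_int b * of_real (x$2))" for x :: "real^2"
  have L: "bounded_linear L"
    unfolding L_def[abs_def]
    by (intro bounded_linear_compose[OF bounded_linear_mult_right] bounded_linear_add
        bounded_linear_compose[OF bounded_linear_of_real] bounded_linear_vec_nth)
  have c: "torus_char a b = (\<lambda>x. exp (L x))" by (simp add: torus_char_def L_def fun_eq_iff)
  have pd: "pd i (torus_char a b) = (\<lambda>x. torus_char a b x * L (axis i 1))" for i
    unfolding c pd_exp[OF smooth_linear[OF L]] pd_linear[OF L] ..
  show "pd 1 (torus_char a b) = (\<lambda>x. 2 * pi * \<i> * of_int a * torus_char a b x)"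
    unfolding pd by (simp add: L_def axis_def mult.commute)
  show "pd 2 (torus_char a b) = (\<lambda>x. 2 * pi * \<i> * of_int b * torus_char a b x)"
    unfolding pd by (simp add: L_def axis_def mult.commute)
qed

lemma torus_continuous: "torus_smooth f \<Longrightarrow> continuous_on S f"
  by (simp add: torus_smooth_def smooth_continuous_on)

lemma tint_torus_char: "tint (torus_char a b) = (if a = 0 \<and> b = 0 then 1 else 0)"
proof -
  have t0: "torus_char 0 0 = (\<lambda>x. 1)" by (simp add: torus_char_0 fun_eq_iff)
  have c: "tint (\<lambda>x. k * torus_char a b x) = k * tint (torus_char a b)" for k
    by (rule tint_cmult[OF torus_continuous[OF torus_char_torus]])
  have "2 * pi * \<i> * of_int a * tint (torus_char a b) = 0"
    using tint_partial[OF torus_char_torus, of 1 a b] unfolding pd_torus_char c .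
  moreover have "2 * pi * \<i> * of_int b * tint (torus_char a b) = 0"
    using tint_partial[OF torus_char_torus, of 2 a b] unfolding pd_torus_char c .
  ultimately show ?thesis by (auto simp: t0)
qed

definition fourier :: "(real^2 \<Rightarrow> complex) \<Rightarrow> int \<Rightarrow> int \<Rightarrow> complex" where
  "fourier f a b = tint (\<lambda>x. f x * torus_char (- a) (- b) x)"

lemma fourier_partial:
  assumes f: "torus_smooth f"
  shows "fourier (pd 1 f) a b = 2 * pi * \<i> * of_int a * fourier f a b"
    and "fourier (pd 2 f) a b = 2 * pi * \<i> * of_int b * fourier f a b"
proof -
  note sm = torus_smoothD(1)[OF f]
  have *: "0 = fourier (pd i f) a b - k * fourier f a b"
    if k: "pd i (torus_char (- a) (- b)) = (\<lambda>x. - k * torus_char (- a) (- b) x)" for i k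
  proof -
    have "0 = tint (pd i (\<lambda>x. f x * torus_char (- a) (- b) x))"
      by (rule tint_partial[symmetric]) (intro torus_intros f)
    also have "\<dots> = tint (\<lambda>x. pd i f x * torus_char (- a) (- b) x - k * (f x * torus_char (- a) (- b) x))"
      unfolding pd_mult[OF sm torus_char_smooth] k by (simp add: algebra_simps)
    also have "\<dots> = fourier (pd i f) a b - k * fourier f a b"
    proof -
      have "continuous_on UNIV (\<lambda>x. pd i f x * torus_char (- a) (- b) x)"
        and fc: "continuous_on UNIV (\<lambda>x. f x * torus_char (- a) (- b) x)"
        and "continuous_on UNIV (\<lambda>x. k * (f x * torus_char (- a) (- b) x))"
        by (intro torus_continuous torus_intros f)+
      then show ?thesis unfolding fourier_def
        by (simp only: tint_diff tint_cmult[OF fc])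
    qed
    finally show ?thesis .
  qed
  show "fourier (pd 1 f) a b = 2 * pi * \<i> * of_int a * fourier f a b"
    using *[of 1 "2 * pi * \<i> * of_int a"] unfolding pd_torus_char by simp
  show "fourier (pd 2 f) a b = 2 * pi * \<i> * of_int b * fourier f a b"
    using *[of 2 "2 * pi * \<i> * of_int b"] unfolding pd_torus_char by simp
qed

lemma fourier_diff: "torus_smooth f \<Longrightarrow> torus_smooth g \<Longrightarrow> fourier (\<lambda>x. f x - g x) a b = fourier f a b - fourier g a b"
  unfolding fourier_def left_diff_distrib
  by (rule tint_diff) (intro torus_continuous torus_intros; assumption)+

lemma fourier_cmult: "torus_smooth f \<Longrightarrow> fourier (\<lambda>x. c * f x) a b = c * fourier f a b"
  unfolding fourier_def mult.assoc
  by (rule tint_cmult) (intro torus_continuous torus_intros; assumption)+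

text \<open>The symbol of the differential operator composed of
  \<open>1 - \<partial>\<^sub>1\<^sup>2 / (4 pi\<^sup>2)\<close> and the same operator in the second
  variable. A product weight makes the sum of the reciprocals factorise.\<close>

definition fweight :: "int \<Rightarrow> int \<Rightarrow> real" where
  "fweight a b = (1 + (of_int a)\<^sup>2) * (1 + (of_int b)\<^sup>2)"

lemma fweight_ge_1: "1 \<le> fweight a b"
  using mult_mono[of 1 "1 + (of_int a)\<^sup>2" 1 "1 + (of_int b :: real)\<^sup>2"] by (simp add: fweight_def)

lemma fweight_ge:
  fixes a b :: int
  shows "\<bar>of_int a\<bar> \<le> fweight a b" "\<bar>of_int b\<bar> \<le> fweight a b"
proof -
  have *: "\<bar>c\<bar> \<le> 1 + c\<^sup>2" for c :: real
  proof -
    have "0 \<le> (\<bar>c\<bar> - 1)\<^sup>2 + \<bar>c\<bar>" by simp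
    then show ?thesis by (simp add: power2_diff)
  qed
  have "\<bar>of_int a\<bar> * 1 \<le> (1 + (of_int a)\<^sup>2) * (1 + (of_int b)\<^sup>2 :: real)"
    by (intro mult_mono *) auto
  then show "\<bar>of_int a\<bar> \<le> fweight a b" by (simp add: fweight_def)
  have "1 * \<bar>of_int b\<bar> \<le> (1 + (of_int a)\<^sup>2) * (1 + (of_int b)\<^sup>2 :: real)"
    by (intro mult_mono *) auto
  then show "\<bar>of_int b\<bar> \<le> fweight a b" by (simp add: fweight_def)
qed

text \<open>The operator \<open>L 1\<close> after \<open>L 2\<close> multiplies the Fourier
  coefficients by \<open>fweight\<close>, so each induction step trades one power of the weight for
  derivatives of \<open>f\<close>. What remains is the trivial bound by the supremum.\<close>

lemma fourier_decay:
  assumes "torus_smooth f"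
  shows "\<exists>C. \<forall>a b. fweight a b ^ m * cmod (fourier f a b) \<le> C"
  using assms
proof (induction m arbitrary: f)
  case 0
  obtain x0 where x0: "\<And>x. cmod (f x) \<le> cmod (f x0)"
    using torus_bounded[OF torus_continuous torus_smoothD(2)] 0 by blast
  have "cmod (fourier f a b) \<le> cmod (f x0)" for a b
  proof -
    have "cmod (fourier f a b) \<le> tint (\<lambda>x. cmod (f x0))"
      unfolding fourier_def tint_def
      by (rule integral_norm_bound_integral)
         (auto simp: norm_mult norm_torus_char x0 intro!: tint_integrable torus_continuous torus_intros 0 continuous_on_const)
    then show ?thesis by simp
  qed
  then show ?case by auto
next
  case (Suc m)
  define L where "L i g = (\<lambda>x. g x - (1 / (4 * of_real (pi\<^sup>2))) * pd i (pd i g) x)" for i and g :: "real^2 \<Rightarrow> complex"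
  have L: "torus_smooth (L i g)" if "torus_smooth g" for i g
    unfolding L_def by (intro torus_intros that)
  have F: "fourier (L i g) a b = fourier g a b - (1 / (4 * of_real (pi\<^sup>2))) * fourier (pd i (pd i g)) a b"
    if "torus_smooth g" for i g a b
    unfolding L_def using that by (simp only: fourier_diff fourier_cmult torus_partial torus_mult torus_const)
  have F1: "fourier (L 1 g) a b = (1 + (of_int a)\<^sup>2) * fourier g a b" if "torus_smooth g" for g a b
    unfolding F[OF that] fourier_partial[OF that] fourier_partial[OF torus_partial[OF that]]
    by (simp add: power2_eq_square field_simps)
  have F2: "fourier (L 2 g) a b = (1 + (of_int b)\<^sup>2) * fourier g a b" if "torus_smooth g" for g a b
    unfolding F[OF that] fourier_partial[OF that] fourier_partial[OF torus_partial[OF that]]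
    by (simp add: power2_eq_square field_simps)
  obtain C where C: "\<And>a b. fweight a b ^ m * cmod (fourier (L 1 (L 2 f)) a b) \<le> C"
    using Suc.IH[OF L[OF L[OF Suc.prems]]] by blast
  have "cmod (fourier (L 1 (L 2 f)) a b) = fweight a b * cmod (fourier f a b)" for a b
  proof -
    have "fourier (L 1 (L 2 f)) a b = of_real (fweight a b) * fourier f a b"
      by (simp add: F1[OF L[OF Suc.prems]] F2[OF Suc.prems] fweight_def)
    then show ?thesis using fweight_ge_1[of a b] by (simp add: norm_mult)
  qed
  then have "fweight a b ^ Suc m * cmod (fourier f a b) \<le> C" for a b
    using C[of a b] by (simp add: mult_ac)
  then show ?case by blast
qed

definition int_pair :: "nat \<Rightarrow> int \<times> int" where
  "int_pair n = map_prod int_decode int_decode (prod_decode n)"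

lemma int_pair_bij: "bij int_pair"
  unfolding int_pair_def[abs_def]
  using bij_comp[OF bij_prod_decode, of "map_prod int_decode int_decode"]
  by (simp add: o_def) (metis bij_betw_map_prod bij_int_decode UNIV_Times_UNIV)

lemma sum_inverse_squares_int:
  obtains K where "\<And>A. finite A \<Longrightarrow> (\<Sum>a\<in>A. 1 / (1 + (of_int a)\<^sup>2)) \<le> (K::real)"
proof
  let ?g = "\<lambda>n::nat. 1 / (1 + (real n)\<^sup>2)"
  let ?f = "\<lambda>a::int. 1 / (1 + (of_int a)\<^sup>2) :: real"
  have sg: "summable ?g"
  proof (rule summable_comparison_test')
    show "summable (\<lambda>n. 1 / (real n)\<^sup>2)" using inverse_power_summable[of 2, where 'a=real] by (simp add: divide_inverse)
    show "norm (?g n) \<le> 1 / (real n)\<^sup>2" if "n \<ge> 1" for n using that by (auto intro!: divide_left_mono mult_pos_pos add_pos_nonneg)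
  qed
  fix A :: "int set" assume A: "finite A"
  define N where "N = (\<lambda>a. nat \<bar>a\<bar>) ` A"
  have N: "finite N" using A by (simp add: N_def)
  have "A \<subseteq> int ` N \<union> (\<lambda>n. - int n) ` N"
  proof
    fix a assume "a \<in> A"
    then have "nat \<bar>a\<bar> \<in> N" by (auto simp: N_def)
    moreover have "a = int (nat \<bar>a\<bar>) \<or> a = - int (nat \<bar>a\<bar>)" by auto
    ultimately show "a \<in> int ` N \<union> (\<lambda>n. - int n) ` N" by blast
  qed
  then have "sum ?f A \<le> sum ?f (int ` N \<union> (\<lambda>n. - int n) ` N)"
    using N by (intro sum_mono2) auto
  also have "\<dots> \<le> sum ?f (int ` N) + sum ?f ((\<lambda>n. - int n) ` N)"
    using N by (subst sum_Un) (auto intro!: sum_nonneg)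
  also have "\<dots> = 2 * sum ?g N"
    by (subst (1 2) sum.reindex) (auto simp: inj_on_def o_def)
  also have "\<dots> \<le> 2 * suminf ?g"
    using sum_le_suminf[OF sg N] by auto
  finally show "sum ?f A \<le> 2 * suminf ?g" .
qed

text \<open>The first terms of the enumeration lie in a finite rectangle, namely the product of
  their projections, over which the sum is a product of two one-dimensional sums.\<close>

lemma summable_fweight: "summable (\<lambda>n. 1 / fweight (fst (int_pair n)) (snd (int_pair n)))"
proof -
  obtain K where K: "\<And>A. finite A \<Longrightarrow> (\<Sum>a\<in>A. 1 / (1 + (of_int a)\<^sup>2)) \<le> (K::real)"
    using sum_inverse_squares_int by blast
  let ?f = "\<lambda>a::int. 1 / (1 + (of_int a)\<^sup>2) :: real"
  let ?w = "\<lambda>p. 1 / fweight (fst p) (snd p)"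
  have K0: "K \<ge> 0" using K[of "{}"] by simp
  have w0: "?w p \<ge> 0" for p using fweight_ge_1[of "fst p" "snd p"] by simp
  show ?thesis
  proof (rule bounded_imp_summable)
    show "0 \<le> ?w (int_pair n)" for n by (rule w0)
    fix n
    let ?S = "int_pair ` {..n}"
    have "(\<Sum>k\<le>n. ?w (int_pair k)) = sum ?w ?S"
      by (subst sum.reindex) (auto intro: inj_on_subset[OF bij_is_inj[OF int_pair_bij]])
    also have "\<dots> \<le> sum ?w (fst ` ?S \<times> snd ` ?S)"
    proof (rule sum_mono2)
      show "?S \<subseteq> fst ` ?S \<times> snd ` ?S" by (rule subset_fst_snd)
    qed (use w0 in auto)
    also have "\<dots> = sum ?f (fst ` ?S) * sum ?f (snd ` ?S)"
      by (simp add: sum_product sum.cartesian_product split_def fweight_def)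
    also have "\<dots> \<le> K * K"
      using K0 by (intro mult_mono K) (auto intro!: sum_nonneg)
    finally show "(\<Sum>k\<le>n. ?w (int_pair k)) \<le> K * K" .
  qed
qed

lemma iter_partial_torus_char:
  "\<exists>K. cmod K \<le> (2 * pi * fweight a b) ^ length is \<and>
     (\<forall>k. iter_partial is (\<lambda>x. k * torus_char a b x) = (\<lambda>x. k * K * torus_char a b x))"
proof (induction "is")
  case Nil
  show ?case by (rule exI[of _ 1]) auto
next
  case (Cons i "is")
  then obtain K where K: "cmod K \<le> (2 * pi * fweight a b) ^ length is"
     "\<And>k. iter_partial is (\<lambda>x. k * torus_char a b x) = (\<lambda>x. k * K * torus_char a b x)" by blast
  define l where "l = (if i = 1 then 2 * pi * \<i> * of_int a else 2 * pi * \<i> * of_int b)"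
  have pd: "pd i (\<lambda>x. k * torus_char a b x) = (\<lambda>x. k * l * torus_char a b x)" for k
    using exhaust_2[of i]
    by (auto simp: pd_mult[OF smooth_const torus_char_smooth] pd_const pd_torus_char l_def mult_ac)
  have "cmod l \<le> 2 * pi * fweight a b"
    using fweight_ge[where a=a and b=b] by (auto simp: l_def norm_mult)
  then have "cmod (l * K) \<le> (2 * pi * fweight a b) ^ length (i # is)"
    using K(1) fweight_ge_1[of a b] by (auto simp: norm_mult intro!: mult_mono)
  moreover have "iter_partial (i # is) (\<lambda>x. k * torus_char a b x) = (\<lambda>x. k * (l * K) * torus_char a b x)" for k
    using K(2)[of "k * l"] by (simp add: pd mult_ac)
  ultimately show ?case by blast
qed

abbreviation torus_char_n :: "nat \<Rightarrow> real^2 \<Rightarrow> complex" where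
  "torus_char_n n \<equiv> torus_char (fst (int_pair n)) (snd (int_pair n))"

lemma C_inf_summable_fourier:
  assumes c: "\<And>m. \<exists>C. \<forall>a b. fweight a b ^ m * cmod (c a b) \<le> C"
  shows "C_inf_summable (\<lambda>n x. c (fst (int_pair n)) (snd (int_pair n)) * torus_char_n n x)"
  unfolding C_inf_summable_def
proof (intro conjI allI)
  fix "is" :: "2 list"
  let ?l = "length is"
  \<comment> \<open>One power of the weight more than there are derivatives:
    \<open>length is\<close> powers absorb the factor \<open>K\<close>, the last one supplies a
    summable majorant.\<close>
  obtain C where C: "\<And>a b. fweight a b ^ Suc ?l * cmod (c a b) \<le> C" using c by blast
  let ?M = "\<lambda>n. (2*pi) ^ ?l * C * (1 / fweight (fst (int_pair n)) (snd (int_pair n)))"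
  have "cmod (iter_partial is (\<lambda>x. c (fst (int_pair n)) (snd (int_pair n)) * torus_char_n n x) x) \<le> ?M n" for n x
  proof -
    define a b where "a = fst (int_pair n)" and "b = snd (int_pair n)"
    obtain K where K: "cmod K \<le> (2 * pi * fweight a b) ^ ?l"
      "iter_partial is (\<lambda>x. c a b * torus_char a b x) = (\<lambda>x. c a b * K * torus_char a b x)"
      using iter_partial_torus_char[of a b "is"] by blast
    have w: "fweight a b > 0" using fweight_ge_1[of a b] by simp
    have "cmod (c a b) * fweight a b ^ ?l \<le> C / fweight a b"
      using C[of a b] w by (simp add: field_simps)
    then have "(2*pi) ^ ?l * (cmod (c a b) * fweight a b ^ ?l) \<le> (2*pi) ^ ?l * (C / fweight a b)"
      by (intro mult_left_mono) auto
    moreover have "cmod (c a b) * cmod K \<le> cmod (c a b) * (2 * pi * fweight a b) ^ ?l"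
      using K(1) by (intro mult_left_mono) auto
    ultimately have "cmod (c a b * K * torus_char a b x) \<le> (2*pi) ^ ?l * C * (1 / fweight a b)"
      by (simp add: norm_mult norm_torus_char power_mult_distrib mult_ac)
    then show ?thesis using K(2) by (simp add: a_def b_def)
  qed
  moreover have "summable ?M" by (intro summable_mult summable_fweight)
  ultimately show "\<exists>M. summable M \<and> (\<forall>n x. cmod (iter_partial is (\<lambda>x. c (fst (int_pair n)) (snd (int_pair n)) * torus_char_n n x) x) \<le> M n)"
    by blast
qed (intro smooth_intros torus_char_smooth)

text \<open>Uniform convergence permits termwise integration, and orthogonality of the characters
  makes the integrals of the partial sums constant once the index \<open>k\<close> of the frequency
  has been passed.\<close>

lemma fourier_series_coeff:
  assumes c: "\<And>m. \<exists>C. \<forall>a b. fweight a b ^ m * cmod (c a b) \<le> C"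
  defines "u \<equiv> \<lambda>x. \<Sum>n. c (fst (int_pair n)) (snd (int_pair n)) * torus_char_n n x"
  shows "torus_smooth u" "fourier u a b = c a b"
proof -
  let ?c = "\<lambda>n. c (fst (int_pair n)) (snd (int_pair n))"
  note cs = C_inf_summable_fourier[of c, OF c]
  show "torus_smooth u" unfolding u_def
    by (rule torus_series[OF cs], rule torus_smoothD(2)) (intro torus_intros)
  obtain k where k: "int_pair k = (a, b)" using int_pair_bij by (metis bij_pointE)
  let ?p = "\<lambda>n x. (\<Sum>i<n. ?c i * torus_char_n i x) * torus_char (-a) (-b) x"
  have unif: "uniform_limit (cbox 0 1) ?p (\<lambda>x. u x * torus_char (-a) (-b) x) sequentially"
  proof (rule uniform_limitI)
    fix e :: real assume e: "e > 0"
    show "\<forall>\<^sub>F n in sequentially. \<forall>x\<in>cbox 0 1. dist (?p n x) (u x * torus_char (-a) (-b) x) < e"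
      using uniform_limitD[OF C_inf_summable_uniform_limit[OF cs] e]
      by (rule eventually_mono)
         (auto simp: u_def dist_norm left_diff_distrib[symmetric] norm_mult norm_torus_char)
  qed
  have cont: "continuous_on (cbox 0 1) (?p n)" for n
    by (intro torus_continuous torus_intros)
  obtain I J where IJ: "\<And>n. (?p n has_integral I n) (cbox 0 1)"
    "((\<lambda>x. u x * torus_char (-a) (-b) x) has_integral J) (cbox 0 1)" "(I \<longlongrightarrow> J) sequentially"
    by (rule uniform_limit_integral_cbox[OF unif cont sequentially_bot]) (rule that; assumption)
  have "I n = c a b" if n: "n > k" for n
  proof -
    have "I n = tint (?p n)" unfolding tint_def by (rule integral_unique[symmetric]) (rule IJ(1))
    also have "\<dots> = tint (\<lambda>x. \<Sum>i<n. ?c i * torus_char (fst (int_pair i) - a) (snd (int_pair i) - b) x)"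
      by (simp add: sum_distrib_right mult.assoc torus_char_mult)
    also have "\<dots> = (\<Sum>i<n. ?c i * tint (torus_char (fst (int_pair i) - a) (snd (int_pair i) - b)))"
      unfolding tint_def
      by (subst integral_sum) (auto intro!: tint_integrable torus_continuous torus_intros)
    also have "\<dots> = (\<Sum>i<n. if i = k then c a b else 0)"
    proof (rule sum.cong[OF refl])
      fix i
      have "fst (int_pair i) = a \<and> snd (int_pair i) = b \<longleftrightarrow> i = k"
        using k bij_is_inj[OF int_pair_bij] by (metis fst_conv injD prod.collapse snd_conv)
      then show "?c i * tint (torus_char (fst (int_pair i) - a) (snd (int_pair i) - b)) = (if i = k then c a b else 0)"
        using k by (auto simp: tint_torus_char)
    qed
    also have "\<dots> = c a b" using n by simp
    finally show ?thesis .
  qed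
  then have "(I \<longlongrightarrow> c a b) sequentially"
    by (intro tendsto_eventually) (auto simp: eventually_sequentially intro!: exI[of _ "Suc k"])
  then have "J = c a b" using IJ(3) LIMSEQ_unique by blast
  then show "fourier u a b = c a b"
    unfolding fourier_def tint_def using integral_unique[OF IJ(2)] by simp
qed

text \<open>A concentration argument. Vanishing coefficients make \<open>F\<close> orthogonal to all
  trigonometric polynomials, in particular to the powers of a real one, \<open>q\<close>, which
  exceeds 1 at \<open>x0\<close> and has modulus at most 1 wherever \<open>G\<close> is not clearly
  positive. Even powers of \<open>q\<close> then let the neighbourhood of \<open>x0\<close> dominate
  the integral, which cannot stay zero.\<close>

lemma fourier_unique:
  assumes F: "torus_smooth F" and F0: "\<And>a b. fourier F a b = 0"
  shows "F x0 = 0"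
proof (rule ccontr)
  assume nz: "F x0 \<noteq> 0"
  define G where "G x = Re (cnj (F x0) * F x)" for x
  define \<eta> where "\<eta> = G x0 / 2"
  have \<eta>: "\<eta> > 0" "G x0 = 2 * \<eta>"
    using nz by (auto simp: \<eta>_def G_def complex_neq_0 power2_eq_square[symmetric])
  have G: "torus_smooth G" unfolding G_def[abs_def] by (intro torus_intros F)
  obtain M where M: "\<And>x. \<bar>G x\<bar> \<le> M"
    using torus_bounded[OF torus_continuous[OF G] torus_smoothD(2)[OF G]] by (metis real_norm_def)
  define c where "c x = (cos (2 * pi * (x$1 - x0$1)) + cos (2 * pi * (x$2 - x0$2))) / 2" for x :: "real^2"
  have c_cont: "continuous_on S c" for S
    unfolding c_def[abs_def] by (intro continuous_intros) auto
  have c_eq1: "c x = 1 \<Longrightarrow> x - x0 \<in> int_lattice" for x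
  proof -
    assume "c x = 1"
    then have "cos (2 * pi * (x$1 - x0$1)) + cos (2 * pi * (x$2 - x0$2)) = 2" by (simp add: c_def)
    then have "cos (2 * pi * (x$1 - x0$1)) = 1 \<and> cos (2 * pi * (x$2 - x0$2)) = 1"
      using cos_le_one[of "2 * pi * (x$1 - x0$1)"] cos_le_one[of "2 * pi * (x$2 - x0$2)"] by linarith
    moreover have "cos (2 * pi * t) = 1 \<Longrightarrow> t \<in> \<int>" for t
      by (auto simp: cos_one_2pi_int algebra_simps)
    ultimately show ?thesis by (auto simp: int_lattice_def forall_2)
  qed
  have c_le: "c x \<le> 1" for x
  proof -
    have "cos (2 * pi * (x$1 - x0$1)) + cos (2 * pi * (x$2 - x0$2)) \<le> 1 + 1"
      by (intro add_mono cos_le_one)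
    then show ?thesis by (simp add: c_def)
  qed
  have c_ge: "- 1 \<le> c x" for x
  proof -
    have "- 1 + - 1 \<le> cos (2 * pi * (x$1 - x0$1)) + cos (2 * pi * (x$2 - x0$2))"
      by (intro add_mono cos_ge_minus_one)
    then show ?thesis by (simp add: c_def)
  qed
  define A where "A = {x \<in> cbox 0 1. G x \<le> \<eta>}"
  have "compact A"
  proof -
    have "closed {x. G x \<le> \<eta>}"
      by (intro closed_Collect_le torus_continuous G continuous_on_const)
    then have "compact (cbox 0 1 \<inter> {x. G x \<le> \<eta>})" by (intro compact_Int_closed) auto
    moreover have "cbox 0 1 \<inter> {x. G x \<le> \<eta>} = A" by (auto simp: A_def)
    ultimately show ?thesis by simp
  qed
  \<comment> \<open>\<open>c\<close> equals 1 only at lattice translates of \<open>x0\<close>, where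
    \<open>G\<close> is \<open>2 * \<eta>\<close>; hence its maximum on the compact set
    \<open>A\<close> is below 1. A gap of \<open>2 * \<delta>\<close> is kept so that
    \<open>q = \<delta> + c\<close> exceeds 1 at \<open>x0\<close> and is still at most
    \<open>1 - \<delta>\<close> on \<open>A\<close>.\<close>
  have "\<exists>\<delta>>0. \<delta> \<le> 1/2 \<and> (\<forall>x\<in>A. c x \<le> 1 - 2 * \<delta>)"
  proof (cases "A = {}")
    case False
    from continuous_attains_sup[OF \<open>compact A\<close> False c_cont] obtain y
      where y: "y \<in> A" "\<And>x. x \<in> A \<Longrightarrow> c x \<le> c y" by blast
    have "c y \<noteq> 1"
    proof
      assume "c y = 1"
      then have "G y = G x0" using periodicD[OF torus_smoothD(2)[OF G] c_eq1, of y x0] by simp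
      then show False using y(1) \<eta> by (simp add: A_def)
    qed
    then have "c y < 1" using c_le[of y] by simp
    have "c x \<le> 1 - 2 * ((1 - c y) / 4)" if "x \<in> A" for x
      using y(2)[OF that] \<open>c y < 1\<close> by (simp add: field_simps)
    then show ?thesis using \<open>c y < 1\<close> c_ge[of y] by (intro exI[of _ "(1 - c y) / 4"]) auto
  qed (auto intro: exI[of _ "1/2"])
  then obtain \<delta> where \<delta>: "\<delta> > 0" "\<delta> \<le> 1/2" "\<And>x. x \<in> A \<Longrightarrow> c x \<le> 1 - 2 * \<delta>" by blast
  define k1 k2 where "k1 = cis (- 2 * pi * x0$1)" and "k2 = cis (- 2 * pi * x0$2)"
  define Q where "Q x = of_real \<delta> + (k1 * torus_char 1 0 x + cnj k1 * torus_char (-1) 0 x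
     + k2 * torus_char 0 1 x + cnj k2 * torus_char 0 (-1) x) / 4" for x
  define q where "q x = \<delta> + c x" for x
  have Q: "torus_smooth Q" unfolding Q_def[abs_def] by (intro torus_intros) simp
  have cc: "cis t + cis (- t) = 2 * of_real (cos t)" for t
    by (simp add: complex_eq_iff)
  have Qq: "Q x = of_real (q x)" for x
  proof -
    have "k1 * torus_char 1 0 x + cnj k1 * torus_char (-1) 0 x = 2 * of_real (cos (2 * pi * (x$1 - x0$1)))"
      unfolding cc[symmetric] by (simp add: k1_def torus_char_cis cis_mult cis_cnj algebra_simps)
    moreover have "k2 * torus_char 0 1 x + cnj k2 * torus_char 0 (-1) x = 2 * of_real (cos (2 * pi * (x$2 - x0$2)))"
      unfolding cc[symmetric] by (simp add: k2_def torus_char_cis cis_mult cis_cnj algebra_simps)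
    ultimately have "Q x = of_real \<delta> + (2 * of_real (cos (2 * pi * (x$1 - x0$1))) + 2 * of_real (cos (2 * pi * (x$2 - x0$2)))) / 4"
      unfolding Q_def by (simp add: add.assoc)
    then show ?thesis by (simp add: q_def c_def)
  qed
  have q: "torus_smooth q"
  proof -
    have "q = (\<lambda>x. Re (Q x))" by (simp add: Qq)
    then show ?thesis by (simp only: torus_Re[OF Q])
  qed
  \<comment> \<open>Multiplication by \<open>Q\<close> only adds shifts of the frequency, so the
    induction must be over all \<open>a\<close> and \<open>b\<close> at once.\<close>
  have zero: "tint (\<lambda>x. F x * Q x ^ N * torus_char a b x) = 0" for N a b
  proof (induction N arbitrary: a b)
    case 0
    then show ?case using F0[of "-a" "-b"] by (simp add: fourier_def)
  next
    case (Suc N)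
    let ?H = "\<lambda>a b x. F x * Q x ^ N * torus_char a b x"
    have H: "torus_smooth (?H a b)" for a b by (intro torus_intros F Q)
    have "(\<lambda>x. F x * Q x ^ Suc N * torus_char a b x) = (\<lambda>x. of_real \<delta> * ?H a b x + (k1/4 * ?H (a+1) b x
        + (cnj k1 / 4 * ?H (a-1) b x + (k2/4 * ?H a (b+1) x + cnj k2 / 4 * ?H a (b-1) x))))"
    proof
      fix x
      have "F x * Q x ^ Suc N * torus_char a b x = (F x * Q x ^ N) * (of_real \<delta> * torus_char a b x
         + (k1/4 * (torus_char 1 0 x * torus_char a b x) + (cnj k1 / 4 * (torus_char (-1) 0 x * torus_char a b x)
         + (k2/4 * (torus_char 0 1 x * torus_char a b x) + cnj k2 / 4 * (torus_char 0 (-1) x * torus_char a b x)))))"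
        by (simp add: Q_def field_simps)
      then show "F x * Q x ^ Suc N * torus_char a b x = of_real \<delta> * ?H a b x + (k1/4 * ?H (a+1) b x
        + (cnj k1 / 4 * ?H (a-1) b x + (k2/4 * ?H a (b+1) x + cnj k2 / 4 * ?H a (b-1) x)))"
        unfolding torus_char_mult by (simp add: algebra_simps)
    qed
    moreover have "tint (\<lambda>x. k * ?H a b x) = 0" for k a b
      using tint_cmult[OF torus_continuous[OF H]] Suc.IH by simp
    ultimately show ?case
      by (simp only: tint_add[OF torus_continuous torus_continuous] torus_intros H) simp
  qed
  have tz: "tint (\<lambda>x. G x * q x ^ N) = 0" for N
  proof -
    have "G x * q x ^ N = Re (cnj (F x0) * (F x * Q x ^ N * torus_char 0 0 x))" for x
      by (simp add: G_def Qq torus_char_0 mult.assoc[symmetric] del: of_real_power flip: of_real_power)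
    then have "tint (\<lambda>x. G x * q x ^ N) = Re (tint (\<lambda>x. cnj (F x0) * (F x * Q x ^ N * torus_char 0 0 x)))"
      by (simp only:) (rule tint_bounded_linear[OF bounded_linear_Re], intro torus_continuous torus_intros F Q)
    also have "tint (\<lambda>x. cnj (F x0) * (F x * Q x ^ N * torus_char 0 0 x)) = cnj (F x0) * tint (\<lambda>x. F x * Q x ^ N * torus_char 0 0 x)"
      by (rule tint_cmult, intro torus_continuous torus_intros F Q)
    finally show ?thesis by (simp add: zero)
  qed
  define h where "h x = max 0 (q x - 1)" for x
  have h_cont: "continuous_on S h" for S
    unfolding h_def[abs_def] by (intro continuous_intros torus_continuous q)
  have p: "tint h > 0"
  proof (rule ccontr)
    assume "\<not> tint h > 0"
    then have "tint h = 0" using tint_nonneg[OF h_cont] by (force simp: h_def)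
    then have hi: "(h has_integral 0) (cbox 0 1)"
      using tint_integrable[OF h_cont] by (metis tint_def has_integral_integral)
    obtain n where n: "n \<in> int_lattice" "x0 + n \<in> cbox 0 1" by (rule int_lattice_reduce)
    have "h (x0 + n) = 0"
    proof (rule has_integral_0_cbox_imp_0[OF h_cont _ hi])
      show "0 \<le> h x" for x by (simp add: h_def)
      show "box (0::real^2) 1 \<noteq> {}" by (simp add: interval_ne_empty_cart)
    qed (use n in auto)
    moreover have "q (x0 + n) = q x0" using periodicD[OF torus_smoothD(2)[OF q] n(1)] .
    ultimately show False using \<delta>(1) by (simp add: h_def q_def c_def)
  qed
  \<comment> \<open>Bernoulli's inequality bounds \<open>q x ^ (2 * m)\<close> from below by a term
    linear in \<open>m\<close>. Where \<open>G x \<le> \<eta>\<close> the even power lies in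
    \<open>{0..1}\<close>, and the constant \<open>M + \<eta>\<close> pays for the loss; integrating
    and letting \<open>m\<close> grow contradicts \<open>tz\<close>.\<close>
  have ineq: "\<eta> * (2 * real m * h x) - (M + \<eta>) \<le> G x * q x ^ (2 * m)" for m x
  proof -
    have bern: "2 * real m * h x \<le> q x ^ (2 * m)"
    proof (cases "q x \<ge> 1")
      case True
      have "1 + real (2 * m) * (q x - 1) \<le> (1 + (q x - 1)) ^ (2 * m)"
        by (rule Bernoulli_inequality) (use True in simp)
      then show ?thesis using True by (simp add: h_def)
    qed (simp add: h_def)
    have "\<eta> * q x ^ (2 * m) - (M + \<eta>) \<le> G x * q x ^ (2 * m)"
    proof (cases "G x \<le> \<eta>")
      case False
      have "0 \<le> M + \<eta>" using M[of x] \<eta>(1) by linarith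
      moreover have "\<eta> * q x ^ (2 * m) \<le> G x * q x ^ (2 * m)"
        using False by (intro mult_right_mono) auto
      ultimately show ?thesis by linarith
    next
      case True
      obtain n where n: "n \<in> int_lattice" "x + n \<in> cbox 0 1" by (rule int_lattice_reduce)
      have "x + n \<in> A"
        using n True periodicD[OF torus_smoothD(2)[OF G] n(1), of x] by (simp add: A_def)
      from \<delta>(3)[OF this] have "q x \<le> 1 - \<delta>"
        using periodicD[OF torus_smoothD(2)[OF q] n(1), of x] by (simp add: q_def)
      moreover have "q x \<ge> - 1" using c_ge[of x] \<delta>(1) by (simp add: q_def)
      ultimately have "\<bar>q x\<bar> \<le> 1" using \<delta>(1) by auto
      then have q1: "q x ^ (2 * m) \<le> 1" "0 \<le> q x ^ (2 * m)"
        using power_le_one[of "(q x)\<^sup>2" m] by (auto simp: power_mult abs_square_le_1)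
      have "\<eta> * q x ^ (2 * m) \<le> \<eta>" using q1 \<eta>(1) by (simp add: mult_left_le)
      moreover have "\<bar>G x * q x ^ (2 * m)\<bar> \<le> M * 1"
        unfolding abs_mult using M[of x] q1 by (intro mult_mono) auto
      ultimately show ?thesis by linarith
    qed
    moreover have "\<eta> * (2 * real m * h x) \<le> \<eta> * q x ^ (2 * m)"
      using bern \<eta>(1) by (intro mult_left_mono) auto
    ultimately show ?thesis by linarith
  qed
  have "\<eta> * (2 * real m * tint h) - (M + \<eta>) \<le> 0" for m
  proof -
    have "\<eta> * (2 * real m * tint h) - (M + \<eta>) = tint (\<lambda>x. \<eta> * (2 * real m * h x) - (M + \<eta>))"
      by (subst tint_diff) (auto simp: tint_cmult_real intro!: continuous_intros h_cont)
    also have "\<dots> \<le> tint (\<lambda>x. G x * q x ^ (2 * m))"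
      by (intro tint_mono ineq continuous_intros h_cont torus_continuous G q)
    finally show ?thesis by (simp add: tz)
  qed
  moreover obtain m where "real m > (M + \<eta>) / (2 * \<eta> * tint h)" using reals_Archimedean2 by blast
  ultimately show False using p \<eta>(1) by (simp add: field_simps) (metis not_less)
qed

section \<open>Wirtinger derivatives and the inhomogeneous Cauchy-Riemann equation\<close>

definition wirt_z :: "(real^2 \<Rightarrow> complex) \<Rightarrow> real^2 \<Rightarrow> complex" where
  "wirt_z f x = (pd 1 f x - \<i> * pd 2 f x) / 2"

definition wirt_zb :: "(real^2 \<Rightarrow> complex) \<Rightarrow> real^2 \<Rightarrow> complex" where
  "wirt_zb f x = (pd 1 f x + \<i> * pd 2 f x) / 2"

lemma wirt_torus [torus_intros]:
  "torus_smooth f \<Longrightarrow> torus_smooth (wirt_z f)" "torus_smooth f \<Longrightarrow> torus_smooth (wirt_zb f)"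
  unfolding wirt_z_def[abs_def] wirt_zb_def[abs_def] by (intro torus_intros; simp)+

lemma wirt_partial: "pd 1 f x = wirt_z f x + wirt_zb f x"
  "pd 2 f x = \<i> * (wirt_z f x - wirt_zb f x)"
  by (simp_all add: wirt_z_def wirt_zb_def field_simps)

lemma pd_wirt:
  assumes "smooth f"
  shows "pd i (wirt_z f) = wirt_z (pd i f)"
    and "pd i (wirt_zb f) = wirt_zb (pd i f)"
  unfolding wirt_z_def[abs_def] wirt_zb_def[abs_def] pd_swap[OF assms, of 1 i] pd_swap[OF assms, of 2 i]
  by (subst pd_divide, auto simp: pd_simps smooth_intros assms power2_eq_square)+

lemma dbar_solvable:
  assumes f: "torus_smooth f" and f0: "tint f = 0"
  obtains u where "torus_smooth u" "\<And>x. wirt_zb u x = f x"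
proof -
  \<comment> \<open>The symbol of \<open>wirt_zb\<close>, half of
    \<open>2 * pi * \<i> * (a + \<i> * b)\<close>. Its modulus is at least 1 away from frequency
    zero, so division by it preserves rapid decay.\<close>
  define l where "l a b = of_real pi * (\<i> * of_int a - of_int b)" for a b
  \<comment> \<open>At frequency zero this is a division by zero with value 0; the assumption
    \<open>tint f = 0\<close> is the matching solvability condition.\<close>
  define c where "c a b = fourier f a b / l a b" for a b
  have l: "cmod (l a b) \<ge> 1" if "(a, b) \<noteq> (0, 0)" for a b
  proof -
    have "(1::int) \<le> a\<^sup>2 + b\<^sup>2"
      using that sum_power2_gt_zero_iff[of a b] by auto
    then have "(1::real) \<le> (of_int a)\<^sup>2 + (of_int b)\<^sup>2"
      by (metis of_int_1_le_iff of_int_add of_int_power)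
    then have "1 \<le> cmod (\<i> * of_int a - of_int b)"
      by (simp add: cmod_def add.commute)
    moreover have "1 \<le> pi" using pi_gt3 by simp
    ultimately show ?thesis unfolding l_def norm_mult
      using mult_mono[of 1 pi 1] by (simp add: norm_mult)
  qed
  have cc: "cmod (c a b) \<le> cmod (fourier f a b)" for a b
  proof (cases "(a, b) = (0, 0)")
    case False
    then show ?thesis using l[OF False]
      by (simp add: c_def norm_divide divide_le_eq) (metis mult_left_mono mult.right_neutral norm_ge_zero)
  qed (simp add: c_def l_def)
  have decay: "\<exists>C. \<forall>a b. fweight a b ^ m * cmod (c a b) \<le> C" for m
  proof -
    obtain C where C: "\<And>a b. fweight a b ^ m * cmod (fourier f a b) \<le> C" using fourier_decay[OF f] by blast
    have "fweight a b ^ m * cmod (c a b) \<le> C" for a b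
      by (rule order_trans[OF mult_left_mono[OF cc] C]) (use fweight_ge_1[of a b] in simp)
    then show ?thesis by blast
  qed
  define u where "u x = (\<Sum>n. c (fst (int_pair n)) (snd (int_pair n)) * torus_char_n n x)" for x
  have u: "torus_smooth u" "fourier u a b = c a b" for a b
    unfolding u_def[abs_def] using fourier_series_coeff[of c, OF decay] by auto
  have "fourier (\<lambda>x. wirt_zb u x - f x) a b = 0" for a b
  proof -
    have "wirt_zb u = (\<lambda>x. (1/2) * pd 1 u x - (- \<i>/2) * pd 2 u x)"
      by (auto simp: wirt_zb_def field_simps)
    then have "fourier (wirt_zb u) a b = l a b * c a b"
      using u by (simp only: fourier_diff fourier_cmult fourier_partial torus_intros l_def) (simp add: field_simps)
    moreover have "l a b * c a b = fourier f a b"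
    proof (cases "(a, b) = (0, 0)")
      case True
      then show ?thesis using f0 by (simp add: c_def fourier_def torus_char_0)
    next
      case False
      then have "l a b \<noteq> 0" using l[OF False] by auto
      then show ?thesis by (simp add: c_def)
    qed
    ultimately show ?thesis by (subst fourier_diff) (auto intro!: torus_intros u f)
  qed
  from fourier_unique[OF torus_diff[OF wirt_torus(2)[OF u(1)] f] this]
  show ?thesis using that[OF u(1)] by simp
qed

lemma jacobian_exact:
  assumes u: "smooth u"
  shows "Im (cnj (pd 1 u x) * pd 2 u x) =
    (pd 1 (\<lambda>x. Im (cnj (u x) * pd 2 u x)) x
     - pd 2 (\<lambda>x. Im (cnj (u x) * pd 1 u x)) x) / 2"
  using u pd_swap[OF u, of 1 2] by (simp add: pd_simps smooth_intros algebra_simps)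

definition jac :: "(real^2 \<Rightarrow> complex) \<Rightarrow> real^2 \<Rightarrow> real" where
  "jac f x = Im (cnj (pd 1 f x) * pd 2 f x)"

lemma smooth_jac [smooth_intros]: "smooth f \<Longrightarrow> smooth (jac f)"
  unfolding jac_def[abs_def] by (intro smooth_intros)

text \<open>Only the primitive one-form has to be periodic, not \<open>f\<close> itself. This covers
  functions that translations multiply by numbers of modulus 1.\<close>

lemma tint_jac_exact:
  assumes f: "smooth f" and per: "\<And>i. periodic (\<lambda>x. Im (cnj (f x) * pd i f x))"
  shows "tint (jac f) = 0"
proof -
  let ?w = "\<lambda>i x. Im (cnj (f x) * pd i f x)"
  have w: "torus_smooth (?w i)" for i
    unfolding torus_smooth_def by (intro conjI smooth_intros f per)
  have "jac f = (\<lambda>x. (1/2) * (pd 1 (?w 2) x - pd 2 (?w 1) x))"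
    unfolding jac_def[abs_def] jacobian_exact[OF f] by simp
  then have "tint (jac f) = (1/2) * (tint (pd 1 (?w 2)) - tint (pd 2 (?w 1)))"
    by (simp only: tint_cmult_real tint_diff[OF torus_continuous torus_continuous] torus_partial w)
  then show ?thesis unfolding tint_partial[OF w] by simp
qed

lemma tint_jac_torus: "torus_smooth f \<Longrightarrow> tint (jac f) = 0"
  by (rule tint_jac_exact, erule torus_smoothD) (rule torus_smoothD(2), intro torus_intros)

text \<open>The squared moduli differ pointwise by the Jacobian and a combination of first
  derivatives, all of mean zero. The pair \<open>m\<close>, \<open>- cnj m\<close> consists of the
  two Wirtinger derivatives of an imaginary linear function, so the isometry also covers
  \<open>u\<close> plus such a function; this is how a nonzero mean is accommodated.\<close>

lemma l2norm_wirt: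
  assumes u: "torus_smooth u"
  shows "l2norm (\<lambda>x. wirt_z u x - cnj m) = l2norm (\<lambda>x. wirt_zb u x + m)"
proof -
  let ?J = "\<lambda>x. Im (cnj (pd 1 u x) * pd 2 u x)"
  have J: "tint ?J = 0" using tint_jac_torus[OF u] unfolding jac_def[abs_def] .
  have pt: "(cmod (wirt_z u x - cnj m))\<^sup>2 = (cmod (wirt_zb u x + m))\<^sup>2
      + (?J x - 2 * (Re m * Re (pd 1 u x) + Im m * Re (pd 2 u x)))" for x
  proof -
    obtain a b where ab: "pd 1 u x = Complex a b" by (cases "pd 1 u x")
    obtain c d where cd: "pd 2 u x = Complex c d" by (cases "pd 2 u x")
    obtain p q where m: "m = Complex p q" by (cases m)
    show ?thesis
      unfolding wirt_z_def wirt_zb_def ab cd m cmod_power2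
      by (simp add: power2_eq_square field_simps)
  qed
  let ?R = "\<lambda>x. Re m * Re (pd 1 u x) + Im m * Re (pd 2 u x)"
  have R: "tint (\<lambda>x. Re (pd i u x)) = 0" for i
    using tint_bounded_linear[OF bounded_linear_Re torus_continuous[OF torus_partial[OF u]]]
    by (simp add: tint_partial u)
  have cR: "continuous_on UNIV (\<lambda>x. c * Re (pd i u x))" for c i
    by (intro torus_continuous torus_intros u)
  have m0: "tint ?R = 0"
    by (simp only: tint_add[OF cR cR] tint_cmult_real R)
  have c: "continuous_on UNIV (\<lambda>x. (cmod (wirt_zb u x + m))\<^sup>2)"
    by (intro continuous_intros torus_continuous torus_intros u)
  have cJ: "continuous_on UNIV ?J" "continuous_on UNIV (\<lambda>x. 2 * ?R x)"
    by (intro torus_continuous torus_intros u)+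
  have cJ': "continuous_on UNIV (\<lambda>x. ?J x - 2 * ?R x)"
    by (intro continuous_on_diff cJ)
  have "tint (\<lambda>x. (cmod (wirt_z u x - cnj m))\<^sup>2) = tint (\<lambda>x. (cmod (wirt_zb u x + m))\<^sup>2)"
    unfolding pt tint_add[OF c cJ'] tint_diff[OF cJ] J tint_cmult_real m0 by simp
  then show ?thesis by (simp add: l2norm_def)
qed

section \<open>The Beltrami equation on the torus\<close>

text \<open>The weights \<open>\<epsilon>\<close> make multiplication by \<open>a\<close> with \<open>\<bar>a\<bar> \<le> k < 1\<close> a contraction
  up to \<open>O(\<epsilon>)\<close>, whatever the order of the norm.\<close>

fun snorm :: "real \<Rightarrow> nat \<Rightarrow> (real^2 \<Rightarrow> complex) \<Rightarrow> real" where
  "snorm \<epsilon> 0 f = l2norm f"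
| "snorm \<epsilon> (Suc s) f = snorm \<epsilon> s f + \<epsilon> * (snorm \<epsilon> s (pd 1 f) + snorm \<epsilon> s (pd 2 f))"

declare snorm.simps(2) [simp del]

lemma snorm_nonneg: "torus_smooth f \<Longrightarrow> \<epsilon> \<ge> 0 \<Longrightarrow> 0 \<le> snorm \<epsilon> s f"
  by (induction s arbitrary: f) (auto simp: snorm.simps(2) intro!: l2norm_nonneg torus_continuous add_nonneg_nonneg mult_nonneg_nonneg torus_partial)

lemma snorm_Suc_ge: "torus_smooth f \<Longrightarrow> \<epsilon> \<ge> 0 \<Longrightarrow> snorm \<epsilon> s f \<le> snorm \<epsilon> (Suc s) f"
  by (auto simp: snorm.simps(2) intro!: mult_nonneg_nonneg add_nonneg_nonneg snorm_nonneg torus_partial)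

lemma snorm_mono: "torus_smooth f \<Longrightarrow> \<epsilon> \<ge> 0 \<Longrightarrow> s \<le> t \<Longrightarrow> snorm \<epsilon> s f \<le> snorm \<epsilon> t f"
  by (rule lift_Suc_mono_le[of "\<lambda>s. snorm \<epsilon> s f"]) (rule snorm_Suc_ge)

lemma snorm_partial:
  assumes "torus_smooth f" "\<epsilon> \<ge> 0" shows "\<epsilon> * snorm \<epsilon> s (pd i f) \<le> snorm \<epsilon> (Suc s) f"
proof -
  have n: "0 \<le> snorm \<epsilon> s f" "\<And>j. 0 \<le> \<epsilon> * snorm \<epsilon> s (pd j f)"
    using assms by (auto intro!: snorm_nonneg mult_nonneg_nonneg torus_partial)
  show ?thesis using exhaust_2[of i] n(1) n(2)[of 1] n(2)[of 2] by (auto simp: snorm.simps(2) distrib_left)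
qed

lemma snorm_triangle:
  assumes "\<epsilon> \<ge> 0"
  shows "torus_smooth f \<Longrightarrow> torus_smooth g \<Longrightarrow> snorm \<epsilon> s (\<lambda>x. f x + g x) \<le> snorm \<epsilon> s f + snorm \<epsilon> s g"
proof (induction s arbitrary: f g)
  case 0
  then show ?case by (auto intro!: l2norm_triangle torus_continuous)
next
  case (Suc s)
  have "\<epsilon> * (snorm \<epsilon> s (pd 1 (\<lambda>x. f x + g x)) + snorm \<epsilon> s (pd 2 (\<lambda>x. f x + g x)))
    \<le> \<epsilon> * ((snorm \<epsilon> s (pd 1 f) + snorm \<epsilon> s (pd 1 g)) + (snorm \<epsilon> s (pd 2 f) + snorm \<epsilon> s (pd 2 g)))"
    unfolding pd_add[OF Suc.prems[THEN torus_smoothD(1)]]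
    by (intro mult_left_mono add_mono Suc.IH torus_partial Suc.prems assms)
  then show ?case using Suc.IH[OF Suc.prems] by (simp add: snorm.simps(2) algebra_simps)
qed

text \<open>A derivative falling on \<open>a\<close> always carries a factor \<epsilon> from the
  recursion of \<open>snorm\<close>. The constant \<open>K\<close> may depend on \<open>a\<close>
  and \<open>s\<close>, but being independent of \<epsilon> it can be made harmless by choosing
  \<epsilon> afterwards.\<close>

lemma snorm_mult:
  assumes "torus_smooth a" "\<And>x. cmod (a x) \<le> k"
  shows "\<exists>K\<ge>0. \<forall>\<epsilon> g. 0 \<le> \<epsilon> \<longrightarrow> \<epsilon> \<le> 1 \<longrightarrow> torus_smooth g \<longrightarrow>
    snorm \<epsilon> s (\<lambda>x. a x * g x) \<le> (k + \<epsilon> * K) * snorm \<epsilon> s g"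
  using assms
proof (induction s arbitrary: a k)
  case 0
  then show ?case by (intro exI[of _ 0]) (auto intro!: l2norm_mult_le torus_continuous)
next
  case (Suc s)
  obtain K where K: "K \<ge> 0" "\<And>\<epsilon> g. 0 \<le> \<epsilon> \<Longrightarrow> \<epsilon> \<le> 1 \<Longrightarrow> torus_smooth g \<Longrightarrow>
    snorm \<epsilon> s (\<lambda>x. a x * g x) \<le> (k + \<epsilon> * K) * snorm \<epsilon> s g"
    using Suc.IH[OF Suc.prems] by blast
  \<comment> \<open>For the partial derivatives of \<open>a\<close> any bound uniform in \<epsilon>
    suffices, since it will be multiplied by \<epsilon>.\<close>
  have "\<exists>L\<ge>0. \<forall>\<epsilon> g. 0 \<le> \<epsilon> \<longrightarrow> \<epsilon> \<le> 1 \<longrightarrow> torus_smooth g \<longrightarrow>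
    snorm \<epsilon> s (\<lambda>x. pd i a x * g x) \<le> L * snorm \<epsilon> s g" for i
  proof -
    have d: "torus_smooth (pd i a)" by (intro torus_intros Suc.prems)
    obtain x0 where x0: "\<And>x. cmod (pd i a x) \<le> cmod (pd i a x0)"
      using torus_bounded[OF torus_continuous[OF d] torus_smoothD(2)[OF d]] by blast
    obtain L where L: "L \<ge> 0" "\<And>\<epsilon> g. 0 \<le> \<epsilon> \<Longrightarrow> \<epsilon> \<le> 1 \<Longrightarrow> torus_smooth g \<Longrightarrow>
      snorm \<epsilon> s (\<lambda>x. pd i a x * g x) \<le> (cmod (pd i a x0) + \<epsilon> * L) * snorm \<epsilon> s g"
      using Suc.IH[OF d x0] by blast
    have "snorm \<epsilon> s (\<lambda>x. pd i a x * g x) \<le> (cmod (pd i a x0) + L) * snorm \<epsilon> s g"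
      if "0 \<le> \<epsilon>" "\<epsilon> \<le> 1" "torus_smooth g" for \<epsilon> g
    proof (rule order_trans[OF L(2)[OF that]], rule mult_right_mono)
      show "cmod (pd i a x0) + \<epsilon> * L \<le> cmod (pd i a x0) + L"
        using mult_right_mono[OF that(2) L(1)] by simp
      show "0 \<le> snorm \<epsilon> s g" using that by (intro snorm_nonneg)
    qed
    then show ?thesis using L(1) by (intro exI[of _ "cmod (pd i a x0) + L"]) auto
  qed
  note ex = this
  obtain L1 where L1: "L1 \<ge> 0" "\<And>\<epsilon> g. 0 \<le> \<epsilon> \<Longrightarrow> \<epsilon> \<le> 1 \<Longrightarrow> torus_smooth g \<Longrightarrow>
    snorm \<epsilon> s (\<lambda>x. pd 1 a x * g x) \<le> L1 * snorm \<epsilon> s g" using ex[of 1] by blast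
  obtain L2 where L2: "L2 \<ge> 0" "\<And>\<epsilon> g. 0 \<le> \<epsilon> \<Longrightarrow> \<epsilon> \<le> 1 \<Longrightarrow> torus_smooth g \<Longrightarrow>
    snorm \<epsilon> s (\<lambda>x. pd 2 a x * g x) \<le> L2 * snorm \<epsilon> s g" using ex[of 2] by blast
  have "snorm \<epsilon> (Suc s) (\<lambda>x. a x * g x) \<le> (k + \<epsilon> * (K + L1 + L2)) * snorm \<epsilon> (Suc s) g"
    if e: "0 \<le> \<epsilon>" "\<epsilon> \<le> 1" and g: "torus_smooth g" for \<epsilon> g
  proof -
    have D: "snorm \<epsilon> s (pd i (\<lambda>x. a x * g x)) \<le>
      (k + \<epsilon> * K) * snorm \<epsilon> s (pd i g) + L * snorm \<epsilon> s g"
      if "\<And>\<epsilon> g. 0 \<le> \<epsilon> \<Longrightarrow> \<epsilon> \<le> 1 \<Longrightarrow> torus_smooth g \<Longrightarrow>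
      snorm \<epsilon> s (\<lambda>x. pd i a x * g x) \<le> L * snorm \<epsilon> s g" for i L
    proof -
      have "snorm \<epsilon> s (pd i (\<lambda>x. a x * g x)) \<le>
        snorm \<epsilon> s (\<lambda>x. a x * pd i g x) + snorm \<epsilon> s (\<lambda>x. pd i a x * g x)"
        unfolding pd_mult[OF torus_smoothD(1)[OF Suc.prems(1)] torus_smoothD(1)[OF g]]
        by (intro snorm_triangle e torus_intros Suc.prems g)
      then show ?thesis using K(2)[OF e torus_partial[OF g], of i] that[OF e g] by linarith
    qed
    let ?A = "snorm \<epsilon> s g" and ?B = "snorm \<epsilon> s (pd 1 g)" and ?C = "snorm \<epsilon> s (pd 2 g)"
    have nn: "?A \<ge> 0" "?B \<ge> 0" "?C \<ge> 0" using e g by (auto intro!: snorm_nonneg torus_partial)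
    have "snorm \<epsilon> (Suc s) (\<lambda>x. a x * g x) \<le> (k + \<epsilon> * K) * ?A +
       \<epsilon> * (((k + \<epsilon> * K) * ?B + L1 * ?A) + ((k + \<epsilon> * K) * ?C + L2 * ?A))"
      unfolding snorm.simps using e
      by (intro add_mono mult_left_mono K(2) D L1 L2 g)
    also have "\<dots> = (k + \<epsilon> * K) * snorm \<epsilon> (Suc s) g + \<epsilon> * (L1 + L2) * ?A"
      by (simp add: snorm.simps(2) algebra_simps)
    also have "\<dots> \<le> (k + \<epsilon> * K) * snorm \<epsilon> (Suc s) g + \<epsilon> * (L1 + L2) * snorm \<epsilon> (Suc s) g"
      using snorm_Suc_ge[OF g e(1), of s] e L1(1) L2(1) by (intro add_left_mono mult_left_mono) auto
    finally show ?thesis by (simp add: algebra_simps)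
  qed
  then show ?case using K(1) L1(1) L2(1) by (intro exI[of _ "K + L1 + L2"]) auto
qed

text \<open>Differentiation removes the constant and commutes with the Wirtinger operators, so the
  induction hypothesis is used for \<open>pd i u\<close> with \<open>m = 0\<close>.\<close>

lemma snorm_wirt:
  assumes "torus_smooth u"
  shows "snorm \<epsilon> s (\<lambda>x. wirt_z u x - cnj m) = snorm \<epsilon> s (\<lambda>x. wirt_zb u x + m)"
  using assms
proof (induction s arbitrary: u m)
  case 0
  then show ?case by (simp add: l2norm_wirt)
next
  case (Suc s)
  note sm = torus_smoothD(1)[OF Suc.prems] and w = wirt_torus[OF Suc.prems, THEN torus_smoothD(1)]
  have "pd i (\<lambda>x. wirt_z u x - cnj m) = (\<lambda>x. wirt_z (pd i u) x - cnj 0)"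
     and "pd i (\<lambda>x. wirt_zb u x + m) = (\<lambda>x. wirt_zb (pd i u) x + 0)" for i
    using w by (simp_all add: pd_diff pd_add pd_const smooth_const pd_wirt[OF sm])
  then show ?case using Suc.IH[OF Suc.prems] Suc.IH[OF torus_partial[OF Suc.prems], of _ 0]
    by (simp add: snorm.simps(2))
qed

lemma sup_le_snorm:
  assumes f: "torus_smooth f" and e: "\<epsilon> > 0"
  shows "cmod (f x) \<le> (1 + 2 / \<epsilon> + 1 / \<epsilon>\<^sup>2) * snorm \<epsilon> 2 f"
proof -
  have e0: "\<epsilon> \<ge> 0" using e by simp
  have 0: "l2norm f \<le> snorm \<epsilon> 2 f"
    using snorm_mono[OF f e0, of 0 2] by simp
  have 1: "l2norm (pd i f) \<le> snorm \<epsilon> 2 f / \<epsilon>" for i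
    using order_trans[OF snorm_partial[OF f e0, of 0 i] snorm_mono[OF f e0, of "Suc 0" 2]] e
    by (simp add: field_simps)
  have "\<epsilon> * (\<epsilon> * l2norm (pd 1 (pd 2 f))) \<le> \<epsilon> * snorm \<epsilon> (Suc 0) (pd 2 f)"
    using snorm_partial[OF torus_partial[OF f] e0, of 0 1 2] e0 by (intro mult_left_mono) auto
  also have "\<dots> \<le> snorm \<epsilon> 2 f"
    using snorm_partial[OF f e0, of "Suc 0" 2] by (simp add: numeral_2_eq_2)
  finally have 2: "l2norm (pd 1 (pd 2 f)) \<le> snorm \<epsilon> 2 f / \<epsilon>\<^sup>2"
    using e by (simp add: field_simps power2_eq_square)
  show ?thesis
    using sobolev_2d[OF f, of x] 0 1[of 1] 1[of 2] 2 by (simp add: algebra_simps)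
qed

text \<open>Each partial derivative costs one order and a factor \<open>1 / \<epsilon>\<close>; the
  two remaining orders pay for the Sobolev embedding.\<close>

lemma iter_partial_le_snorm:
  assumes e: "\<epsilon> > 0"
  shows "\<exists>C\<ge>0. \<forall>f x. torus_smooth f \<longrightarrow> cmod (iter_partial is f x) \<le> C * snorm \<epsilon> (length is + 2) f"
proof (induction "is")
  case Nil
  show ?case using e sup_le_snorm[OF _ e] by (intro exI[of _ "1 + 2 / \<epsilon> + 1 / \<epsilon>\<^sup>2"]) (auto simp: numeral_2_eq_2)
next
  case (Cons i "is")
  then obtain C where C: "C \<ge> 0" "\<And>f x. torus_smooth f \<Longrightarrow> cmod (iter_partial is f x) \<le> C * snorm \<epsilon> (length is + 2) f"
    by blast
  have "cmod (iter_partial (i # is) f x) \<le> C / \<epsilon> * snorm \<epsilon> (length (i # is) + 2) f" if f: "torus_smooth f" for f x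
  proof -
    have "cmod (iter_partial (i # is) f x) \<le> C * snorm \<epsilon> (length is + 2) (pd i f)"
      using C(2)[OF torus_partial[OF f]] by simp
    also have "\<dots> \<le> C * (snorm \<epsilon> (Suc (length is + 2)) f / \<epsilon>)"
      using snorm_partial[OF f, of \<epsilon> "length is + 2" i] e C(1)
      by (intro mult_left_mono) (simp_all add: pos_le_divide_eq mult.commute)
    finally show ?thesis by (simp)
  qed
  then show ?case using C(1) e by (intro exI[of _ "C / \<epsilon>"]) (simp)
qed

lemma tint_le_snorm:
  assumes f: "torus_smooth f" and e: "\<epsilon> \<ge> 0" shows "cmod (tint f) \<le> snorm \<epsilon> s f"
proof -
  have "cmod (tint f) \<le> tint (\<lambda>x. cmod (f x))"
    unfolding tint_def
    by (intro integral_norm_bound_integral tint_integrable torus_continuous continuous_on_norm f) auto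
  also have "\<dots> \<le> snorm \<epsilon> 0 f" using l1_le_l2norm[OF torus_continuous[OF f]] by simp
  also have "\<dots> \<le> snorm \<epsilon> s f" by (rule snorm_mono[OF f e]) simp
  finally show ?thesis .
qed

lemma snorm_const: "\<epsilon> \<ge> 0 \<Longrightarrow> snorm \<epsilon> s (\<lambda>x. c) = cmod c"
proof (induction s arbitrary: c)
  case (Suc s)
  then show ?case using Suc.IH[of 0] by (simp add: pd_const snorm.simps(2))
qed (simp add: l2norm_def)

text \<open>Up to a period every point is reached from 0 by two axis-parallel segments of length at
  most 1. This gives majorants for the undifferentiated terms of a series when only their
  derivatives are estimated.\<close>

lemma sup_le_partials:
  fixes u :: "real^2 \<Rightarrow> complex"
  assumes u: "torus_smooth u" and u0: "u 0 = 0" and B: "\<And>i x. cmod (pd i u x) \<le> B i"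
  shows "cmod (u x) \<le> B 1 + B 2"
proof -
  have step: "cmod (u (y + t *\<^sub>R axis i 1) - u y) \<le> B i" if t: "0 \<le> t" "t \<le> 1" for i y t
  proof -
    have "u (y + t *\<^sub>R axis i 1) - u y = integral {0..t} (\<lambda>s. pd i u (y + s *\<^sub>R axis i 1))"
      using integral_partial_line[OF torus_smoothD(1)[OF u] t(1), of i y] by simp
    also have "cmod \<dots> \<le> integral {0..t} (\<lambda>s. B i)"
      using B t
      by (intro integral_norm_bound_integral integrable_continuous_interval
          smooth_continuous_on_compose[OF smooth_partial[OF torus_smoothD(1)[OF u]]] continuous_intros) auto
    also have "\<dots> = t * B i" using t by simp
    also have "\<dots> \<le> 1 * B i" using t B[of i 0] norm_ge_zero order_trans by (intro mult_right_mono) blast+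
    finally show ?thesis by simp
  qed
  obtain n where n: "n \<in> int_lattice" "x + n \<in> cbox 0 1" by (rule int_lattice_reduce)
  define s t where "s = (x + n)$1" and "t = (x + n)$2"
  have st: "0 \<le> s" "s \<le> 1" "0 \<le> t" "t \<le> 1" using n(2) by (auto simp: s_def t_def mem_box_cart)
  have "x + n = (0 + s *\<^sub>R axis 1 1) + t *\<^sub>R axis 2 1"
    unfolding s_def t_def by (subst vec2_axis) simp
  then have "u x = (u ((0 + s *\<^sub>R axis 1 1) + t *\<^sub>R axis 2 1) - u (0 + s *\<^sub>R axis 1 1)) + (u (0 + s *\<^sub>R axis 1 1) - u 0)"
    using periodicD[OF torus_smoothD(2)[OF u] n(1), of x] by (simp add: u0)
  also have "cmod \<dots> \<le> B 2 + B 1"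
    by (rule order_trans[OF norm_triangle_ineq]) (intro add_mono step st)
  finally show ?thesis by simp
qed

text \<open>The Neumann series of \<open>T\<close>, which multiplies by \<mu> after the isometry.
  Since \<open>wirt_zb u\<close> always has mean zero, the unknown constant \<open>m\<close> takes
  up the mean of the right-hand side; accordingly \<open>u\<close> and \<open>m\<close> are the sums
  of the solutions and of the means of the iterates \<open>F n\<close>.\<close>

lemma beltrami_solvable:
  assumes mu: "torus_smooth \<mu>" and k: "\<And>x. cmod (\<mu> x) \<le> k" "k < 1" and h0: "torus_smooth h"
  obtains u m where "torus_smooth u" "\<And>x. wirt_zb u x + m = h x + \<mu> x * (wirt_z u x - cnj m)"
proof -
  have "\<exists>u. torus_smooth u \<and> (\<forall>x. wirt_zb u x = f x - tint f) \<and> u 0 = 0" if f: "torus_smooth f" for f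
  proof -
    have "tint (\<lambda>x. f x - tint f) = 0"
      using f by (subst tint_diff) (auto intro!: torus_continuous torus_const)
    moreover have "torus_smooth (\<lambda>x. f x - tint f)" by (intro torus_intros f)
    ultimately obtain v where v: "torus_smooth v" "\<And>x. wirt_zb v x = f x - tint f"
      using dbar_solvable[of "\<lambda>x. f x - tint f"] by blast
    have "wirt_zb (\<lambda>x. v x - v 0) x = wirt_zb v x" for x
      using torus_smoothD(1)[OF v(1)] by (simp add: wirt_zb_def pd_diff smooth_const pd_const)
    then show ?thesis using v by (intro exI[of _ "\<lambda>x. v x - v 0"]) (auto intro!: torus_intros)
  qed
  then obtain sol where sol: "\<And>f. torus_smooth f \<Longrightarrow> torus_smooth (sol f)"
    "\<And>f x. torus_smooth f \<Longrightarrow> wirt_zb (sol f) x = f x - tint f" "\<And>f. torus_smooth f \<Longrightarrow> sol f 0 = 0"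
    by metis
  define T where "T f = (\<lambda>x. \<mu> x * (wirt_z (sol f) x - cnj (tint f)))" for f
  define F where "F n = (T ^^ n) h" for n
  have T: "torus_smooth (T f)" if "torus_smooth f" for f
    unfolding T_def by (intro torus_intros mu sol that)
  have F: "torus_smooth (F n)" for n
    by (induction n) (auto simp: F_def h0 T)
  have F_Suc: "F (Suc n) x = \<mu> x * (wirt_z (sol (F n)) x - cnj (tint (F n)))" for n x
    by (simp add: F_def T_def)
  \<comment> \<open>The weight \<epsilon> and the ratio \<open>q\<close> depend on the order
    \<open>s\<close>; this is harmless because smooth convergence is tested order by order.\<close>
  have geom: "\<exists>\<epsilon> q C. 0 < \<epsilon> \<and> 0 \<le> q \<and> q < 1 \<and> C \<ge> 0 \<and> (\<forall>n. snorm \<epsilon> s (F n) \<le> C * q ^ n)" for s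
  proof -
    obtain K where K: "K \<ge> 0" "\<And>\<epsilon> g. 0 \<le> \<epsilon> \<Longrightarrow> \<epsilon> \<le> 1 \<Longrightarrow> torus_smooth g \<Longrightarrow>
      snorm \<epsilon> s (\<lambda>x. \<mu> x * g x) \<le> (k + \<epsilon> * K) * snorm \<epsilon> s g"
      using snorm_mult[OF mu k(1)] by blast
    have k0: "k \<ge> 0" using k(1)[of 0] norm_ge_zero order_trans by blast
    \<comment> \<open>Chosen so that \<open>\<epsilon> * K\<close> is at most half of
      \<open>1 - k\<close>; \<open>K + 1\<close> avoids a vanishing denominator.\<close>
    define \<epsilon> where "\<epsilon> = min 1 ((1 - k) / (2 * (K + 1)))"
    have e: "0 < \<epsilon>" "\<epsilon> \<le> 1" using k(2) K(1) by (auto simp: \<epsilon>_def)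
    define q where "q = k + \<epsilon> * K"
    have "\<epsilon> * K \<le> (1 - k) / (2 * (K + 1)) * (K + 1)"
      using k(2) K(1) e by (intro mult_mono) (auto simp: \<epsilon>_def)
    also have "\<dots> = (1 - k) / 2" using K(1) by (simp add: field_simps)
    finally have q: "0 \<le> q" "q < 1" using k(2) k0 K(1) e by (auto simp: q_def)
    have "snorm \<epsilon> s (F n) \<le> snorm \<epsilon> s h * q ^ n" for n
    proof (induction n)
      case 0
      show ?case by (simp add: F_def)
    next
      case (Suc n)
      have "snorm \<epsilon> s (F (Suc n)) = snorm \<epsilon> s (\<lambda>x. \<mu> x * (wirt_z (sol (F n)) x - cnj (tint (F n))))"
        by (rule arg_cong[where f="snorm \<epsilon> s"], rule ext, rule F_Suc)
      also have "\<dots> \<le> q * snorm \<epsilon> s (\<lambda>x. wirt_z (sol (F n)) x - cnj (tint (F n)))"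
        unfolding q_def using e by (intro K(2) torus_intros sol F) auto
      also have "snorm \<epsilon> s (\<lambda>x. wirt_z (sol (F n)) x - cnj (tint (F n))) = snorm \<epsilon> s (F n)"
        by (simp add: snorm_wirt[OF sol(1)[OF F]] sol(2)[OF F])
      also have "q * snorm \<epsilon> s (F n) \<le> q * (snorm \<epsilon> s h * q ^ n)"
        using Suc.IH q(1) by (rule mult_left_mono)
      finally show ?case by (simp add: mult_ac)
    qed
    moreover have "0 \<le> snorm \<epsilon> s h" using e by (intro snorm_nonneg h0) auto
    ultimately show ?thesis using e q by blast
  qed
  have bound: "\<exists>q C. 0 \<le> q \<and> q < 1 \<and> (\<forall>n x. cmod (iter_partial is (F n) x) \<le> C * q ^ n \<and>
      cmod (tint (F n)) \<le> C * q ^ n \<and> (\<forall>i. cmod (iter_partial is (pd i (sol (F n))) x) \<le> C * q ^ n))" for "is"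
  proof -
    let ?s = "length is + 2"
    obtain \<epsilon> q C where e: "0 < \<epsilon>" "0 \<le> q" "q < 1" "C \<ge> 0" "\<And>n. snorm \<epsilon> ?s (F n) \<le> C * q ^ n"
      using geom[of ?s] by blast
    obtain B where B: "B \<ge> 0" "\<And>f x. torus_smooth f \<Longrightarrow> cmod (iter_partial is f x) \<le> B * snorm \<epsilon> ?s f"
      using iter_partial_le_snorm[OF e(1), of "is"] by blast
    have e0: "\<epsilon> \<ge> 0" using e by simp
    \<comment> \<open>One factor 2 comes from subtracting the mean of \<open>F n\<close>, the other
      from recovering a partial derivative from two Wirtinger derivatives of equal norm.\<close>
    have D: "snorm \<epsilon> ?s (pd i (sol (F n))) \<le> 4 * (C * q ^ n)" for i n
    proof -
      let ?u = "sol (F n)"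
      have m: "cmod (tint (F n)) \<le> C * q ^ n" using tint_le_snorm[OF F e0] e(5) order_trans by blast
      have "snorm \<epsilon> ?s (wirt_zb ?u) = snorm \<epsilon> ?s (\<lambda>x. F n x + (- tint (F n)))"
        by (rule arg_cong[where f="snorm \<epsilon> ?s"]) (auto simp: sol(2)[OF F])
      also have "\<dots> \<le> snorm \<epsilon> ?s (F n) + snorm \<epsilon> ?s (\<lambda>x. - tint (F n))"
        by (intro snorm_triangle e0 torus_intros F)
      also have "\<dots> \<le> 2 * (C * q ^ n)"
        using m e(5)[of n] by (simp add: snorm_const[OF e0])
      finally have zb: "snorm \<epsilon> ?s (wirt_zb ?u) \<le> 2 * (C * q ^ n)" .
      have z: "snorm \<epsilon> ?s (wirt_z ?u) = snorm \<epsilon> ?s (wirt_zb ?u)"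
        using snorm_wirt[OF sol(1)[OF F], of \<epsilon> ?s n 0] by simp
      have c1: "snorm \<epsilon> ?s (\<lambda>x. c * g x) \<le> snorm \<epsilon> ?s g" if "torus_smooth g" "cmod c = 1" for c g
      proof -
        have "snorm \<epsilon> s (\<lambda>x. c * g x) = snorm \<epsilon> s g" for s using that(1)
        proof (induction s arbitrary: g)
          case 0
          show ?case by (simp add: l2norm_def norm_mult that(2))
        next
          case (Suc s)
          have "pd i (\<lambda>x. c * g x) = (\<lambda>x. c * pd i g x)" for i
            using torus_smoothD(1)[OF Suc.prems] by (simp add: pd_mult smooth_const pd_const)
          then show ?case using Suc.IH[OF Suc.prems] Suc.IH[OF torus_partial[OF Suc.prems]] by (simp add: snorm.simps(2))
        qed
        then show ?thesis by simp
      qed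
      have w: "torus_smooth (wirt_z ?u)" "torus_smooth (wirt_zb ?u)" by (intro torus_intros sol F)+
      have "snorm \<epsilon> ?s (pd 1 ?u) \<le> snorm \<epsilon> ?s (wirt_z ?u) + snorm \<epsilon> ?s (wirt_zb ?u)"
        unfolding wirt_partial[abs_def] by (intro snorm_triangle e0 w)
      moreover have "snorm \<epsilon> ?s (pd 2 ?u) \<le> snorm \<epsilon> ?s (wirt_z ?u) + snorm \<epsilon> ?s (wirt_zb ?u)"
      proof -
        have "pd 2 ?u = (\<lambda>x. \<i> * wirt_z ?u x + (- \<i>) * wirt_zb ?u x)"
          by (auto simp: wirt_partial algebra_simps)
        then have "snorm \<epsilon> ?s (pd 2 ?u) \<le> snorm \<epsilon> ?s (\<lambda>x. \<i> * wirt_z ?u x) + snorm \<epsilon> ?s (\<lambda>x. (- \<i>) * wirt_zb ?u x)"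
          by (simp only:) (intro snorm_triangle e0 torus_intros w)
        also have "\<dots> \<le> snorm \<epsilon> ?s (wirt_z ?u) + snorm \<epsilon> ?s (wirt_zb ?u)"
          by (intro add_mono c1 w) auto
        finally show ?thesis .
      qed
      ultimately show ?thesis using zb z exhaust_2[of i] by auto
    qed
    let ?C = "max (4 * B * C) C"
    have qn: "0 \<le> q ^ n" for n using e by simp
    have "cmod (iter_partial is (F n) x) \<le> ?C * q ^ n" for n x
    proof -
      have "cmod (iter_partial is (F n) x) \<le> B * (C * q ^ n)"
        by (rule order_trans[OF B(2)[OF F]]) (intro mult_left_mono e B)
      also have "\<dots> \<le> 4 * B * C * q ^ n" using B(1) e qn[of n] by simp
      also have "\<dots> \<le> ?C * q ^ n" using qn[of n] by (intro mult_right_mono) auto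
      finally show ?thesis .
    qed
    moreover have "cmod (tint (F n)) \<le> ?C * q ^ n" for n
    proof -
      have "cmod (tint (F n)) \<le> C * q ^ n" using tint_le_snorm[OF F e0] e(5) order_trans by blast
      also have "\<dots> \<le> ?C * q ^ n" using qn[of n] by (intro mult_right_mono) auto
      finally show ?thesis .
    qed
    moreover have "cmod (iter_partial is (pd i (sol (F n))) x) \<le> ?C * q ^ n" for n x i
    proof -
      have "cmod (iter_partial is (pd i (sol (F n))) x) \<le> B * (4 * (C * q ^ n))"
        by (rule order_trans[OF B(2)[OF torus_partial[OF sol(1)[OF F]]]]) (intro mult_left_mono D B)
      also have "\<dots> = 4 * B * C * q ^ n" by simp
      also have "\<dots> \<le> ?C * q ^ n" using qn[of n] by (intro mult_right_mono) auto
      finally show ?thesis .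
    qed
    ultimately show ?thesis using e(2,3) by blast
  qed
  have geo: "summable (\<lambda>n. C * q ^ n)" if "0 \<le> q" "q < 1" for C q :: real
    using that by (intro summable_mult summable_geometric) auto
  have sF: "C_inf_summable F"
    unfolding C_inf_summable_def using torus_smoothD(1)[OF F] bound geo by metis
  have sU: "C_inf_summable (\<lambda>n. sol (F n))"
    unfolding C_inf_summable_def
  proof (intro conjI allI)
    show "smooth (sol (F n))" for n by (rule torus_smoothD(1)[OF sol(1)[OF F]])
    fix "is" :: "2 list"
    show "\<exists>M. summable M \<and> (\<forall>n x. cmod (iter_partial is (sol (F n)) x) \<le> M n)"
    proof (cases "is")
      case Nil
      obtain q C where q: "0 \<le> q" "q < 1" "\<And>n x i. cmod (pd i (sol (F n)) x) \<le> C * q ^ n"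
        using bound[of "[]"] unfolding iter_partial.simps by metis
      have "cmod (sol (F n) x) \<le> C * q ^ n + C * q ^ n" for n x
        by (rule sup_le_partials[of _ "\<lambda>_. C * q ^ n"]) (use sol F q in auto)
      moreover have "summable (\<lambda>n. C * q ^ n + C * q ^ n)" by (intro summable_add geo q)
      ultimately show ?thesis unfolding Nil iter_partial.simps by blast
    next
      case (Cons i js)
      obtain q C where "0 \<le> q" "q < 1" "\<And>n x. cmod (iter_partial js (pd i (sol (F n))) x) \<le> C * q ^ n"
        using bound[of js] by metis
      then show ?thesis using geo unfolding Cons iter_partial.simps by blast
    qed
  qed
  have sm: "summable (\<lambda>n. tint (F n))"
  proof -
    obtain q C where q: "0 \<le> q" "q < 1" "\<And>n. cmod (tint (F n)) \<le> C * q ^ n"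
      using bound[of "[]"] by auto
    show ?thesis by (rule summable_comparison_test'[OF geo[OF q(1,2)]]) (use q(3) in auto)
  qed
  define u where "u x = (\<Sum>n. sol (F n) x)" for x
  define m where "m = (\<Sum>n. tint (F n))"
  have u: "torus_smooth u" unfolding u_def[abs_def]
    by (rule torus_series[OF sU]) (rule torus_smoothD(2)[OF sol(1)[OF F]])
  have su: "(\<lambda>n. pd i (sol (F n)) x) sums pd i u x" for i x
    using summable_sums[OF C_inf_summable_summable[OF C_inf_summable_partial[OF sU]], of i x]
    unfolding u_def[abs_def] pd_series[OF sU] .
  have z: "(\<lambda>n. wirt_z (sol (F n)) x) sums wirt_z u x" for x
    unfolding wirt_z_def by (intro sums_divide sums_diff sums_mult su)
  have zb: "(\<lambda>n. wirt_zb (sol (F n)) x) sums wirt_zb u x" for x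
    unfolding wirt_zb_def by (intro sums_divide sums_add sums_mult su)
  have ms: "(\<lambda>n. tint (F n)) sums m" unfolding m_def by (rule summable_sums[OF sm])
  \<comment> \<open>Both sides are the sum of all \<open>F n x\<close>: on the left by the equation
    solved by \<open>sol\<close>, on the right by splitting off \<open>F 0 = h\<close> and using the
    recursion for the rest.\<close>
  have "wirt_zb u x + m = h x + \<mu> x * (wirt_z u x - cnj m)" for x
  proof -
    have "(\<lambda>n. wirt_zb (sol (F n)) x + tint (F n)) sums (wirt_zb u x + m)" by (intro sums_add zb ms)
    then have "(\<lambda>n. F n x) sums (wirt_zb u x + m)" by (simp add: sol(2)[OF F])
    moreover have "(\<lambda>n. F (Suc n) x) sums (\<mu> x * (wirt_z u x - cnj m))"
      unfolding F_Suc by (intro sums_mult sums_diff z) (use ms sums_cnj in auto)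
    then have "(\<lambda>n. F n x) sums (\<mu> x * (wirt_z u x - cnj m) + F 0 x)" by (rule sums_Suc)
    ultimately show ?thesis using sums_unique2 by (fastforce simp: F_def)
  qed
  then show ?thesis using that u by blast
qed

section \<open>Closed forms and diffeomorphisms of the plane\<close>

lemma smooth_of_partials:
  fixes A B :: "real^2 \<Rightarrow> 'b::real_normed_vector"
  assumes d: "\<And>x. (f has_derivative (\<lambda>v. v$1 *\<^sub>R A x + v$2 *\<^sub>R B x)) (at x)"
    and A: "smooth A" and B: "smooth B"
  shows "smooth f" "pd 1 f = A" "pd 2 f = B"
proof -
  have "C_k (Suc k) f" for k
    by (rule C_k_SucI[where f'="\<lambda>x v. v$1 *\<^sub>R A x + v$2 *\<^sub>R B x", OF d])
       (intro C_k_add C_k_scaleR C_k_const smoothD A B)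
  then show "smooth f" using C_k_Suc_imp by (blast intro: smoothI)
  show "pd 1 f = A" "pd 2 f = B"
    by (auto simp: partial_derivI[OF d] axis_def)
qed

lemma smooth_deriv_line:
  fixes f :: "real^2 \<Rightarrow> 'b::real_normed_vector"
  assumes "smooth f"
  shows "((\<lambda>t. f (x + t *\<^sub>R h)) has_vector_derivative
     h$1 *\<^sub>R pd 1 f (x + t *\<^sub>R h) + h$2 *\<^sub>R pd 2 f (x + t *\<^sub>R h)) (at t within S)"
proof -
  have "((\<lambda>t. x + t *\<^sub>R h) has_derivative (\<lambda>t. t *\<^sub>R h)) (at t within S)"
    by (auto intro!: derivative_eq_intros)
  from has_derivative_compose[OF this smooth_has_derivative2[OF assms]]
  show ?thesis by (simp add: has_vector_derivative_def scaleR_add_right)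
qed

text \<open>The primitive is the integral along the ray from the origin. Its derivative along a line
  is computed under the integral sign; closedness turns the resulting integrand into a total
  derivative in the ray parameter.\<close>

lemma poincare:
  fixes A B :: "real^2 \<Rightarrow> complex"
  assumes A: "smooth A" and B: "smooth B" and closed: "\<And>x. pd 2 A x = pd 1 B x"
  obtains f where "smooth f" "pd 1 f = A" "pd 2 f = B"
proof -
  define f where "f x = integral {0..1} (\<lambda>s. (x$1) *\<^sub>R A (s *\<^sub>R x) + (x$2) *\<^sub>R B (s *\<^sub>R x))" for x
  have line: "((\<lambda>t. f (x + t *\<^sub>R h)) has_vector_derivative
      h$1 *\<^sub>R A (x + t *\<^sub>R h) + h$2 *\<^sub>R B (x + t *\<^sub>R h)) (at t)" for x h t
  proof -
    let ?y = "\<lambda>t. x + t *\<^sub>R h"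
    let ?G = "\<lambda>t s. (?y t)$1 *\<^sub>R A (s *\<^sub>R ?y t) + (?y t)$2 *\<^sub>R B (s *\<^sub>R ?y t)"
    let ?D = "\<lambda>g t s. h$1 *\<^sub>R pd 1 g (s *\<^sub>R ?y t) + h$2 *\<^sub>R pd 2 g (s *\<^sub>R ?y t)"
    let ?G' = "\<lambda>t s. (h$1 *\<^sub>R A (s *\<^sub>R ?y t) + (?y t)$1 *\<^sub>R s *\<^sub>R ?D A t s)
        + (h$2 *\<^sub>R B (s *\<^sub>R ?y t) + (?y t)$2 *\<^sub>R s *\<^sub>R ?D B t s)"
    \<comment> \<open>The antiderivative in \<open>s\<close> of the differentiated integrand
      \<open>?G' t\<close>; the factor \<open>s\<close> makes it vanish at 0.\<close>
    let ?H = "\<lambda>s. s *\<^sub>R (h$1 *\<^sub>R A (s *\<^sub>R ?y t) + h$2 *\<^sub>R B (s *\<^sub>R ?y t))"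
    have dg: "((\<lambda>t. g (s *\<^sub>R ?y t)) has_vector_derivative s *\<^sub>R ?D g t s) (at t within S)" if "smooth g" for g :: "real^2 \<Rightarrow> complex" and s t S
      using smooth_deriv_line[OF that, of "s *\<^sub>R x" "s *\<^sub>R h" t S]
      by (simp add: algebra_simps)
    have dy: "((\<lambda>t. (?y t)$i) has_vector_derivative h$i) (at t within S)" for i t S
      unfolding has_real_derivative_iff_has_vector_derivative[symmetric]
      by (auto intro!: derivative_eq_intros)
    have prod: "((\<lambda>t. (?y t)$i *\<^sub>R g (s *\<^sub>R ?y t)) has_vector_derivative
         h$i *\<^sub>R g (s *\<^sub>R ?y t) + (?y t)$i *\<^sub>R s *\<^sub>R ?D g t s) (at t within S)" if "smooth g" for g :: "real^2 \<Rightarrow> complex" and i s t S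
      using has_vector_derivative_scaleR[OF dy[unfolded has_real_derivative_iff_has_vector_derivative[symmetric]] dg[OF that, of s t S], of i]
      by (simp only: add.commute)
    have c: "continuous_on T (\<lambda>p. g (snd p *\<^sub>R (x + fst p *\<^sub>R h)))" if "smooth g" for g :: "real^2 \<Rightarrow> complex" and T
      by (rule smooth_continuous_on_compose[OF that]) (intro continuous_intros)
    have c1: "continuous_on T (\<lambda>s. g (s *\<^sub>R z))" if "smooth g" for g :: "real^2 \<Rightarrow> complex" and T z
      by (rule smooth_continuous_on_compose[OF that]) (intro continuous_intros)
    have L: "((\<lambda>t. integral (cbox 0 1) (?G t)) has_vector_derivative integral (cbox 0 1) (?G' t)) (at t within UNIV)"
    proof (rule leibniz_rule_vector_derivative)
      show "((\<lambda>t. ?G t s) has_vector_derivative ?G' t s) (at t within UNIV)" for t s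
        by (intro has_vector_derivative_add prod A B)
      show "?G t integrable_on cbox 0 1" for t
        by (intro integrable_continuous continuous_intros c1 A B)
      show "continuous_on (UNIV \<times> cbox 0 1) (\<lambda>(t, s). ?G' t s)"
        unfolding split_def by (intro continuous_intros c smooth_partial A B)
    qed auto
    have "(?H has_vector_derivative ?G' t s) (at s within T)" for s T
    proof -
      have g: "((\<lambda>s. g (s *\<^sub>R ?y t)) has_vector_derivative
         (?y t)$1 *\<^sub>R pd 1 g (s *\<^sub>R ?y t) + (?y t)$2 *\<^sub>R pd 2 g (s *\<^sub>R ?y t)) (at s within T)"
        if "smooth g" for g :: "real^2 \<Rightarrow> complex"
        using smooth_deriv_line[OF that, of 0 "?y t" s T] by simp
      have "(?H has_vector_derivative (s *\<^sub>R (h$1 *\<^sub>R ((?y t)$1 *\<^sub>R pd 1 A (s *\<^sub>R ?y t) + (?y t)$2 *\<^sub>R pd 2 A (s *\<^sub>R ?y t))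
         + h$2 *\<^sub>R ((?y t)$1 *\<^sub>R pd 1 B (s *\<^sub>R ?y t) + (?y t)$2 *\<^sub>R pd 2 B (s *\<^sub>R ?y t)))
         + 1 *\<^sub>R (h$1 *\<^sub>R A (s *\<^sub>R ?y t) + h$2 *\<^sub>R B (s *\<^sub>R ?y t)))) (at s within T)"
        by (intro has_vector_derivative_scaleR has_vector_derivative_add bounded_linear.has_vector_derivative[OF bounded_linear_scaleR_right] g A B)
           (auto intro!: derivative_eq_intros)
      moreover have "?G' t s = s *\<^sub>R (h$1 *\<^sub>R ((?y t)$1 *\<^sub>R pd 1 A (s *\<^sub>R ?y t) + (?y t)$2 *\<^sub>R pd 2 A (s *\<^sub>R ?y t))
         + h$2 *\<^sub>R ((?y t)$1 *\<^sub>R pd 1 B (s *\<^sub>R ?y t) + (?y t)$2 *\<^sub>R pd 2 B (s *\<^sub>R ?y t)))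
         + 1 *\<^sub>R (h$1 *\<^sub>R A (s *\<^sub>R ?y t) + h$2 *\<^sub>R B (s *\<^sub>R ?y t))"
        unfolding closed by (simp only: scaleR_add_right scaleR_scaleR scaleR_one mult_1_left mult_ac add_ac)
      ultimately show ?thesis by (simp only:)
    qed
    then have "integral {0..1} (?G' t) = ?H 1 - ?H 0"
      by (intro integral_unique fundamental_theorem_of_calculus) auto
    then show ?thesis using L by (simp add: f_def[abs_def] cbox_interval)
  qed
  \<comment> \<open>Derivatives along lines are upgraded to a total derivative by the mean value
    inequality, with continuity of \<open>A\<close> and \<open>B\<close> controlling the
    remainder.\<close>
  have "(f has_derivative (\<lambda>v. v$1 *\<^sub>R A x + v$2 *\<^sub>R B x)) (at x)" for x
    unfolding has_derivative_at_alt
  proof (intro conjI allI impI)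
    show "bounded_linear (\<lambda>v::real^2. v$1 *\<^sub>R A x + v$2 *\<^sub>R B x)"
      by (intro bounded_linear_add bounded_linear_compose[OF bounded_linear_scaleR_left] bounded_linear_vec_nth)
    fix e :: real assume e: "e > 0"
    have "continuous (at x) A" "continuous (at x) B"
      using smooth_continuous_on[OF A, of UNIV] smooth_continuous_on[OF B, of UNIV]
      by (auto simp: continuous_on_eq_continuous_at)
    then obtain d1 d2 where d: "d1 > 0" "\<And>y. dist y x < d1 \<Longrightarrow> dist (A y) (A x) < e/2"
        "d2 > 0" "\<And>y. dist y x < d2 \<Longrightarrow> dist (B y) (B x) < e/2"
      unfolding continuous_at_eps_delta by (metis half_gt_zero e)
    show "\<exists>d>0. \<forall>y. norm (y - x) < d \<longrightarrow>
        norm (f y - f x - ((y - x)$1 *\<^sub>R A x + (y - x)$2 *\<^sub>R B x)) \<le> e * norm (y - x)"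
    proof (intro exI conjI allI impI)
      show "min d1 d2 > 0" using d by simp
      fix y assume y: "norm (y - x) < min d1 d2"
      define h where "h = y - x"
      let ?c = "h$1 *\<^sub>R A x + h$2 *\<^sub>R B x"
      let ?f = "\<lambda>t. f (x + t *\<^sub>R h) - t *\<^sub>R ?c"
      let ?f' = "\<lambda>t. h$1 *\<^sub>R A (x + t *\<^sub>R h) + h$2 *\<^sub>R B (x + t *\<^sub>R h) - ?c"
      have dd: "(?f has_derivative (\<lambda>s. s *\<^sub>R ?f' t)) (at t)" for t
      proof -
        have "(?f has_vector_derivative ?f' t) (at t)"
          by (intro has_vector_derivative_diff line) (auto intro!: derivative_eq_intros)
        then show ?thesis by (simp add: has_vector_derivative_def)
      qed
      have "continuous_on {0..1} ?f"
        by (intro continuous_at_imp_continuous_on ballI has_derivative_continuous[OF dd])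
      from mvt_general[OF zero_less_one this dd]
      have "\<exists>t\<in>{0<..<1}. norm (?f 1 - ?f 0) \<le> norm (?f' t)" unfolding diff_zero scaleR_one .
      then obtain t where t: "t \<in> {0<..<1}" "norm (?f 1 - ?f 0) \<le> norm (?f' t)" by blast
      have "norm (t *\<^sub>R h) \<le> norm h" using t(1) by (simp add: mult_left_le_one_le)
      then have near: "dist (x + t *\<^sub>R h) x < d1" "dist (x + t *\<^sub>R h) x < d2"
        using y by (auto simp: dist_norm h_def)
      have "?f' t = h$1 *\<^sub>R (A (x + t *\<^sub>R h) - A x) + h$2 *\<^sub>R (B (x + t *\<^sub>R h) - B x)"
        by (simp add: algebra_simps)
      also have "norm \<dots> \<le> \<bar>h$1\<bar> * norm (A (x + t *\<^sub>R h) - A x) + \<bar>h$2\<bar> * norm (B (x + t *\<^sub>R h) - B x)"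
        by (metis norm_triangle_ineq norm_scaleR)
      also have "\<dots> \<le> norm h * (e/2) + norm h * (e/2)"
        using d(2)[OF near(1)] d(4)[OF near(2)] component_le_norm_cart[of h 1] component_le_norm_cart[of h 2]
        by (intro add_mono mult_mono) (auto simp: dist_norm)
      finally have le: "norm (?f' t) \<le> e * norm h" by (simp add: algebra_simps)
      have eq: "?f 1 - ?f 0 = f y - f x - ?c" by (simp add: h_def)
      have "norm (f y - f x - ?c) \<le> e * norm h"
        using order_trans[OF t(2) le] unfolding eq .
      then show "norm (f y - f x - ((y - x)$1 *\<^sub>R A x + (y - x)$2 *\<^sub>R B x)) \<le> e * norm (y - x)"
        by (simp only: h_def)
    qed
  qed
  from smooth_of_partials[OF this A B] that show ?thesis by blast
qed

text \<open>Uniform radii make \<open>f\<close> a covering: the balls of radius \<rho> in the target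
  are evenly covered. Sheets live in balls of half the injectivity radius, so that the centres of
  two overlapping sheets lie in one ball on which \<open>f\<close> is injective.\<close>

lemma bij_of_uniform_local_inverse:
  fixes f :: "'a::euclidean_space \<Rightarrow> 'b::euclidean_space"
  assumes cont: "continuous_on UNIV f" and dim: "DIM('b) \<le> DIM('a)"
    and r: "r > 0" "\<rho> > 0" and inj: "\<And>x. inj_on f (ball x r)"
    and sur: "\<And>x. ball (f x) \<rho> \<subseteq> f ` ball x (r/2)"
  shows "bij f"
proof -
  have cf: "continuous_on S f" for S using cont continuous_on_subset by blast
  \<comment> \<open>The range is open, and so is its complement: a point within \<rho> of a value of
    \<open>f\<close> is itself a value, with the same \<rho> everywhere.\<close>
  have range: "range f = UNIV"
  proof -
    have "open (range f)"
      unfolding open_contains_ball using sur r by fast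
    moreover have "open (- range f)"
      unfolding open_contains_ball
    proof
      fix w assume w: "w \<in> - range f"
      have "ball w \<rho> \<subseteq> - range f"
      proof
        fix z assume z: "z \<in> ball w \<rho>"
        show "z \<in> - range f"
        proof (rule ccontr)
          assume "z \<notin> - range f"
          then obtain y where "z = f y" by auto
          then have "w \<in> ball (f y) \<rho>" using z by (simp add: dist_commute)
          then show False using w sur by blast
        qed
      qed
      then show "\<exists>e>0. ball w e \<subseteq> - range f" using r by blast
    qed
    ultimately have "range f = {} \<or> range f = UNIV"
      using clopen[of "range f"] by (simp add: closed_def)
    then show ?thesis by auto
  qed
  have "covering_space UNIV f UNIV"
    unfolding covering_space_def
  proof (intro conjI ballI cont range)
    fix w :: 'b
    let ?T = "ball w \<rho>"
    let ?U = "\<lambda>x. ball x (r/2) \<inter> f -` ?T"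
    let ?v = "?U ` (f -` {w})"
    have inj2: "x = x'" if "y \<in> ball x (r/2)" "y \<in> ball x' (r/2)" "f x = f x'" for x x' y
    proof (rule inj_onD[OF inj[of y] that(3)])
      show "x \<in> ball y r" "x' \<in> ball y r" using that r by (auto simp: dist_commute)
    qed
    have U_open: "open (?U x)" for x
      using cont by (intro open_Int open_ball open_vimage)
    show "\<exists>T. w \<in> T \<and> openin (top_of_set UNIV) T \<and>
      (\<exists>v. \<Union>v = UNIV \<inter> f -` T \<and> (\<forall>u\<in>v. openin (top_of_set UNIV) u) \<and> pairwise disjnt v \<and>
        (\<forall>u\<in>v. \<exists>q. homeomorphism u T f q))"
    proof (intro exI[of _ ?T] conjI exI[of _ ?v] ballI)
      show "w \<in> ?T" "openin (top_of_set UNIV) ?T" using r by auto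
      show "\<Union> ?v = UNIV \<inter> f -` ?T"
      proof
        show "UNIV \<inter> f -` ?T \<subseteq> \<Union> ?v"
        proof
          fix y assume "y \<in> UNIV \<inter> f -` ?T"
          then have y: "f y \<in> ?T" by simp
          then have "w \<in> f ` ball y (r/2)" using sur[of y] by (auto simp: dist_commute)
          then obtain x where "w = f x" "x \<in> ball y (r/2)" by blast
          then have "x \<in> f -` {w}" "y \<in> ?U x" using y by (auto simp: dist_commute)
          then show "y \<in> \<Union> ?v" by blast
        qed
      qed auto
      show "openin (top_of_set UNIV) u" if "u \<in> ?v" for u using that U_open by auto
      show "pairwise disjnt ?v"
      proof (rule pairwiseI)
        fix a b assume ab: "a \<in> ?v" "b \<in> ?v" "a \<noteq> b"
        then obtain x x' where xx: "a = ?U x" "b = ?U x'" "f x = w" "f x' = w" by auto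
        show "disjnt a b"
        proof (rule ccontr)
          assume "\<not> disjnt a b"
          then obtain y where "y \<in> a" "y \<in> b" by (auto simp: disjnt_iff)
          then have "x = x'" using inj2[of y x x'] xx by auto
          then show False using ab xx by simp
        qed
      qed
      fix u assume "u \<in> ?v"
      then obtain x where x: "u = ?U x" "f x = w" by auto
      have inj_u: "inj_on f u"
        using r by (intro inj_on_subset[OF inj[of x]]) (auto simp: x)
      have im: "f ` u = ?T"
        using sur[of x] by (auto simp: x)
      have "\<exists>q. homeomorphism u ?T f q"
      proof (rule homeomorphism_injective_open_map[OF cf im inj_u])
        fix V assume "openin (top_of_set u) V"
        then have V: "open V" "V \<subseteq> u" using U_open[of x] by (auto simp: x openin_open_eq)
        have "open (f ` V)"
          by (rule invariance_of_domain_gen[OF V(1) cf inj_on_subset[OF inj_u V(2)] dim])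
        then show "openin (top_of_set ?T) (f ` V)"
          using V(2) im by (intro open_openin_trans) auto
      qed blast
      then show "\<exists>q. homeomorphism u ?T f q" .
    qed
  qed
  note cov = this
  \<comment> \<open>A segment joining two preimages maps to a loop, which is null-homotopic in the
    target; lifting the homotopy forces the segment to close up.\<close>
  have "inj f"
  proof (rule injI)
    fix a b assume ab: "f a = f b"
    let ?g = "f \<circ> linepath a b"
    have pg: "path ?g" by (rule path_continuous_image) (auto intro: cf)
    have sc: "simply_connected (UNIV :: 'b set)" by (rule convex_imp_simply_connected) simp
    have hom: "homotopic_paths UNIV ?g (linepath (f a) (f a))"
      using sc pg ab unfolding simply_connected_eq_homotopic_paths
      by (auto simp: pathstart_compose pathfinish_compose)
    have "homotopic_paths UNIV (linepath a b) (linepath a a)"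
      by (rule covering_space_lift_homotopic_paths[OF cov pg subset_UNIV path_linepath subset_UNIV hom
            path_linepath subset_UNIV _ path_linepath subset_UNIV]) (auto simp: linepath_refl pathstart_def linepath_0')
    then show "a = b" using homotopic_paths_imp_pathfinish by fastforce
  qed
  then show ?thesis using range by (simp add: bij_def)
qed

text \<open>Cramer's rule: the inverse of the differential of \<open>f\<close>, whose determinant is
  \<open>jac f x\<close>.\<close>

definition pd_inv :: "(real^2 \<Rightarrow> complex) \<Rightarrow> real^2 \<Rightarrow> complex \<Rightarrow> real^2" where
  "pd_inv f x w = plane_pt (Im (cnj w * pd 2 f x) / jac f x) (Im (cnj (pd 1 f x) * w) / jac f x)"

lemma pd_inv_left:
  assumes "jac f x \<noteq> 0"
  shows "pd_inv f x (v$1 *\<^sub>R pd 1 f x + v$2 *\<^sub>R pd 2 f x) = v"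
proof -
  obtain a b where a: "pd 1 f x = Complex a b" by (cases "pd 1 f x")
  obtain c d where c: "pd 2 f x = Complex c d" by (cases "pd 2 f x")
  have J: "jac f x = a * d - b * c" by (simp add: jac_def a c)
  have "Im (cnj (v$1 *\<^sub>R Complex a b + v$2 *\<^sub>R Complex c d) * Complex c d) = v$1 * (a * d - b * c)"
    "Im (cnj (Complex a b) * (v$1 *\<^sub>R Complex a b + v$2 *\<^sub>R Complex c d)) = v$2 * (a * d - b * c)"
    by (simp_all add: algebra_simps)
  then show ?thesis using assms by (simp add: pd_inv_def J a c)
qed

lemma pd_inv_linear: "bounded_linear (pd_inv f x)"
  unfolding pd_inv_def[abs_def] plane_pt_def divide_inverse
  by (intro bounded_linear_add bounded_linear_compose[OF bounded_linear_scaleR_left]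
      bounded_linear_compose[OF bounded_linear_mult_left] bounded_linear_compose[OF bounded_linear_Im]
      bounded_linear_compose[OF bounded_linear_mult_right] bounded_linear_cnj bounded_linear_ident)

text \<open>Translation by lattice vectors changes \<open>f\<close> by constants only, so radii
  found over the compact fundamental square are valid on the whole plane.\<close>

lemma torus_map_bij:
  assumes sm: "smooth f" and J: "\<And>x. jac f x \<noteq> 0"
    and quasi: "\<And>x n. n \<in> int_lattice \<Longrightarrow> f (x + n) = f x + t n"
  shows "bij f"
proof -
  let ?f' = "\<lambda>x v::real^2. v$1 *\<^sub>R pd 1 f x + v$2 *\<^sub>R pd 2 f x"
  note cont = smooth_continuous_on[OF sm]
  have "\<exists>r>0. inj_on f (ball a r)" for a
  proof (rule has_derivative_locally_injective[of a UNIV "pd_inv f a" ?f' f])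
    show "pd_inv f a \<circ> ?f' a = id" using pd_inv_left[OF J] by (auto simp: fun_eq_iff)
    show "(f has_derivative ?f' x) (at x)" for x by (rule smooth_has_derivative2[OF sm])
    fix e :: real assume e: "e > 0"
    have "continuous (at a) (pd i f)" for i
      using smooth_continuous_on[OF smooth_partial[OF sm], of UNIV] by (auto simp: continuous_on_eq_continuous_at)
    note c = this[unfolded continuous_at_eps_delta]
    have "\<exists>d>0. \<forall>y. dist y a < d \<longrightarrow> dist (pd i f y) (pd i f a) < e/4" for i
      by (rule mp[OF spec[OF c, of "e/4"]]) (use e in simp)
    then obtain d where d: "\<And>i. d i > 0" "\<And>i y. dist y a < d i \<Longrightarrow> dist (pd i f y) (pd i f a) < e/4"
      by metis
    show "\<exists>d>0. \<forall>x. dist a x < d \<longrightarrow> onorm (\<lambda>v. ?f' x v - ?f' a v) < e"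
    proof (intro exI conjI allI impI)
      show "min (d 1) (d 2) > 0" using d(1) by simp
      fix x assume x: "dist a x < min (d 1) (d 2)"
      have "norm (?f' x v - ?f' a v) \<le> (e/2) * norm v" for v
      proof -
        have "?f' x v - ?f' a v = v$1 *\<^sub>R (pd 1 f x - pd 1 f a) + v$2 *\<^sub>R (pd 2 f x - pd 2 f a)"
          by (simp add: algebra_simps)
        also have "norm \<dots> \<le> \<bar>v$1\<bar> * norm (pd 1 f x - pd 1 f a) + \<bar>v$2\<bar> * norm (pd 2 f x - pd 2 f a)"
          by (metis norm_triangle_ineq norm_scaleR)
        also have "\<dots> \<le> norm v * (e/4) + norm v * (e/4)"
          using d(2)[of x 1] d(2)[of x 2] x component_le_norm_cart[of v 1] component_le_norm_cart[of v 2]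
          by (intro add_mono mult_mono) (auto simp: dist_norm norm_minus_commute)
        finally show ?thesis by (simp add: algebra_simps)
      qed
      then have "onorm (\<lambda>v. ?f' x v - ?f' a v) \<le> e/2" by (rule onorm_le)
      then show "onorm (\<lambda>v. ?f' x v - ?f' a v) < e" using e by linarith
    qed
  qed (auto intro: pd_inv_linear)
  then obtain R where R: "\<And>a. R a > 0" "\<And>a. inj_on f (ball a (R a))" by metis
  \<comment> \<open>A Lebesgue number of the cover by balls of injectivity.\<close>
  obtain r where r: "r > 0" "\<And>x. x \<in> cbox (0::real^2) 1 \<Longrightarrow> \<exists>G\<in>range (\<lambda>a. ball a (R a)). ball x r \<subseteq> G"
  proof (rule Heine_Borel_lemma[of "cbox (0::real^2) 1" "range (\<lambda>a. ball a (R a))"])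
    show "cbox (0::real^2) 1 \<subseteq> \<Union> (range (\<lambda>a. ball a (R a)))"
    proof
      fix x :: "real^2"
      have "x \<in> ball x (R x)" using R(1) by simp
      then show "x \<in> \<Union> (range (\<lambda>a. ball a (R a)))" by blast
    qed
  qed auto
  have inj: "inj_on f (ball x r)" for x
  proof (rule inj_onI)
    fix y z assume yz: "y \<in> ball x r" "z \<in> ball x r" "f y = f z"
    obtain n where n: "n \<in> int_lattice" "x + n \<in> cbox 0 1" by (rule int_lattice_reduce)
    have "inj_on f (ball (x + n) r)" using r(2)[OF n(2)] R(2) inj_on_subset by blast
    moreover have "f (y + n) = f (z + n)" using yz(3) quasi[OF n(1)] by simp
    moreover have "y + n \<in> ball (x + n) r" "z + n \<in> ball (x + n) r" using yz by (auto simp: dist_norm)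
    ultimately have "y + n = z + n" by (meson inj_onD)
    then show "y = z" by simp
  qed
  \<comment> \<open>Pairs of a base point and a displacement of length \<open>r/2\<close>. By
    compactness \<open>f\<close> moves the images of all such pairs apart by a least distance, and
    injectivity makes it positive.\<close>
  define K where "K = cbox (0::real^2) 1 \<times> sphere (0::real^2) (r/2)"
  have K: "compact K" "K \<noteq> {}"
  proof -
    show "compact K" unfolding K_def by (intro compact_Times) auto
    have "(0, (r/2) *\<^sub>R axis 1 1) \<in> K" using r(1) by (auto simp: K_def mem_box_cart norm_axis_1)
    then show "K \<noteq> {}" by blast
  qed
  have "continuous_on K (\<lambda>p. dist (f (fst p + snd p)) (f (fst p)))"
    by (intro continuous_intros smooth_continuous_on_compose[OF sm])
  from continuous_attains_inf[OF K this] obtain p where p: "p \<in> K"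
    "\<And>q. q \<in> K \<Longrightarrow> dist (f (fst p + snd p)) (f (fst p)) \<le> dist (f (fst q + snd q)) (f (fst q))" by blast
  define \<rho> where "\<rho> = dist (f (fst p + snd p)) (f (fst p))"
  have rho: "\<rho> > 0"
  proof -
    have "snd p \<noteq> 0" "norm (snd p) < r" using p(1) r(1) by (auto simp: K_def)
    then have "f (fst p + snd p) \<noteq> f (fst p)"
      using inj_onD[OF inj[of "fst p"], of "fst p + snd p" "fst p"] r(1) by (auto simp: dist_norm)
    then show ?thesis by (simp add: \<rho>_def)
  qed
  have far: "\<rho> \<le> dist (f y) (f x)" if "dist x y = r/2" for x y
  proof -
    obtain n where n: "n \<in> int_lattice" "x + n \<in> cbox 0 1" by (rule int_lattice_reduce)
    have "(x + n, y - x) \<in> K" using n that by (auto simp: K_def dist_norm norm_minus_commute)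
    from p(2)[OF this] have "\<rho> \<le> dist (f (y + n)) (f (x + n))" by (simp add: \<rho>_def algebra_simps)
    then show ?thesis using quasi[OF n(1)] by simp
  qed
  \<comment> \<open>The image of the open ball is open by invariance of domain. Within the ball of
    radius \<rho> it is also closed, because the bounding sphere is mapped outside; connectedness
    does the rest.\<close>
  have "ball (f x) \<rho> \<subseteq> f ` ball x (r/2)" for x
  proof -
    let ?B = "ball (f x) \<rho>" and ?V = "f ` ball x (r/2)"
    have "open ?V"
      using r(1) by (intro invariance_of_domain_gen inj_on_subset[OF inj[of x]] cont) auto
    moreover have "closed (f ` cball x (r/2))"
      by (intro compact_imp_closed compact_continuous_image cont) auto
    moreover have "?B \<inter> f ` cball x (r/2) = ?B \<inter> ?V"
    proof (intro equalityI subsetI)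
      fix w assume w: "w \<in> ?B \<inter> f ` cball x (r/2)"
      then obtain y where y: "w = f y" "dist x y \<le> r/2" by auto
      have "dist x y \<noteq> r/2"
      proof
        assume "dist x y = r/2"
        from far[OF this] w y(1) show False by (simp add: dist_commute)
      qed
      then show "w \<in> ?B \<inter> ?V" using w y by auto
    qed auto
    ultimately have "openin (top_of_set ?B) (?B \<inter> ?V)" "closedin (top_of_set ?B) (?B \<inter> ?V)"
      by (auto simp: openin_open_Int) (metis closedin_closed_Int)
    moreover have "connected ?B" by (rule connected_ball)
    ultimately have "?B \<inter> ?V = {} \<or> ?B \<inter> ?V = ?B" by (auto simp: connected_clopen)
    moreover have "f x \<in> ?B \<inter> ?V" using rho r(1) by auto
    ultimately have "?B \<inter> ?V = ?B" by blast
    then show ?thesis by blast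
  qed
  then show ?thesis
    using bij_of_uniform_local_inverse[OF cont _ r(1) rho inj] by auto
qed

lemma inv_has_derivative:
  assumes sm: "smooth f" and J: "\<And>x. jac f x \<noteq> 0" and bij: "bij f"
  shows "(inv f has_derivative pd_inv f (inv f w)) (at w)"
proof -
  note cont = smooth_continuous_on[OF sm]
  have fi: "f (inv f w) = w" for w using bij by (simp add: bij_is_surj surj_f_inv_f)
  have inj: "inj_on f S" for S using bij bij_is_inj inj_on_subset by blast
  let ?x = "inv f w"
  have "(inv f has_derivative pd_inv f ?x) (at (f ?x))"
  proof (rule has_derivative_inverse[of "cball ?x 1" ?x f])
    have "open (f ` ball ?x 1)" by (intro invariance_of_domain_gen inj cont) auto
    moreover have "f ` ball ?x 1 \<subseteq> f ` cball ?x 1" by auto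
    ultimately have "f ` ball ?x 1 \<subseteq> interior (f ` cball ?x 1)" by (rule interior_maximal[rotated])
    then show "f ?x \<in> interior (f ` cball ?x 1)" by auto
    show "inv f (f y) = y" for y using bij by (simp add: bij_is_inj)
    show "(f has_derivative (\<lambda>v. v$1 *\<^sub>R pd 1 f ?x + v$2 *\<^sub>R pd 2 f ?x)) (at ?x)"
      by (rule smooth_has_derivative2[OF sm])
    show "pd_inv f ?x \<circ> (\<lambda>v. v$1 *\<^sub>R pd 1 f ?x + v$2 *\<^sub>R pd 2 f ?x) = id"
      using pd_inv_left[OF J] by (auto simp: fun_eq_iff)
  qed (auto intro: cont pd_inv_linear)
  then show ?thesis by (simp add: fi)
qed

text \<open>A bootstrap: the derivative of \<open>inv f\<close> is a smooth function composed with
  \<open>inv f\<close>, so each order of differentiability yields the next.\<close>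

lemma smooth_inv:
  assumes sm: "smooth f" and J: "\<And>x. jac f x \<noteq> 0" and bij: "bij f"
  shows "smooth (inv f)"
proof -
  note d = inv_has_derivative[OF assms]
  have "smooth (\<lambda>x. pd_inv f x v)" for v
    unfolding pd_inv_def plane_pt_def
    by (intro smooth_intros sm J)
  then have s: "C_k k (\<lambda>x. pd_inv f x v)" for k v by (rule smoothD)
  have "C_k k (inv f)" for k
  proof (induction k)
    case 0
    have "continuous_on UNIV (inv f)"
      using d by (meson continuous_at_imp_continuous_on has_derivative_continuous)
    then show ?case by simp
  next
    case (Suc k)
    show ?case
    proof (rule C_k_SucI[where f'="\<lambda>w. pd_inv f (inv f w)", OF d])
      show "C_k k (\<lambda>w. pd_inv f (inv f w) v)" for v
        by (rule C_k_compose[OF s Suc.IH])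
    qed
  qed
  then show ?thesis by (rule smoothI)
qed

section \<open>Uniformization of tori\<close>

lemma int_lattice_cases:
  assumes "n \<in> int_lattice"
  obtains k l :: int where "n = plane_pt (of_int k) (of_int l)"
proof -
  obtain k l where "n$1 = of_int k" "n$2 = of_int l"
    using assms unfolding int_lattice_def by (metis (mono_tags) Ints_cases mem_Collect_eq)
  then have "n = plane_pt (of_int k) (of_int l)" by (metis plane_pt_eta)
  then show ?thesis using that by blast
qed

lemma plane_pt_in_int_lattice: "plane_pt (of_int k) (of_int l) \<in> int_lattice"
  by (auto simp: int_lattice_def forall_2)

lemma shift_int:
  fixes f :: "real^2 \<Rightarrow> 'b::real_vector"
  assumes "\<And>x. f (x + v) = f x + w"
  shows "f (x + of_int k *\<^sub>R v) = f x + of_int k *\<^sub>R w"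
proof -
  have n: "f (x + of_nat j *\<^sub>R v) = f x + of_nat j *\<^sub>R w" for j x
  proof (induction j)
    case (Suc j)
    have "f (x + of_nat (Suc j) *\<^sub>R v) = f ((x + of_nat j *\<^sub>R v) + v)" by (simp add: algebra_simps)
    also have "\<dots> = f (x + of_nat j *\<^sub>R v) + w" by (rule assms)
    finally show ?case using Suc by (simp add: algebra_simps)
  qed simp
  show ?thesis
  proof (cases "k \<ge> 0")
    case True
    then show ?thesis using n[of x "nat k"] by simp
  next
    case False
    then show ?thesis using n[of "x + of_int k *\<^sub>R v" "nat (- k)"] by (simp add: algebra_simps)
  qed
qed

lemma shift_lattice:
  fixes f :: "real^2 \<Rightarrow> 'b::real_vector"
  assumes "\<And>x i. f (x + axis i 1) = f x + t i"
  shows "f (x + plane_pt (of_int k) (of_int l)) = f x + (of_int k *\<^sub>R t 1 + of_int l *\<^sub>R t 2)"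
proof -
  have "f ((x + of_int k *\<^sub>R axis 1 1) + of_int l *\<^sub>R axis 2 1) = f x + of_int k *\<^sub>R t 1 + of_int l *\<^sub>R t 2"
    by (simp only: shift_int[where f=f and v="axis 1 1" and w="t 1", OF assms]
        shift_int[where f=f and v="axis 2 1" and w="t 2", OF assms])
  then show ?thesis by (simp add: plane_pt_def add.assoc)
qed

lemma periodicI_axes:
  fixes f :: "real^2 \<Rightarrow> 'b::real_vector"
  assumes "\<And>x i. f (x + axis i 1) = f x" shows "periodic f"
  unfolding periodic_def
proof (intro allI ballI)
  fix x n assume "n \<in> int_lattice"
  then obtain k l where "n = plane_pt (of_int k) (of_int l)" by (rule int_lattice_cases)
  then show "f (x + n) = f x" using shift_lattice[of f "\<lambda>_. 0" x k l] assms by simp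
qed

lemma smooth_shift: "smooth f \<Longrightarrow> smooth (\<lambda>x. f (x + n))" for f :: "real^2 \<Rightarrow> 'b::real_normed_vector"
  by (rule smooth_compose[of f "\<lambda>x. x + n"]) (assumption, intro smooth_intros)

lemma constant_of_partials:
  fixes f :: "real^2 \<Rightarrow> complex"
  assumes "smooth f" "\<And>i x. pd i f x = 0"
  shows "f x = f y"
proof (rule has_derivative_zero_unique[of UNIV f])
  show "(f has_derivative (\<lambda>h. 0)) (at x within UNIV)" for x
    using smooth_has_derivative2[OF assms(1), of x] by (simp add: assms(2))
qed auto

lemma quasi_periodic:
  fixes f :: "real^2 \<Rightarrow> complex"
  assumes f: "smooth f" and p: "\<And>i x. pd i f (x + n) = c * pd i f x"
  shows "f (x + n) = c * f x + (f n - c * f 0)"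
proof -
  have "f (x + n) - c * f x = f (0 + n) - c * f 0"
  proof (rule constant_of_partials[of "\<lambda>x. f (x + n) - c * f x"])
    show "smooth (\<lambda>x. f (x + n) - c * f x)" by (intro smooth_intros smooth_shift f)
    show "pd i (\<lambda>x. f (x + n) - c * f x) x = 0" for i x
      using p by (simp add: pd_diff smooth_shift f smooth_mult smooth_const pd_mult pd_const pd_shift)
  qed
  then show ?thesis by (simp add: algebra_simps)
qed

text \<open>Subtracting the linear map \<open>L\<close> with the same periods leaves a periodic
  \<open>p\<close>. Its Jacobian and the mixed terms have mean zero, so only the signed area of the
  period parallelogram remains.\<close>

lemma tint_jac:
  assumes f: "smooth f" and t: "\<And>x i. f (x + axis i 1) = f x + t i"
  shows "tint (jac f) = Im (cnj (t 1) * t 2)"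
proof -
  define L where "L x = (x$1) *\<^sub>R t 1 + (x$2) *\<^sub>R t 2" for x :: "real^2"
  have L: "bounded_linear L" unfolding L_def[abs_def]
    by (intro bounded_linear_add bounded_linear_compose[OF bounded_linear_scaleR_left] bounded_linear_vec_nth)
  define p where "p x = f x - L x" for x
  have sp: "smooth p" unfolding p_def[abs_def] by (intro smooth_intros f smooth_linear L)
  have Lt: "L (axis i 1) = t i" for i
    using exhaust_2[of i] by (auto simp: L_def axis_def)
  then have "p (x + axis i 1) = p x" for x i
    by (simp add: p_def t linear_add[OF bounded_linear.linear[OF L]])
  then have p: "torus_smooth p" using sp periodicI_axes by (auto simp: torus_smooth_def)
  have feq: "f = (\<lambda>x. p x + L x)" by (simp add: p_def)
  have "pd i f = (\<lambda>x. pd i p x + L (axis i 1))" for i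
    by (subst feq) (simp only: pd_add[OF sp smooth_linear[OF L]] pd_linear[OF L])
  then have pd: "pd i f = (\<lambda>x. pd i p x + t i)" for i
    by (simp only: Lt)
  have "jac f = (\<lambda>x. jac p x + (Im (cnj (t 1) * pd 2 p x) + (Im (- cnj (t 2) * pd 1 p x) + Im (cnj (t 1) * t 2))))"
    by (auto simp: jac_def pd algebra_simps)
  moreover have z: "tint (\<lambda>x. Im (c * pd i p x)) = 0" for c i
  proof -
    have "tint (\<lambda>x. Im (c * pd i p x)) = Im (c * tint (pd i p))"
      by (rule tint_bounded_linear[OF bounded_linear_compose[OF bounded_linear_Im bounded_linear_mult_right]])
         (intro torus_continuous torus_intros p)
    then show ?thesis by (simp add: tint_partial[OF p])
  qed
  have c1: "continuous_on UNIV (jac p)" by (intro smooth_continuous_on smooth_intros sp)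
  have c2: "continuous_on UNIV (\<lambda>x. Im (c * pd i p x))" for c i
    by (intro torus_continuous torus_intros p)
  have c3: "continuous_on UNIV (\<lambda>x. Im (- cnj (t 2) * pd 1 p x) + Im (cnj (t 1) * t 2))"
    by (intro continuous_on_add c2 continuous_on_const)
  have c4: "continuous_on UNIV (\<lambda>x. Im (cnj (t 1) * pd 2 p x) + (Im (- cnj (t 2) * pd 1 p x) + Im (cnj (t 1) * t 2)))"
    by (intro continuous_on_add c2 c3)
  ultimately show ?thesis
    by (simp only: tint_add[OF c1 c4] tint_add[OF c2 c3] tint_add[OF c2 continuous_on_const] z tint_jac_torus[OF p] tint_const add_0_left)
qed

text \<open>
  Solving the Beltrami equation for the logarithm \<open>\<sigma>\<close> of \<open>\<partial>\<^sub>z \<psi>\<close> rather than for \<open>\<psi>\<close> makes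
  \<open>\<partial>\<^sub>z \<psi> = exp \<sigma>\<close> nonvanishing. The price is that \<open>\<sigma>\<close> is periodic only up to an imaginary linear
  function, i.e. \<open>\<psi>\<close> has a unitary character as multiplier; the character is trivial because
  otherwise the Jacobian of \<open>\<psi>\<close> would have mean zero.
\<close>

lemma torus_flat_coordinate:
  fixes a b :: "real^2 \<Rightarrow> complex"
  assumes a: "torus_smooth a" and b: "torus_smooth b" and pos: "\<And>x. Im (cnj (a x) * b x) > 0"
  obtains \<psi> r t where "smooth \<psi>" "\<And>x. pd 1 \<psi> x = r x * a x" "\<And>x. pd 2 \<psi> x = r x * b x"
    "\<And>x. r x \<noteq> 0" "\<And>x n. n \<in> int_lattice \<Longrightarrow> \<psi> (x + n) = \<psi> x + t n"
proof -
  \<comment> \<open>The coefficients of \<open>dz\<close> and of its conjugate in the form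
    \<open>a dx1 + b dx2\<close>. By \<open>pq\<close>, positivity of the Jacobian is what makes
    \<mu> smaller than 1 in modulus.\<close>
  define p where "p x = (a x - \<i> * b x) / 2" for x
  define q where "q x = (a x + \<i> * b x) / 2" for x
  have pq: "(cmod (p x))\<^sup>2 = (cmod (q x))\<^sup>2 + Im (cnj (a x) * b x)" for x
  proof -
    obtain a1 a2 where ax: "a x = Complex a1 a2" by (cases "a x")
    obtain b1 b2 where bx: "b x = Complex b1 b2" by (cases "b x")
    show ?thesis unfolding p_def q_def ax bx cmod_power2
      by (simp add: power2_eq_square field_simps)
  qed
  have p0: "p x \<noteq> 0" for x using pq[of x] pos[of x] by (smt (verit) norm_zero power_zero_numeral zero_le_power2)
  define \<mu> where "\<mu> x = q x / p x" for x
  have mu: "torus_smooth \<mu>"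
    unfolding \<mu>_def[abs_def] using p0 unfolding p_def q_def by (intro torus_intros a b) auto
  have mu1: "cmod (\<mu> x) < 1" for x
  proof -
    have "(cmod (q x))\<^sup>2 < (cmod (p x))\<^sup>2" using pq[of x] pos[of x] by simp
    then have "cmod (q x) < cmod (p x)" using power_less_imp_less_base norm_ge_zero by blast
    then show ?thesis using p0[of x] by (simp add: \<mu>_def norm_divide)
  qed
  obtain x0 where x0: "\<And>x. cmod (\<mu> x) \<le> cmod (\<mu> x0)"
    using torus_bounded[OF torus_continuous[OF mu] torus_smoothD(2)[OF mu]] by blast
  obtain u m where u: "torus_smooth u" and um: "\<And>x. wirt_zb u x + m = wirt_z \<mu> x + \<mu> x * (wirt_z u x - cnj m)"
    using beltrami_solvable[OF mu x0 mu1 wirt_torus(1)[OF mu]] by blast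
  \<comment> \<open>The imaginary linear function whose Wirtinger derivatives are
    \<open>- cnj m\<close> and \<open>m\<close>; hence \<open>u + l\<close> solves the Beltrami
    equation without constants.\<close>
  define l where "l x = 2 * \<i> * (of_real (Im m * x$1 - Re m * x$2))" for x :: "real^2"
  have l: "bounded_linear l" unfolding l_def[abs_def] of_real_diff of_real_mult
    by (intro bounded_linear_compose[OF bounded_linear_mult_right] bounded_linear_sub
        bounded_linear_compose[OF bounded_linear_of_real] bounded_linear_vec_nth)
  define P where "P x = exp (u x + l x)" for x
  have su: "smooth u" "smooth l" "smooth \<mu>" using torus_smoothD(1)[OF u] torus_smoothD(1)[OF mu] smooth_linear[OF l] by auto
  have P: "smooth P" unfolding P_def[abs_def] by (intro smooth_intros su)
  have P0: "P x \<noteq> 0" for x by (simp add: P_def)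
  have pdl: "pd 1 l = (\<lambda>x. 2 * \<i> * of_real (Im m))" "pd 2 l = (\<lambda>x. - 2 * \<i> * of_real (Re m))"
    by (simp_all add: pd_linear[OF l] l_def axis_def)
  have pdP: "pd 1 P = (\<lambda>x. P x * (pd 1 u x + 2 * \<i> * of_real (Im m)))"
    "pd 2 P = (\<lambda>x. P x * (pd 2 u x - 2 * \<i> * of_real (Re m)))"
    unfolding P_def[abs_def] by (simp_all add: pd_exp smooth_add su pd_add pdl)
  define A where "A x = P x * (1 + \<mu> x)" for x
  define B where "B x = \<i> * (P x * (1 - \<mu> x))" for x
  have AB: "smooth A" "smooth B" unfolding A_def[abs_def] B_def[abs_def] by (intro smooth_intros P su)+
  have closed: "pd 2 A x = pd 1 B x" for x
  proof -
    have pA: "pd 2 A x = P x * ((pd 2 u x - 2 * \<i> * of_real (Re m)) * (1 + \<mu> x) + pd 2 \<mu> x)"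
      unfolding A_def[abs_def] pd_mult[OF P smooth_add[OF smooth_const su(3)]] pd_add[OF smooth_const su(3)] pd_const pdP
      by (simp add: algebra_simps)
    have pB: "pd 1 B x = \<i> * P x * ((pd 1 u x + 2 * \<i> * of_real (Im m)) * (1 - \<mu> x) - pd 1 \<mu> x)"
      unfolding B_def[abs_def] pd_mult[OF smooth_const smooth_mult[OF P smooth_diff[OF smooth_const su(3)]]]
          pd_mult[OF P smooth_diff[OF smooth_const su(3)]] pd_diff[OF smooth_const su(3)] pd_const pdP
      by (simp add: algebra_simps)
    define z w where "z = wirt_z u x - cnj m" and "w = wirt_zb u x + m"
    have 2: "pd 2 u x - 2 * \<i> * of_real (Re m) = \<i> * (z - w)"
      unfolding wirt_partial(2) z_def w_def by (simp add: complex_eq_iff)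
    have 1: "pd 1 u x + 2 * \<i> * of_real (Im m) = z + w"
      unfolding wirt_partial(1) z_def w_def by (simp add: complex_eq_iff)
    have w: "w = wirt_z \<mu> x + \<mu> x * z" using um by (simp add: w_def z_def)
    show ?thesis unfolding pA pB 1 2 wirt_partial[of \<mu>] w by (simp add: algebra_simps)
  qed
  obtain \<psi> where psi: "smooth \<psi>" "pd 1 \<psi> = A" "pd 2 \<psi> = B"
    using poincare[OF AB closed] by blast
  define \<gamma> where "\<gamma> n = exp (l n)" for n
  have chi_norm: "cmod (\<gamma> n) = 1" for n by (simp add: \<gamma>_def norm_exp l_def)
  have P_shift: "P (x + n) = \<gamma> n * P x" if "n \<in> int_lattice" for x n
    using periodicD[OF torus_smoothD(2)[OF u] that, of x]
    by (simp add: P_def \<gamma>_def linear_add[OF bounded_linear.linear[OF l]] exp_add[symmetric] algebra_simps)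
  have mu_shift: "\<mu> (x + n) = \<mu> x" if "n \<in> int_lattice" for x n
    by (rule periodicD[OF torus_smoothD(2)[OF mu] that])
  have pd_shift: "pd i \<psi> (x + n) = \<gamma> n * pd i \<psi> x" if "n \<in> int_lattice" for i x n
    using exhaust_2[of i] by (auto simp: psi A_def B_def P_shift[OF that] mu_shift[OF that])
  define t where "t n = \<psi> n - \<gamma> n * \<psi> 0" for n
  have quasi: "\<psi> (x + n) = \<gamma> n * \<psi> x + t n" if "n \<in> int_lattice" for x n
    unfolding t_def by (rule quasi_periodic[OF psi(1) pd_shift[OF that]])
  have jac: "jac \<psi> x = (cmod (P x))\<^sup>2 * (1 - (cmod (\<mu> x))\<^sup>2)" for x
  proof -
    obtain c d where c: "P x = Complex c d" by (cases "P x")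
    obtain e f where e: "\<mu> x = Complex e f" by (cases "\<mu> x")
    show ?thesis unfolding jac_def psi A_def B_def c e cmod_power2
      by (simp add: power2_eq_square algebra_simps)
  qed
  have jac_pos: "jac \<psi> x > 0" for x
    unfolding jac using P0[of x] mu1[of x] by (simp add: power_less_one_iff abs_square_less_1)
  \<comment> \<open>A nontrivial multiplier gives the affine action of \<open>n0\<close> on values a
    fixed point \<open>c\<close>. Moving it to the origin makes every translation act by
    multiplication alone, so \<open>tint_jac_exact\<close> applies, against positivity of the
    Jacobian.\<close>
  have chi1: "\<gamma> n0 = 1" if n0: "n0 \<in> int_lattice" for n0
  proof (rule ccontr)
    assume neq: "\<gamma> n0 \<noteq> 1"
    define c where "c = t n0 / (1 - \<gamma> n0)"
    define \<phi> where "\<phi> x = \<psi> x - c" for x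
    have pdphi: "pd i \<phi> = pd i \<psi>" for i
      unfolding \<phi>_def[abs_def] by (simp add: pd_diff psi(1) smooth_const pd_const)
    have sphi: "smooth \<phi>" unfolding \<phi>_def[abs_def] by (intro smooth_intros psi)
    have phi0: "\<phi> (x + n0) = \<gamma> n0 * \<phi> x" for x
      unfolding \<phi>_def quasi[OF n0] c_def using neq by (simp add: divide_simps) (simp add: algebra_simps)
    have phi: "\<phi> (x + n) = \<gamma> n * \<phi> x" if n: "n \<in> int_lattice" for x n
    proof -
      define s where "s = \<gamma> n * c + t n - c"
      have ns: "\<phi> (x + n) = \<gamma> n * \<phi> x + s" for x
        unfolding \<phi>_def quasi[OF n] s_def by (simp add: algebra_simps)
      \<comment> \<open>Translations by \<open>n\<close> and \<open>n0\<close> commute; comparing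
        the two orders shows that \<open>n\<close> has no additive part either.\<close>
      have "\<gamma> n0 * (\<gamma> n * \<phi> 0 + s) = \<gamma> n * (\<gamma> n0 * \<phi> 0) + s"
        using phi0[of "0 + n"] ns[of 0] ns[of "0 + n0"] phi0[of 0] by (simp add: add.commute)
      then have "(\<gamma> n0 - 1) * s = 0" by (simp add: algebra_simps)
      then have "s = 0" using neq by simp
      then show ?thesis by (simp add: ns)
    qed
    have "tint (jac \<phi>) = 0"
    proof (rule tint_jac_exact[OF sphi])
      show "periodic (\<lambda>x. Im (cnj (\<phi> x) * pd i \<phi> x))" for i
        unfolding periodic_def
      proof (intro allI ballI)
        fix x n assume n: "n \<in> int_lattice"
        have "cnj (\<phi> (x + n)) * pd i \<phi> (x + n) = (cnj (\<gamma> n) * \<gamma> n) * (cnj (\<phi> x) * pd i \<phi> x)"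
          by (simp add: phi[OF n] pdphi pd_shift[OF n])
        also have "cnj (\<gamma> n) * \<gamma> n = 1"
          using chi_norm[of n] by (metis complex_norm_square mult.commute of_real_1 one_power2)
        finally show "Im (cnj (\<phi> (x + n)) * pd i \<phi> (x + n)) = Im (cnj (\<phi> x) * pd i \<phi> x)" by simp
      qed
    qed
    moreover have "jac \<phi> = jac \<psi>" by (auto simp: jac_def pdphi)
    moreover have "tint (jac \<psi>) > 0" by (intro tint_pos jac_pos smooth_continuous_on smooth_intros psi)
    ultimately show False by simp
  qed
  show ?thesis
  proof (rule that[of \<psi> "\<lambda>x. P x / p x" t])
    show "smooth \<psi>" by (rule psi)
    have 1: "a x = p x * (1 + \<mu> x)" and 2: "b x = \<i> * (p x * (1 - \<mu> x))" for x
      using p0[of x] by (simp_all add: \<mu>_def distrib_left right_diff_distrib) (simp_all add: p_def q_def field_simps)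
    show "pd 1 \<psi> x = P x / p x * a x" "pd 2 \<psi> x = P x / p x * b x" for x
      unfolding psi A_def B_def 1 2 using p0[of x] by simp_all
    show "P x / p x \<noteq> 0" for x using P0 p0 by simp
    show "\<psi> (x + n) = \<psi> x + t n" if "n \<in> int_lattice" for x n
      using quasi[OF that] chi1[OF that] by simp
  qed
qed

text \<open>Dividing the flat coordinate by its first period normalises the period lattice to
  \<open>\<int> + \<tau>\<int>\<close>. The mean Jacobian equals the signed area spanned by the
  periods, which makes the first period nonzero and puts \<tau> in the upper half plane.\<close>

theorem torus_uniformization:
  fixes a b :: "real^2 \<Rightarrow> complex"
  assumes a: "torus_smooth a" and b: "torus_smooth b" and pos: "\<And>x. Im (cnj (a x) * b x) > 0"
  obtains \<tau> \<psi> r where "\<tau> \<in> upper_half_plane" "torus_diffeo \<tau> \<psi>"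
    "\<And>x. pd 1 \<psi> x = r x * a x" "\<And>x. pd 2 \<psi> x = r x * b x" "\<And>x. r x \<noteq> 0"
proof -
  obtain f r t where f: "smooth f" "\<And>x. pd 1 f x = r x * a x" "\<And>x. pd 2 f x = r x * b x"
    "\<And>x. r x \<noteq> 0" "\<And>x n. n \<in> int_lattice \<Longrightarrow> f (x + n) = f x + t n"
    using torus_flat_coordinate[OF a b pos] by metis
  have jac: "jac f x = (cmod (r x))\<^sup>2 * Im (cnj (a x) * b x)" for x
  proof -
    have "jac f x = Im ((cnj (r x) * r x) * (cnj (a x) * b x))" by (simp add: jac_def f mult_ac)
    also have "cnj (r x) * r x = of_real ((cmod (r x))\<^sup>2)" by (metis complex_norm_square mult.commute)
    finally show ?thesis by simp
  qed
  have J: "jac f x > 0" for x unfolding jac using f(4)[of x] pos[of x] by simp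
  define t1 t2 where "t1 = t (axis 1 1)" and "t2 = t (axis 2 1)"
  have ax: "f (x + axis i 1) = f x + t (axis i 1)" for x i by (rule f(5)[OF axis_in_int_lattice])
  have det: "Im (cnj t1 * t2) > 0"
  proof -
    have "tint (jac f) > 0" by (intro tint_pos J smooth_continuous_on smooth_intros f)
    then show ?thesis using tint_jac[OF f(1) ax] by (simp add: t1_def t2_def)
  qed
  then have t1: "t1 \<noteq> 0" by auto
  define \<tau> where "\<tau> = t2 / t1"
  have "Im \<tau> = Im (cnj t1 * t2) / (cmod t1)\<^sup>2"
    by (simp add: \<tau>_def Im_divide cmod_power2 algebra_simps)
  then have tau: "\<tau> \<in> upper_half_plane" using det t1 by (simp add: upper_half_plane_def)
  define \<psi> where "\<psi> x = (1 / t1) * f x" for x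
  have pd: "pd i \<psi> = (\<lambda>x. (1 / t1) * pd i f x)" for i
    unfolding \<psi>_def[abs_def] pd_mult[OF smooth_const f(1)] pd_const by simp
  have sm: "smooth \<psi>" unfolding \<psi>_def[abs_def] by (rule smooth_mult[OF smooth_const f(1)])
  have Jpsi: "jac \<psi> x > 0" for x
  proof -
    have "jac \<psi> x = Im ((cnj (1/t1) * (1/t1)) * (cnj (pd 1 f x) * pd 2 f x))"
      by (simp add: jac_def pd)
    also have "cnj (1/t1) * (1/t1) = of_real ((cmod (1/t1))\<^sup>2)" by (metis complex_norm_square mult.commute)
    finally have "jac \<psi> x = (cmod (1/t1))\<^sup>2 * jac f x" by (simp add: jac_def)
    then show ?thesis using J[of x] t1 by simp
  qed
  have quasi: "\<psi> (x + plane_pt (of_int k) (of_int l)) = \<psi> x + (of_int k + of_int l * \<tau>)" for x k l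
  proof -
    have "f (x + plane_pt (of_int k) (of_int l)) = f x + (of_int k * t1 + of_int l * t2)"
      using shift_lattice[of f "\<lambda>i. t (axis i 1)" x k l] ax by (simp add: t1_def t2_def scaleR_conv_of_real)
    then show ?thesis using t1 by (simp add: \<psi>_def \<tau>_def field_simps)
  qed
  have bij: "bij \<psi>"
  proof (rule torus_map_bij[OF sm])
    show "jac \<psi> x \<noteq> 0" for x using Jpsi[of x] by simp
    show "\<psi> (x + n) = \<psi> x + (\<psi> n - \<psi> 0)" if n: "n \<in> int_lattice" for x n
      using int_lattice_cases[OF n] quasi[of x] quasi[of 0] by (metis add_0 add_diff_cancel_left')
  qed
  have "torus_diffeo \<tau> \<psi>"
    unfolding torus_diffeo_def
  proof (intro conjI allI iffI bij sm smooth_inv[OF sm _ bij])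
    show "jac \<psi> x \<noteq> 0" for x using Jpsi[of x] by simp
    show "Im (cnj (pd 1 \<psi> x) * pd 2 \<psi> x) > 0" for x using Jpsi[of x] by (simp add: jac_def)
    fix x y
    show "x - y \<in> int_lattice" if h: "\<psi> x - \<psi> y \<in> torus_lattice \<tau>"
    proof -
      obtain k l :: int where "\<psi> x - \<psi> y = of_int k + of_int l * \<tau>" using h unfolding torus_lattice_def by blast
      then have "\<psi> x = \<psi> (y + plane_pt (of_int k) (of_int l))" by (simp add: quasi algebra_simps)
      then have "x = y + plane_pt (of_int k) (of_int l)" using bij by (simp add: bij_def inj_eq)
      then show ?thesis by (simp add: plane_pt_in_int_lattice)
    qed
    show "\<psi> x - \<psi> y \<in> torus_lattice \<tau>" if h: "x - y \<in> int_lattice"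
    proof -
      obtain k l where "x - y = plane_pt (of_int k) (of_int l)" using int_lattice_cases[OF h] by blast
      then have "x = y + plane_pt (of_int k) (of_int l)" by (simp add: algebra_simps)
      then show ?thesis by (auto simp: quasi torus_lattice_def)
    qed
  qed
  moreover have "pd 1 \<psi> x = (r x / t1) * a x" "pd 2 \<psi> x = (r x / t1) * b x" for x
    by (simp_all add: pd f)
  moreover have "r x / t1 \<noteq> 0" for x using f(4) t1 by simp
  ultimately show ?thesis by (intro that[of \<tau> \<psi> "\<lambda>x. r x / t1"] tau)
qed

section \<open>The conformally invariant Dirichlet form\<close>

text \<open>The Dirichlet density, area factor included, of a map with partial derivatives
  \<open>u\<close>, \<open>v\<close>, in the conformal structure whose flat coordinate has partial
  derivatives \<open>p\<close>, \<open>q\<close>.\<close>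

definition conf_energy :: "complex \<Rightarrow> complex \<Rightarrow> 'b::real_inner \<Rightarrow> 'b \<Rightarrow> real" where
  "conf_energy p q u v =
     ((cmod q)\<^sup>2 * (u \<bullet> u) - 2 * Re (cnj p * q) * (u \<bullet> v) + (cmod p)\<^sup>2 * (v \<bullet> v)) / Im (cnj p * q)"

text \<open>\<open>dual1\<close> and \<open>dual2\<close> are the derivatives of that map with
  respect to the real and the imaginary part of the flat coordinate.\<close>

definition dual1 :: "complex \<Rightarrow> complex \<Rightarrow> 'b::real_vector \<Rightarrow> 'b \<Rightarrow> 'b" where
  "dual1 p q u v = (1 / Im (cnj p * q)) *\<^sub>R (Im q *\<^sub>R u - Im p *\<^sub>R v)"

definition dual2 :: "complex \<Rightarrow> complex \<Rightarrow> 'b::real_vector \<Rightarrow> 'b \<Rightarrow> 'b" where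
  "dual2 p q u v = (1 / Im (cnj p * q)) *\<^sub>R (Re p *\<^sub>R v - Re q *\<^sub>R u)"

lemma conf_energy_dual:
  assumes "Im (cnj p * q) > 0"
  shows "conf_energy p q u v = Im (cnj p * q) * ((norm (dual1 p q u v))\<^sup>2 + (norm (dual2 p q u v))\<^sup>2)"
proof -
  obtain a b where p: "p = Complex a b" by (cases p)
  obtain c d where q: "q = Complex c d" by (cases q)
  define J where "J = Im (cnj p * q)"
  have J: "J > 0" "J = a * d - b * c" using assms by (simp_all add: J_def p q)
  have n1: "(norm (dual1 p q u v))\<^sup>2 = (d\<^sup>2 * (u \<bullet> u) - 2 * b * d * (u \<bullet> v) + b\<^sup>2 * (v \<bullet> v)) / J\<^sup>2"
    unfolding power2_norm_eq_inner dual1_def J_def[symmetric]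
    by (simp add: p q inner_diff_left inner_diff_right inner_commute[of v u] power2_eq_square algebra_simps add_divide_distrib diff_divide_distrib)
  have n2: "(norm (dual2 p q u v))\<^sup>2 = (c\<^sup>2 * (u \<bullet> u) - 2 * a * c * (u \<bullet> v) + a\<^sup>2 * (v \<bullet> v)) / J\<^sup>2"
    unfolding power2_norm_eq_inner dual2_def J_def[symmetric]
    by (simp add: p q inner_diff_left inner_diff_right inner_commute[of v u] power2_eq_square algebra_simps add_divide_distrib diff_divide_distrib)
  have fr: "J * (A / J\<^sup>2 + B / J\<^sup>2) = (A + B) / J" for A B
    using J(1) by (simp add: field_simps power2_eq_square)
  show ?thesis
    unfolding conf_energy_def J_def[symmetric] n1 n2 fr
    unfolding p q cmod_power2 by (simp add: algebra_simps)
qed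

lemma conf_energy_ge:
  assumes "Im (cnj p * q) > 0"
  shows "Im (cnj p * q) * (norm (dual1 p q u v))\<^sup>2 \<le> conf_energy p q u v"
  unfolding conf_energy_dual[OF assms] using assms by (intro mult_left_mono) auto

lemma conf_energy_inner:
  assumes "Im (cnj p * q) > 0" and w: "norm w = 1"
  shows "conf_energy p q (u \<bullet> w) (v \<bullet> w) \<le> conf_energy p q u v"
proof -
  have "dual1 p q (u \<bullet> w) (v \<bullet> w) = dual1 p q u v \<bullet> w" "dual2 p q (u \<bullet> w) (v \<bullet> w) = dual2 p q u v \<bullet> w"
    by (simp_all add: dual1_def dual2_def inner_diff_left)
  moreover have "(norm (z \<bullet> w))\<^sup>2 \<le> (norm z)\<^sup>2" for z
    using Cauchy_Schwarz_ineq2[of z w] w by (intro power_mono) auto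
  ultimately show ?thesis unfolding conf_energy_dual[OF assms(1)]
    using assms(1) by (intro mult_left_mono add_mono) auto
qed

text \<open>The hypothesis says that \<open>d\<lambda> + i (d\<beta> + \<omega>)\<close> is of type \<open>(1,0)\<close>, i.e. \<open>d\<beta> + \<omega>\<close> is
  the Hodge dual of \<open>d\<lambda>\<close> up to sign.\<close>

lemma conf_energy_rotation:
  fixes l1 l2 b1 b2 w1 w2 :: real
  assumes J: "Im (cnj p * q) > 0"
    and h: "Complex l1 (b1 + w1) * q = Complex l2 (b2 + w2) * p"
  shows "conf_energy p q b1 b2 \<le> conf_energy p q w1 w2 + 2 * (l1 * b2 - l2 * b1)"
proof -
  let ?J = "Im (cnj p * q)"
  have E: "conf_energy p q x y = (cmod (x *\<^sub>R q - y *\<^sub>R p))\<^sup>2 / ?J" for x y :: real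
  proof -
    obtain a b where p: "p = Complex a b" by (cases p)
    obtain c d where q: "q = Complex c d" by (cases q)
    show ?thesis unfolding conf_energy_def p q cmod_power2
      by (simp add: power2_eq_square algebra_simps)
  qed
  define U where "U = l1 *\<^sub>R q - l2 *\<^sub>R p"
  define V where "V = b1 *\<^sub>R q - b2 *\<^sub>R p"
  define W where "W = w1 *\<^sub>R q - w2 *\<^sub>R p"
  \<comment> \<open>On real arguments \<open>conf_energy\<close> is a squared modulus by
    \<open>E\<close>. Expanding that of \<open>W = \<i> * U - V\<close> leaves a cross term which is
    the wedge product of the forms \<open>l\<close> and \<open>b\<close>, and dropping the square of
    \<open>U\<close> gives the inequality.\<close>
  have "U + \<i> * (V + W) = 0"
    using h unfolding U_def V_def W_def by (simp add: complex_eq_iff algebra_simps)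
  then have W: "W = \<i> * U - V" by (simp add: algebra_simps add_eq_0_iff) (simp add: complex_eq_iff)
  have n: "(cmod W)\<^sup>2 = (cmod U)\<^sup>2 + (cmod V)\<^sup>2 - 2 * Im (cnj U * V)"
  proof -
    obtain u1 u2 where u: "U = Complex u1 u2" by (cases U)
    obtain v1 v2 where v: "V = Complex v1 v2" by (cases V)
    show ?thesis unfolding W u v cmod_power2 by (simp add: power2_eq_square algebra_simps)
  qed
  have i: "Im (cnj U * V) = (l1 * b2 - l2 * b1) * ?J"
    by (simp add: U_def V_def algebra_simps)
  have "(cmod V)\<^sup>2 \<le> (cmod W)\<^sup>2 + 2 * ((l1 * b2 - l2 * b1) * ?J)"
    using n zero_le_power2[of "cmod U"] unfolding i by linarith
  then have "(cmod V)\<^sup>2 / ?J \<le> ((cmod W)\<^sup>2 + 2 * ((l1 * b2 - l2 * b1) * ?J)) / ?J"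
    using J by (intro divide_right_mono) auto
  also have "\<dots> = (cmod W)\<^sup>2 / ?J + 2 * (l1 * b2 - l2 * b1)"
    using J by (simp add: add_divide_distrib)
  finally show ?thesis unfolding E V_def W_def .
qed

section \<open>The frame energy density in a conformal coordinate\<close>

lemma matrix_inv_eqI:
  fixes A B :: "real^'n^'n"
  assumes "A ** B = mat 1" "B ** A = mat 1"
  shows "matrix_inv A = B"
proof -
  have "A ** matrix_inv A = mat 1 \<and> matrix_inv A ** A = mat 1"
    unfolding matrix_inv_def by (rule someI[of _ B]) (use assms in simp)
  then show ?thesis using assms by (metis matrix_mul_assoc matrix_mul_lid matrix_mul_rid)
qed

lemma matrix_inv_2:
  fixes g :: "real^2^2"
  assumes "det g \<noteq> 0"
  shows "matrix_inv g $ 1 $ 1 = g$2$2 / det g" "matrix_inv g $ 1 $ 2 = - g$1$2 / det g"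
    "matrix_inv g $ 2 $ 1 = - g$2$1 / det g" "matrix_inv g $ 2 $ 2 = g$1$1 / det g"
proof -
  \<comment> \<open>In the index type \<open>2\<close>, \<open>3 - i\<close> is the index other than
    \<open>i\<close>, so this is the adjugate matrix over the determinant.\<close>
  define B :: "real^2^2" where "B = (\<chi> i j. (if i = j then g$(3-i)$(3-j) else - g$i$j) / det g)"
  have [simp]: "(3::2) - 1 = 2" "(3::2) - 2 = 1" by simp_all
  have B: "B$1$1 = g$2$2 / det g" "B$1$2 = - g$1$2 / det g" "B$2$1 = - g$2$1 / det g" "B$2$2 = g$1$1 / det g"
    by (simp_all add: B_def)
  define D where "D = det g"
  have D: "D \<noteq> 0" "g$1$1 * g$2$2 = D + g$1$2 * g$2$1" using assms by (simp_all add: D_def det_2)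
  have "matrix_inv g = B"
  proof (rule matrix_inv_eqI)
    show "g ** B = mat 1" "B ** g = mat 1"
      using D by (simp_all add: vec_eq_iff forall_2 matrix_matrix_mult_def sum_2 mat_def B D_def[symmetric])
        (simp_all add: field_simps)
  qed
  then show "matrix_inv g $ 1 $ 1 = g$2$2 / det g" "matrix_inv g $ 1 $ 2 = - g$1$2 / det g"
    "matrix_inv g $ 2 $ 1 = - g$2$1 / det g" "matrix_inv g $ 2 $ 2 = g$1$1 / det g" using B by simp_all
qed

text \<open>Conformal invariance in dimension two: the factor \<open>c\<close> of the inverse metric
  cancels against that of the area density.\<close>

lemma frame_energy_density:
  fixes g :: "real^2 \<Rightarrow> real^2^2"
  assumes J: "Im (cnj p * q) > 0" and c: "c > 0"
    and g: "c * g x $ 1 $ 1 = (cmod p)\<^sup>2" "c * g x $ 1 $ 2 = Re (cnj p * q)"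
      "c * g x $ 2 $ 1 = Re (cnj p * q)" "c * g x $ 2 $ 2 = (cmod q)\<^sup>2"
  shows "frame_norm_sq g e x * sqrt (det (g x)) =
    (\<Sum>k\<in>UNIV. conf_energy p q (pd 1 (e k) x) (pd 2 (e k) x))"
proof -
  define J where "J = Im (cnj p * q)"
  define R where "R = Re (cnj p * q)"
  have J: "J > 0" using assms(1) by (simp add: J_def)
  have gx: "g x $ 1 $ 1 = (cmod p)\<^sup>2 / c" "g x $ 1 $ 2 = R / c"
    "g x $ 2 $ 1 = R / c" "g x $ 2 $ 2 = (cmod q)\<^sup>2 / c"
    using g[folded R_def] c by (simp_all add: field_simps)
  have JJ: "J\<^sup>2 = (cmod p)\<^sup>2 * (cmod q)\<^sup>2 - R\<^sup>2"
  proof -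
    obtain a b where p: "p = Complex a b" by (cases p)
    obtain c d where q: "q = Complex c d" by (cases q)
    show ?thesis unfolding J_def R_def p q cmod_power2 by (simp add: power2_eq_square algebra_simps)
  qed
  have det: "det (g x) = (J / c)\<^sup>2"
    unfolding det_2 gx power_divide JJ using c by (simp add: power2_eq_square field_simps)
  then have sq: "sqrt (det (g x)) = J / c" and d0: "det (g x) \<noteq> 0" using J c by simp_all
  define k where "k = J / c"
  define I where "I i j = matrix_inv (g x) $ i $ j" for i j
  have inv: "I 1 1 * k = (cmod q)\<^sup>2 / J" "I 1 2 * k = - R / J" "I 2 1 * k = - R / J" "I 2 2 * k = (cmod p)\<^sup>2 / J"
    unfolding I_def k_def matrix_inv_2[OF d0] det gx using J c by (simp_all add: power2_eq_square)
  let ?u = "\<lambda>k. pd 1 (e k) x" and ?v = "\<lambda>k. pd 2 (e k) x"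
  have "frame_norm_sq g e x * sqrt (det (g x)) =
     (I 1 1 * k) * (\<Sum>k\<in>UNIV. ?u k \<bullet> ?u k) + (I 1 2 * k) * (\<Sum>k\<in>UNIV. ?u k \<bullet> ?v k)
     + (I 2 1 * k) * (\<Sum>k\<in>UNIV. ?v k \<bullet> ?u k) + (I 2 2 * k) * (\<Sum>k\<in>UNIV. ?v k \<bullet> ?v k)"
    unfolding sq k_def[symmetric] frame_norm_sq_def I_def[symmetric] by (simp add: sum_2 algebra_simps)
  also have "\<dots> = (\<Sum>k\<in>UNIV. conf_energy p q (?u k) (?v k))"
    unfolding inv conf_energy_def J_def[symmetric] R_def[symmetric]
    by (simp add: sum_2 inner_commute algebra_simps add_divide_distrib diff_divide_distrib)
  finally show ?thesis .
qed

section \<open>Coframes of immersed tori\<close>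

text \<open>Packing the two dual one-forms into one complex form turns rotating and scaling the
  coframe into multiplication by a complex function.\<close>

definition coframe :: "(real^2 \<Rightarrow> real^'m) \<Rightarrow> (2 \<Rightarrow> real^2 \<Rightarrow> real^'m) \<Rightarrow> 2 \<Rightarrow> real^2 \<Rightarrow> complex" where
  "coframe \<Phi> e j x = of_real (e 1 x \<bullet> pd j \<Phi> x) + \<i> * of_real (e 2 x \<bullet> pd j \<Phi> x)"

lemma coframe_sel: "Re (coframe \<Phi> e j x) = e 1 x \<bullet> pd j \<Phi> x" "Im (coframe \<Phi> e j x) = e 2 x \<bullet> pd j \<Phi> x"
  by (simp_all add: coframe_def)

lemma moving_frameD:
  assumes "moving_frame \<Phi> e"
  shows "torus_smooth (e k)" "e k x \<bullet> e l x = (if k = l then 1 else 0)"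
  using assms by (auto simp: moving_frame_def torus_smooth_def)

lemma torus_immersionD: "torus_immersion \<Phi> \<Longrightarrow> torus_smooth \<Phi>"
  by (simp add: torus_immersion_def torus_smooth_def)

lemma coframe_torus:
  assumes "torus_immersion \<Phi>" "moving_frame \<Phi> e"
  shows "torus_smooth (coframe \<Phi> e j)"
  unfolding coframe_def[abs_def]
  by (intro torus_intros moving_frameD(1)[OF assms(2)] torus_immersionD[OF assms(1)])

text \<open>The matrix \<open>v\<close> expresses the frame in coordinate vectors; inverting it
  expresses the coordinate vectors in the frame. The Jacobian of the coframe is the reciprocal of
  \<open>det v\<close>, which is where the orientation of the frame enters.\<close>

lemma frame_expansion:
  assumes \<Phi>: "torus_immersion \<Phi>" and e: "moving_frame \<Phi> e"
  shows "pd j \<Phi> x = Re (coframe \<Phi> e j x) *\<^sub>R e 1 x + Im (coframe \<Phi> e j x) *\<^sub>R e 2 x"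
    and "Im (cnj (coframe \<Phi> e 1 x) * coframe \<Phi> e 2 x) > 0"
proof -
  note sm = torus_smoothD(1)[OF torus_immersionD[OF \<Phi>]]
  let ?P = "pd 1 \<Phi> x" and ?Q = "pd 2 \<Phi> x"
  obtain v :: "real^2^2" where v: "\<And>k. e k x = frechet_derivative \<Phi> (at x) (v $ k)" "det v > 0"
    using e unfolding moving_frame_def by metis
  define D where "D = det v"
  have D: "D > 0" "D = v$1$1 * v$2$2 - v$1$2 * v$2$1" using v(2) by (simp_all add: D_def det_2)
  have ek: "e k x = v$k$1 *\<^sub>R ?P + v$k$2 *\<^sub>R ?Q" for k
    unfolding v(1) by (rule frechet_eq_partials[OF smooth_differentiable[OF sm]])
  have P: "D *\<^sub>R ?P = v$2$2 *\<^sub>R e 1 x - v$1$2 *\<^sub>R e 2 x"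
    unfolding ek D(2) by (simp add: algebra_simps)
  have Q: "D *\<^sub>R ?Q = v$1$1 *\<^sub>R e 2 x - v$2$1 *\<^sub>R e 1 x"
    unfolding ek D(2) by (simp add: algebra_simps)
  have on: "e 1 x \<bullet> e 1 x = 1" "e 2 x \<bullet> e 2 x = 1" "e 1 x \<bullet> e 2 x = 0" "e 2 x \<bullet> e 1 x = 0"
    using moving_frameD(2)[OF e] by simp_all
  have "D * (e 1 x \<bullet> ?P) = v$2$2" "D * (e 2 x \<bullet> ?P) = - v$1$2" "D * (e 1 x \<bullet> ?Q) = - v$2$1" "D * (e 2 x \<bullet> ?Q) = v$1$1"
    unfolding inner_scaleR_right[symmetric] P Q by (simp_all add: inner_diff_right on)
  then have c: "e 1 x \<bullet> ?P = v$2$2 / D" "e 2 x \<bullet> ?P = - v$1$2 / D" "e 1 x \<bullet> ?Q = - v$2$1 / D" "e 2 x \<bullet> ?Q = v$1$1 / D"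
    using D(1) by (simp_all add: field_simps)
  have "?P = (1 / D) *\<^sub>R (D *\<^sub>R ?P)" "?Q = (1 / D) *\<^sub>R (D *\<^sub>R ?Q)" using D(1) by simp_all
  then have "?P = Re (coframe \<Phi> e 1 x) *\<^sub>R e 1 x + Im (coframe \<Phi> e 1 x) *\<^sub>R e 2 x"
    "?Q = Re (coframe \<Phi> e 2 x) *\<^sub>R e 1 x + Im (coframe \<Phi> e 2 x) *\<^sub>R e 2 x"
    unfolding P Q coframe_sel c by (simp_all add: algebra_simps)
  then show "pd j \<Phi> x = Re (coframe \<Phi> e j x) *\<^sub>R e 1 x + Im (coframe \<Phi> e j x) *\<^sub>R e 2 x"
    using exhaust_2[of j] by metis
  have "Im (cnj (coframe \<Phi> e 1 x) * coframe \<Phi> e 2 x) = (e 1 x \<bullet> ?P) * (e 2 x \<bullet> ?Q) - (e 2 x \<bullet> ?P) * (e 1 x \<bullet> ?Q)"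
    by (simp add: coframe_sel)
  also have "\<dots> = (v$1$1 * v$2$2 - v$1$2 * v$2$1) / (D * D)"
    unfolding c using D(1) by (simp add: field_simps)
  also have "\<dots> = 1 / D" unfolding D(2)[symmetric] using D(1) by simp
  finally show "Im (cnj (coframe \<Phi> e 1 x) * coframe \<Phi> e 2 x) > 0" using D(1) by simp
qed

lemma pullback_coframe:
  assumes "torus_immersion \<Phi>" "moving_frame \<Phi> e"
  shows "pullback_metric \<Phi> x $ i $ j = Re (cnj (coframe \<Phi> e i x) * coframe \<Phi> e j x)"
proof -
  have on: "e 1 x \<bullet> e 1 x = 1" "e 2 x \<bullet> e 2 x = 1" "e 1 x \<bullet> e 2 x = 0" "e 2 x \<bullet> e 1 x = 0"
    using moving_frameD(2)[OF assms(2)] by simp_all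
  show ?thesis
    unfolding pullback_metric_def
    by (simp add: frame_expansion(1)[OF assms, of i x] frame_expansion(1)[OF assms, of j x]
        inner_add_left inner_add_right on del: coframe_sel)
qed

lemma pullback_complex: "pullback_metric \<psi> x $ i $ j = Re (cnj (pd i \<psi> x) * pd j \<psi> x)"
  for \<psi> :: "real^2 \<Rightarrow> complex"
  by (simp add: pullback_metric_def inner_complex_def)

text \<open>The Gram matrix of a pair determines \<open>Im (cnj p * q)\<close> up to sign, and the
  orientation fixes the sign. Two positively oriented pairs with proportional Gram matrices
  therefore differ by one complex factor, the conjugate alternative being excluded.\<close>

lemma conformal_factor:
  assumes "Im (cnj a * b) > 0" "Im (cnj p * q) > 0" "c > 0"
    and "(cmod p)\<^sup>2 = c * (cmod a)\<^sup>2" "Re (cnj p * q) = c * Re (cnj a * b)" "(cmod q)\<^sup>2 = c * (cmod b)\<^sup>2"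
  shows "b / q = a / p" "a = (a / p) * p" "b = (a / p) * q"
proof -
  have p0: "p \<noteq> 0" "q \<noteq> 0" using assms(2) by auto
  have J: "(Im (cnj u * v))\<^sup>2 = (cmod u)\<^sup>2 * (cmod v)\<^sup>2 - (Re (cnj u * v))\<^sup>2" for u v
  proof -
    obtain a b where u: "u = Complex a b" by (cases u)
    obtain c d where v: "v = Complex c d" by (cases v)
    show ?thesis unfolding u v cmod_power2 by (simp add: power2_eq_square algebra_simps)
  qed
  have "(Im (cnj p * q))\<^sup>2 = (c * Im (cnj a * b))\<^sup>2"
    unfolding J power_mult_distrib assms(4-6) by (simp add: J power2_eq_square algebra_simps)
  then have "Im (cnj p * q) = c * Im (cnj a * b)"
    using assms(1-3) by (simp add: power2_eq_iff_nonneg)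
  then have eq: "cnj p * q = of_real c * (cnj a * b)"
    using assms(5) by (simp add: complex_eq_iff)
  have pp: "cnj p * p = of_real c * (cnj a * a)"
    using assms(4) by (metis complex_norm_square mult.commute of_real_mult)
  have "cnj p * (q * a) = of_real c * (cnj a * b) * a" unfolding eq[symmetric] by simp
  also have "\<dots> = (of_real c * (cnj a * a)) * b" by simp
  also have "\<dots> = cnj p * (p * b)" unfolding pp[symmetric] by simp
  finally have "q * a = p * b" using p0 by simp
  then show "b / q = a / p" "a = (a / p) * p" "b = (a / p) * q" using p0 by (simp_all add: field_simps)
qed

section \<open>Flat coordinates of a torus\<close>

lemma countable_torus_lattice: "countable (torus_lattice \<tau>)"
proof -
  have "torus_lattice \<tau> = (\<lambda>(a, b). of_int a + of_int b * \<tau>) ` (UNIV :: (int \<times> int) set)"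
    by (auto simp: torus_lattice_def)
  then show ?thesis by simp
qed

locale torus_chart =
  fixes \<tau> :: complex and \<psi> :: "real^2 \<Rightarrow> complex"
  assumes diffeo: "torus_diffeo \<tau> \<psi>" and tau: "\<tau> \<in> upper_half_plane"
begin

lemma chart_smooth: "smooth \<psi>" and chart_bij: "bij \<psi>" and chart_inv_smooth: "smooth (inv \<psi>)"
  and chart_lattice: "\<psi> x - \<psi> y \<in> torus_lattice \<tau> \<longleftrightarrow> x - y \<in> int_lattice"
  and jac_pos: "jac \<psi> x > 0"
  using diffeo by (auto simp: torus_diffeo_def jac_def)

lemma jac_nz: "jac \<psi> x \<noteq> 0"
  using jac_pos[of x] by simp

lemma inv_chart [simp]: "inv \<psi> (\<psi> x) = x" "\<psi> (inv \<psi> w) = w"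
  using chart_bij by (simp_all add: bij_is_inj bij_is_surj surj_f_inv_f)

text \<open>The difference \<open>\<psi> (x + n) - \<psi> x\<close> is continuous in
  \<open>x\<close> with values in a countable set, so it is constant.\<close>

lemma chart_translate:
  assumes n: "n \<in> int_lattice"
  shows "\<psi> (x + n) = \<psi> x + (\<psi> n - \<psi> 0)" "\<psi> n - \<psi> 0 \<in> torus_lattice \<tau>"
proof -
  let ?f = "\<lambda>x. \<psi> (x + n) - \<psi> x"
  have f: "?f x \<in> torus_lattice \<tau>" for x using n by (simp add: chart_lattice)
  have "continuous_on UNIV ?f"
    by (intro smooth_continuous_on smooth_intros smooth_shift chart_smooth)
  then have "connected (range ?f)" by (intro connected_continuous_image) auto
  moreover have "countable (range ?f)"
    using f by (intro countable_subset[OF _ countable_torus_lattice[of \<tau>]]) auto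
  ultimately have "?f x = ?f 0" for x
    using connected_uncountable[of "range ?f" "?f x" "?f 0"] by blast
  from this[of x] show "\<psi> (x + n) = \<psi> x + (\<psi> n - \<psi> 0)" by (simp add: algebra_simps)
  show "\<psi> n - \<psi> 0 \<in> torus_lattice \<tau>" using f[of 0] by simp
qed

lemma lattice_translate:
  assumes "l \<in> torus_lattice \<tau>"
  obtains n where "n \<in> int_lattice" "\<psi> n - \<psi> 0 = l"
proof -
  let ?n = "inv \<psi> (\<psi> 0 + l)"
  have "\<psi> ?n - \<psi> 0 = l" by simp
  moreover from this have "?n \<in> int_lattice" using chart_lattice[of ?n 0] assms by simp
  ultimately show ?thesis using that by blast
qed

lemma chart_inv_translate:
  assumes n: "n \<in> int_lattice"
  shows "inv \<psi> (w + (\<psi> n - \<psi> 0)) = inv \<psi> w + n"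
  using chart_translate(1)[OF n, of "inv \<psi> w"] by (metis inv_chart)

text \<open>The area is an integer determinant times \<open>Im \<tau>\<close>; being positive, that
  determinant is at least 1.\<close>

lemma Im_le_area: "Im \<tau> \<le> tint (jac \<psi>)"
proof -
  let ?t = "\<lambda>i. \<psi> (axis i 1) - \<psi> 0"
  obtain a b :: int where 1: "?t 1 = of_int a + of_int b * \<tau>"
    using chart_translate(2)[OF axis_in_int_lattice[of 1]] unfolding torus_lattice_def by blast
  obtain c d :: int where 2: "?t 2 = of_int c + of_int d * \<tau>"
    using chart_translate(2)[OF axis_in_int_lattice[of 2]] unfolding torus_lattice_def by blast
  have "tint (jac \<psi>) = Im (cnj (?t 1) * ?t 2)"
    by (rule tint_jac[OF chart_smooth]) (rule chart_translate(1)[OF axis_in_int_lattice])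
  also have "\<dots> = of_int (a * d - b * c) * Im \<tau>"
    unfolding 1 2 by (simp add: algebra_simps)
  finally have eq: "tint (jac \<psi>) = of_int (a * d - b * c) * Im \<tau>" .
  have "tint (jac \<psi>) > 0" by (intro tint_pos jac_pos smooth_continuous_on smooth_intros chart_smooth)
  moreover have "Im \<tau> > 0" using tau by (simp add: upper_half_plane_def)
  ultimately have "a * d - b * c > 0" unfolding eq using zero_less_mult_pos2 of_int_0_less_iff by metis
  then have "1 \<le> (of_int (a * d - b * c) :: real)" by linarith
  then show ?thesis unfolding eq using \<open>Im \<tau> > 0\<close> mult_right_mono[of 1 "of_int (a * d - b * c)" "Im \<tau>"] by simp
qed

lemma torus_pd_chart: "torus_smooth (pd i \<psi>)"
proof -
  have "pd i \<psi> (x + n) = pd i \<psi> x" if n: "n \<in> int_lattice" for x n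
  proof -
    have "pd i \<psi> (x + n) = pd i (\<lambda>x. \<psi> (x + n)) x"
      by (rule pd_shift[OF chart_smooth, symmetric])
    also have "(\<lambda>x. \<psi> (x + n)) = (\<lambda>x. \<psi> x + (\<psi> n - \<psi> 0))" by (rule ext) (rule chart_translate(1)[OF n])
    finally show ?thesis by (simp add: pd_add[OF chart_smooth smooth_const] pd_const)
  qed
  then show ?thesis unfolding torus_smooth_def periodic_def by (auto intro: smooth_intros chart_smooth)
qed

lemma torus_jac: "torus_smooth (jac \<psi>)"
  unfolding jac_def[abs_def] by (intro torus_intros torus_pd_chart)

text \<open>Horizontal translation in the flat coordinate. As 1 is a lattice period, every orbit
  closes up on the torus at time 1.\<close>

definition flow :: "real \<Rightarrow> real^2 \<Rightarrow> real^2" where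
  "flow s x = inv \<psi> (\<psi> x + of_real s)"

lemma continuous_flow: "continuous_on S f \<Longrightarrow> continuous_on S g \<Longrightarrow> continuous_on S (\<lambda>x. flow (f x) (g x))"
  unfolding flow_def
  by (intro smooth_continuous_on_compose[OF chart_inv_smooth] continuous_intros smooth_continuous_on_compose[OF chart_smooth])

lemma flow_deriv:
  fixes F :: "real^2 \<Rightarrow> 'b::real_normed_vector"
  assumes F: "smooth F"
  shows "((\<lambda>s. F (flow s x)) has_vector_derivative
    dual1 (pd 1 \<psi> (flow s x)) (pd 2 \<psi> (flow s x)) (pd 1 F (flow s x)) (pd 2 F (flow s x))) (at s within S)"
proof -
  let ?y = "flow s x"
  have "((\<lambda>s. \<psi> x + of_real s) has_derivative of_real) (at s within S)"
    by (auto intro!: derivative_eq_intros)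
  from has_derivative_compose[OF this inv_has_derivative[OF chart_smooth jac_nz chart_bij]]
  have "((\<lambda>s. flow s x) has_derivative (\<lambda>t. pd_inv \<psi> ?y (of_real t))) (at s within S)"
    by (simp add: flow_def[abs_def])
  from has_derivative_compose[OF this smooth_has_derivative2[OF F]]
  show ?thesis
    by (simp add: has_vector_derivative_def pd_inv_def dual1_def jac_def algebra_simps)
qed

lemma flow_1: obtains n where "n \<in> int_lattice" "flow 1 x = x + n"
proof -
  have "1 = of_int 1 + of_int 0 * \<tau>" by simp
  then have "1 \<in> torus_lattice \<tau>" unfolding torus_lattice_def by blast
  then obtain n where n: "n \<in> int_lattice" "\<psi> n - \<psi> 0 = 1" by (rule lattice_translate)
  have "flow 1 x = x + n" using chart_inv_translate[OF n(1), of "\<psi> x"] n(2) by (simp add: flow_def)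
  then show ?thesis using that n by blast
qed

text \<open>Translations preserve the flat area form. The derivative of the left side in
  \<open>s\<close> is the integral of an exact form with periodic primitive, hence zero.\<close>

lemma tint_flow:
  fixes H :: "real^2 \<Rightarrow> real"
  assumes H: "torus_smooth H"
  shows "tint (\<lambda>x. H (flow s x) * jac \<psi> x) = tint (\<lambda>x. H x * jac \<psi> x)"
proof -
  define h where "h w = H (inv \<psi> w)" for w
  have h: "smooth h" unfolding h_def[abs_def]
    by (rule smooth_compose[OF torus_smoothD(1)[OF H] chart_inv_smooth])
  define K where "K s x = h (\<psi> x + of_real s)" for s x
  have HK: "H (flow s x) = K s x" for s x by (simp add: K_def h_def flow_def)
  have K: "torus_smooth (K s)" for s
    unfolding torus_smooth_def periodic_def
  proof (intro conjI allI ballI)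
    show "smooth (K s)" unfolding K_def[abs_def]
      by (rule smooth_compose[OF h]) (intro smooth_intros chart_smooth)
    fix x n assume n: "n \<in> int_lattice"
    have "K s (x + n) = H (inv \<psi> ((\<psi> x + of_real s) + (\<psi> n - \<psi> 0)))"
      unfolding K_def h_def chart_translate(1)[OF n] by (simp add: algebra_simps)
    then show "K s (x + n) = K s x"
      by (simp only: chart_inv_translate[OF n] periodicD[OF torus_smoothD(2)[OF H] n]) (simp add: K_def h_def)
  qed
  define h1 where "h1 w = frechet_derivative h (at w) 1" for w
  have h1: "smooth h1" unfolding h1_def[abs_def] by (rule smooth_frechet[OF h])
  have lin: "frechet_derivative h (at w) z = Re z * h1 w + Im z * frechet_derivative h (at w) \<i>" for w z
  proof -
    have l: "linear (frechet_derivative h (at w))" by (rule linear_frechet_derivative[OF smooth_differentiable[OF h]])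
    have "z = Re z *\<^sub>R 1 + Im z *\<^sub>R \<i>" by (simp add: complex_eq_iff)
    then have "frechet_derivative h (at w) z = frechet_derivative h (at w) (Re z *\<^sub>R 1 + Im z *\<^sub>R \<i>)" by simp
    then show ?thesis by (simp only: linear_add[OF l] linear_cmul[OF l] h1_def real_scaleR_def)
  qed
  have pdK: "pd i (K s) x = frechet_derivative h (at (\<psi> x + of_real s)) (pd i \<psi> x)" for i s x
  proof -
    have "((\<lambda>x. \<psi> x + of_real s) has_derivative frechet_derivative \<psi> (at x)) (at x)"
      using has_derivative_add[OF smooth_has_derivative[OF chart_smooth] has_derivative_const] by simp
    from partial_derivI[OF has_derivative_compose[OF this smooth_has_derivative[OF h]]]
    show ?thesis by (simp add: K_def[abs_def] partial_deriv_def)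
  qed
  let ?p = "\<lambda>x. Im (pd 1 \<psi> x)" and ?q = "\<lambda>x. Im (pd 2 \<psi> x)"
  have pq: "torus_smooth ?p" "torus_smooth ?q" by (intro torus_intros torus_pd_chart)+
  have pdpq: "pd 1 ?q = pd 2 ?p"
    using pd_swap[OF chart_smooth, of 1 2]
    by (simp add: pd_Im[OF smooth_partial[OF chart_smooth]])
  have zero: "tint (\<lambda>x. h1 (\<psi> x + of_real s) * jac \<psi> x) = 0" for s
  proof -
    \<comment> \<open>The left side is the pullback of \<open>h1 dX \<and> dY\<close>, where X and Y
      are the real and imaginary parts of the flat coordinate; the right side is the exterior
      derivative of \<open>K s\<close> times the pullback of \<open>dY\<close>.\<close>
    have "h1 (\<psi> x + of_real s) * jac \<psi> x = pd 1 (\<lambda>x. K s x * ?q x) x - pd 2 (\<lambda>x. K s x * ?p x) x" for x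
      unfolding pd_mult[OF torus_smoothD(1)[OF K] torus_smoothD(1)[OF pq(1)]]
        pd_mult[OF torus_smoothD(1)[OF K] torus_smoothD(1)[OF pq(2)]] pdpq pdK
      by (subst (1 2) lin) (simp add: jac_def algebra_simps)
    then have "tint (\<lambda>x. h1 (\<psi> x + of_real s) * jac \<psi> x)
      = tint (pd 1 (\<lambda>x. K s x * ?q x)) - tint (pd 2 (\<lambda>x. K s x * ?p x))"
      by (simp only:) (intro tint_diff torus_continuous torus_intros K pq)
    then show ?thesis by (simp add: tint_partial torus_mult K pq)
  qed
  have "((\<lambda>s. integral (cbox 0 1) (\<lambda>x. K s x * jac \<psi> x)) has_vector_derivative
      integral (cbox 0 1) (\<lambda>x. h1 (\<psi> x + of_real s) * jac \<psi> x)) (at s within UNIV)" for s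
  proof (rule leibniz_rule_vector_derivative)
    show "((\<lambda>s. K s x * jac \<psi> x) has_vector_derivative h1 (\<psi> x + of_real s) * jac \<psi> x) (at s within UNIV)" for s x
    proof -
      have "((\<lambda>s. \<psi> x + of_real s) has_derivative of_real) (at s within UNIV)"
        by (auto intro!: derivative_eq_intros)
      from has_derivative_compose[OF this smooth_has_derivative[OF h]]
      have "((\<lambda>s. K s x) has_vector_derivative h1 (\<psi> x + of_real s)) (at s within UNIV)"
        unfolding has_vector_derivative_def K_def by (subst (asm) lin) simp
      then show ?thesis
        by (intro has_vector_derivative_mult_left)
    qed
    show "(\<lambda>x. K s x * jac \<psi> x) integrable_on cbox 0 1" for s
      by (intro tint_integrable torus_continuous torus_intros K torus_jac)
    show "continuous_on (UNIV \<times> cbox 0 1) (\<lambda>(s, x). h1 (\<psi> x + of_real s) * jac \<psi> x)"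
      unfolding split_def
      by (intro continuous_intros smooth_continuous_on_compose[OF h1] smooth_continuous_on_compose[OF chart_smooth]
          smooth_continuous_on_compose[OF smooth_jac[OF chart_smooth]])
  qed auto
  note L = this
  have "((\<lambda>s. tint (\<lambda>x. K s x * jac \<psi> x)) has_vector_derivative 0) (at s within UNIV)" for s
    using L[of s] unfolding zero[unfolded tint_def] tint_def .
  then obtain c where "\<And>s. tint (\<lambda>x. K s x * jac \<psi> x) = c"
    using has_vector_derivative_zero_constant[of UNIV "\<lambda>s. tint (\<lambda>x. K s x * jac \<psi> x)"] by auto
  then have "tint (\<lambda>x. K s x * jac \<psi> x) = tint (\<lambda>x. K 0 x * jac \<psi> x)" by simp
  moreover have "K 0 x = H x" for x by (simp add: K_def h_def)
  ultimately show ?thesis by (simp add: HK)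
qed

end

section \<open>Unit tangents of closed curves\<close>

lemma integral_sq_le:
  fixes f :: "real \<Rightarrow> real"
  assumes f: "continuous_on {0..1} f"
  shows "(integral {0..1} f)\<^sup>2 \<le> integral {0..1} (\<lambda>s. (f s)\<^sup>2)"
proof -
  let ?c = "integral {0..1} f"
  have i: "f integrable_on {0..1}" "(\<lambda>s. (f s)\<^sup>2) integrable_on {0..1}" "(\<lambda>s. 2 * ?c * f s) integrable_on {0..1}"
    by (intro integrable_continuous_interval continuous_intros f)+
  have "2 * ?c * ?c - ?c\<^sup>2 = integral {0..1} (\<lambda>s. 2 * ?c * f s - ?c\<^sup>2)"
    using i by (subst integral_diff) auto
  also have "\<dots> \<le> integral {0..1} (\<lambda>s. (f s)\<^sup>2)"
  proof (intro integral_le integrable_diff i)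
    show "(\<lambda>s::real. ?c\<^sup>2) integrable_on {0..1}" by (rule integrable_const_ivl)
    show "2 * ?c * f s - ?c\<^sup>2 \<le> (f s)\<^sup>2" for s
      using zero_le_power2[of "f s - ?c"] by (simp add: power2_diff algebra_simps)
  qed
  finally show ?thesis by (simp add: power2_eq_square)
qed

text \<open>The unit tangent of a closed curve leaves the half space around its initial value,
  so it travels a distance of at least \<open>\<surd>2\<close>.\<close>

lemma closed_curve_tangent:
  fixes \<gamma> T T' :: "real \<Rightarrow> 'b::euclidean_space"
  assumes \<gamma>: "\<And>s. (\<gamma> has_vector_derivative (r s *\<^sub>R T s)) (at s)" and r: "\<And>s. r s > 0" "continuous_on UNIV r"
    and T: "\<And>s. (T has_vector_derivative T' s) (at s)" "continuous_on UNIV T'" "\<And>s. norm (T s) = 1"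
    and closed: "\<gamma> 1 = \<gamma> 0"
  shows "2 \<le> integral {0..1} (\<lambda>s. (norm (T' s))\<^sup>2)"
proof -
  have cT: "continuous_on S T" for S
    using T(1) by (meson continuous_at_imp_continuous_on has_vector_derivative_continuous)
  have cT': "continuous_on S T'" and cr: "continuous_on S r" for S using T(2) r(2) continuous_on_subset by blast+
  \<comment> \<open>Otherwise \<open>\<gamma> s \<bullet> T 0\<close> would have positive derivative
    throughout, and the curve could not return to its starting point.\<close>
  have "\<exists>s\<in>{0..1}. T s \<bullet> T 0 \<le> 0"
  proof (rule ccontr)
    assume "\<not> (\<exists>s\<in>{0..1}. T s \<bullet> T 0 \<le> 0)"
    then have pos: "T s \<bullet> T 0 > 0" if "s \<in> {0..1}" for s using that by force
    let ?f = "\<lambda>s. r s * (T s \<bullet> T 0)"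
    have cf: "continuous_on {0..1} ?f" by (intro continuous_intros cT cr)
    have "((\<lambda>s. \<gamma> s \<bullet> T 0) has_vector_derivative ?f s) (at s within {0..1})" for s
      using bounded_linear.has_vector_derivative[OF bounded_linear_inner_left has_vector_derivative_at_within[OF \<gamma>[of s]], of "T 0"]
      by simp
    then have "(?f has_integral (\<gamma> 1 \<bullet> T 0 - \<gamma> 0 \<bullet> T 0)) {0..1}"
      by (intro fundamental_theorem_of_calculus) auto
    then have "(?f has_integral 0) (cbox 0 1)" using closed by (simp add: cbox_interval)
    moreover have "?f 0 \<noteq> 0" using pos[of 0] r(1)[of 0] by auto
    moreover have "0 \<le> ?f s" if "s \<in> cbox 0 1" for s using pos[of s] that r(1)[of s] by (simp add: cbox_interval less_imp_le)
    ultimately show False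
      using has_integral_0_cbox_imp_0[of 0 1 ?f 0] cf by (auto simp: cbox_interval)
  qed
  then obtain s where s: "s \<in> {0..1}" "T s \<bullet> T 0 \<le> 0" by blast
  let ?n = "\<lambda>s. norm (T' s)"
  have cn: "continuous_on S ?n" for S by (intro continuous_intros cT')
  have "2 \<le> (norm (T s - T 0))\<^sup>2"
  proof -
    have "(norm (T s - T 0))\<^sup>2 = (norm (T s))\<^sup>2 + (norm (T 0))\<^sup>2 - 2 * (T s \<bullet> T 0)"
      unfolding power2_norm_eq_inner by (simp add: inner_diff_left inner_diff_right inner_commute)
    then show ?thesis using s(2) by (simp add: T(3))
  qed
  also have "norm (T s - T 0) \<le> integral {0..1} ?n"
  proof -
    have "(T' has_integral T s - T 0) {0..s}"
      by (rule fundamental_theorem_of_calculus) (use s(1) in simp, rule has_vector_derivative_at_within[OF T(1)])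
    then have "T s - T 0 = integral {0..s} T'" by (simp add: integral_unique)
    also have "norm \<dots> \<le> integral {0..s} ?n"
      by (intro integral_norm_bound_integral integrable_continuous_interval cT' cn) auto
    also have "\<dots> \<le> integral {0..1} ?n"
      using s(1) by (intro integral_subset_le integrable_continuous_interval cn) auto
    finally show ?thesis .
  qed
  then have "(norm (T s - T 0))\<^sup>2 \<le> (integral {0..1} ?n)\<^sup>2" by (intro power_mono) auto
  also have "\<dots> \<le> integral {0..1} (\<lambda>s. (?n s)\<^sup>2)" by (rule integral_sq_le[OF cn])
  finally show ?thesis by simp
qed

section \<open>The frame energy bounds the height of the conformal class\<close>

lemma dual1_add: "dual1 p q (u + u') (v + v') = dual1 p q u v + dual1 p q u' v'"
  unfolding dual1_def by (simp add: algebra_simps)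

lemma dual1_scaleR: "dual1 p q (k *\<^sub>R u) (k *\<^sub>R v) = k *\<^sub>R dual1 p q u v"
  unfolding dual1_def by (simp add: algebra_simps)

lemma dual1_vec: "dual1 p q (a *\<^sub>R w) (b *\<^sub>R w) = dual1 p q a b *\<^sub>R w" for a b :: real
  unfolding dual1_def
  by (simp only: real_scaleR_def scaleR_scaleR scaleR_diff_left scaleR_diff_right right_diff_distrib)

locale conformal_torus = torus_chart \<tau> \<psi> for \<tau> \<psi> +
  fixes \<Phi> :: "real^2 \<Rightarrow> real^'m" and e :: "2 \<Rightarrow> real^2 \<Rightarrow> real^'m"
  assumes immersion: "torus_immersion \<Phi>" and frame: "moving_frame \<Phi> e"
    and conformal: "\<And>x. \<exists>c>0. pullback_metric \<psi> x = c *\<^sub>R pullback_metric \<Phi> x"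
begin

abbreviation p where "p \<equiv> pd 1 \<psi>"
abbreviation q where "q \<equiv> pd 2 \<psi>"

definition \<kappa> where "\<kappa> x = coframe \<Phi> e 1 x / p x"
definition log_scale where "log_scale x = (1/2) * ln (\<kappa> x \<bullet> \<kappa> x)"
definition N where "N x = \<kappa> x * exp (- of_real (log_scale x))"
text \<open>The differential of the argument of \<kappa>, as the imaginary part of the logarithmic
  derivative. No argument is chosen, since on the torus it may be multivalued.\<close>

definition \<beta> where "\<beta> i x = Im (pd i \<kappa> x / \<kappa> x)"
definition \<omega> where "\<omega> i x = pd i (e 1) x \<bullet> e 2 x"
text \<open>Rotating the frame by the phase \<open>N\<close> aligns its first vector with the
  coordinate direction: the derivative of \<Phi> along the flow is a positive multiple of
  it.\<close>

definition tangent where "tangent x = Re (N x) *\<^sub>R e 1 x + Im (N x) *\<^sub>R e 2 x"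
text \<open>Differentiation along the flow, that is, in the real direction of the flat
  coordinate.\<close>

definition D1 :: "(real^2 \<Rightarrow> 'b::real_normed_vector) \<Rightarrow> real^2 \<Rightarrow> 'b" where
  "D1 F x = dual1 (p x) (q x) (pd 1 F x) (pd 2 F x)"
definition H where "H x = D1 tangent x \<bullet> D1 tangent x"

lemma Jpos: "Im (cnj (p x) * q x) > 0"
  using jac_pos[of x] by (simp add: jac_def)

lemma pq_nz: "p x \<noteq> 0" "q x \<noteq> 0"
  using Jpos[of x] by auto

lemma frame_torus: "torus_smooth (e k)"
  by (rule moving_frameD(1)[OF frame])

lemma frame_inner: "e k x \<bullet> e l x = (if k = l then 1 else 0)"
  by (rule moving_frameD(2)[OF frame])

lemma metric_conformal:
  obtains c where "c > 0" "\<And>i j. Re (cnj (pd i \<psi> x) * pd j \<psi> x) = c * pullback_metric \<Phi> x $ i $ j"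
proof -
  obtain c where c: "c > 0" "pullback_metric \<psi> x = c *\<^sub>R pullback_metric \<Phi> x" using conformal by blast
  have "Re (cnj (pd i \<psi> x) * pd j \<psi> x) = c * pullback_metric \<Phi> x $ i $ j" for i j
    unfolding pullback_complex[symmetric] c(2) by simp
  then show ?thesis using that c(1) by blast
qed

lemma coframe_\<kappa>: "coframe \<Phi> e 1 x = \<kappa> x * p x" "coframe \<Phi> e 2 x = \<kappa> x * q x"
proof -
  obtain c where c: "c > 0" "\<And>i j. Re (cnj (pd i \<psi> x) * pd j \<psi> x) = c * pullback_metric \<Phi> x $ i $ j"
    using metric_conformal[of x] by blast
  have sq: "(cmod z)\<^sup>2 = Re (cnj z * z)" for z unfolding cmod_power2 by (simp add: power2_eq_square)
  note cf = conformal_factor[OF frame_expansion(2)[OF immersion frame, of x] Jpos[of x] c(1)]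
  note h = c(2)[unfolded pullback_coframe[OF immersion frame]]
  show "coframe \<Phi> e 1 x = \<kappa> x * p x" "coframe \<Phi> e 2 x = \<kappa> x * q x"
    using cf(2,3)[unfolded sq, OF h h h] by (simp_all add: \<kappa>_def)
qed

lemma \<kappa>_nz: "\<kappa> x \<noteq> 0"
  using frame_expansion(2)[OF immersion frame, of x] unfolding coframe_\<kappa> by auto

lemma \<kappa>_torus [torus_intros]: "torus_smooth \<kappa>"
  unfolding \<kappa>_def[abs_def]
  by (intro torus_intros coframe_torus[OF immersion frame] torus_pd_chart pq_nz)

lemma log_scale_torus [torus_intros]: "torus_smooth log_scale"
  unfolding log_scale_def[abs_def] by (intro torus_intros) (simp add: \<kappa>_nz)

lemma N_torus [torus_intros]: "torus_smooth N"
  unfolding N_def[abs_def] by (intro torus_intros)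

lemma \<beta>_torus [torus_intros]: "torus_smooth (\<beta> i)"
  unfolding \<beta>_def[abs_def] by (intro torus_intros \<kappa>_nz)

lemma tangent_torus [torus_intros]: "torus_smooth tangent"
  unfolding tangent_def[abs_def] by (intro torus_intros frame_torus)

lemma torus_D1 [torus_intros]: "torus_smooth F \<Longrightarrow> torus_smooth (D1 F)"
  unfolding D1_def[abs_def] dual1_def
  by (intro torus_intros torus_pd_chart) (use Jpos in \<open>auto simp: less_le\<close>)

lemma H_torus [torus_intros]: "torus_smooth H"
  unfolding H_def[abs_def] by (intro torus_intros)

lemma exp_log_scale: "exp (log_scale x) = cmod (\<kappa> x)"
proof -
  have "ln (\<kappa> x \<bullet> \<kappa> x) = 2 * ln (cmod (\<kappa> x))"
    using \<kappa>_nz[of x] by (simp add: power2_norm_eq_inner[symmetric] ln_realpow)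
  then show ?thesis using \<kappa>_nz[of x] by (simp add: log_scale_def)
qed

lemma N_eq: "\<kappa> x = of_real (exp (log_scale x)) * N x" "cmod (N x) = 1"
proof -
  have "exp (- complex_of_real (log_scale x)) = of_real (exp (- log_scale x))" by (simp flip: exp_of_real)
  also have "\<dots> = of_real (1 / cmod (\<kappa> x))" by (simp add: exp_minus exp_log_scale divide_inverse)
  finally have "N x = \<kappa> x / of_real (cmod (\<kappa> x))" by (simp add: N_def)
  then show "\<kappa> x = of_real (exp (log_scale x)) * N x" "cmod (N x) = 1"
    using \<kappa>_nz[of x] by (simp_all add: exp_log_scale norm_divide)
qed

lemma N_sq: "(Re (N x))\<^sup>2 + (Im (N x))\<^sup>2 = 1"
  using N_eq(2)[of x] by (metis cmod_power2 one_power2)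

lemma pd_log_scale: "pd i log_scale x = Re (pd i \<kappa> x / \<kappa> x)"
proof -
  note s = torus_smoothD(1)[OF \<kappa>_torus]
  have "pd i log_scale x = (1/2) * ((\<kappa> x \<bullet> pd i \<kappa> x + pd i \<kappa> x \<bullet> \<kappa> x) / (\<kappa> x \<bullet> \<kappa> x))"
    unfolding log_scale_def[abs_def]
    by (subst pd_mult[OF smooth_const smooth_ln]) (simp_all add: pd_ln pd_inner pd_const smooth_inner s \<kappa>_nz)
  also have "\<dots> = (\<kappa> x \<bullet> pd i \<kappa> x) / (\<kappa> x \<bullet> \<kappa> x)"
    by (simp add: inner_commute)
  also have "\<dots> = Re (pd i \<kappa> x / \<kappa> x)"
    by (simp add: inner_complex_def Re_divide cmod_power2 power2_eq_square mult.commute)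
  finally show ?thesis .
qed

lemma pd_N: "pd i N x = \<i> * of_real (\<beta> i x) * N x"
proof -
  note s = torus_smoothD(1)[OF \<kappa>_torus] and l = torus_smoothD(1)[OF log_scale_torus]
  have "pd i N x = \<kappa> x * (exp (- of_real (log_scale x)) * - of_real (pd i log_scale x)) + pd i \<kappa> x * exp (- of_real (log_scale x))"
    unfolding N_def[abs_def]
    by (subst pd_mult) (simp_all add: pd_exp pd_minus pd_of_real smooth_exp smooth_minus smooth_of_real s l)
  also have "\<dots> = (pd i \<kappa> x / \<kappa> x - of_real (pd i log_scale x)) * N x"
    using \<kappa>_nz[of x] by (simp add: N_def field_simps)
  also have "pd i \<kappa> x / \<kappa> x - of_real (pd i log_scale x) = \<i> * of_real (\<beta> i x)"
    unfolding pd_log_scale \<beta>_def by (simp add: complex_eq_iff)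
  finally show ?thesis .
qed

lemma \<beta>_closed: "pd 1 (\<beta> 2) x = pd 2 (\<beta> 1) x"
proof -
  note s = torus_smoothD(1)[OF \<kappa>_torus]
  have "pd i (\<beta> j) x = Im ((pd i (pd j \<kappa>) x * \<kappa> x - pd j \<kappa> x * pd i \<kappa> x) / (\<kappa> x)\<^sup>2)" for i j
    unfolding \<beta>_def[abs_def]
    by (subst pd_Im) (simp_all add: smooth_divide pd_divide smooth_partial s \<kappa>_nz)
  then show ?thesis by (simp add: pd_swap[OF s, of 1 2] mult.commute)
qed

lemma frame_deriv:
  "pd i (e k) x \<bullet> e k x = 0" "pd i (e 2) x \<bullet> e 1 x = - \<omega> i x"
proof -
  note s = torus_smoothD(1)[OF frame_torus]
  have "pd i (\<lambda>x. e k x \<bullet> e l x) x = 0" for k l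
    unfolding frame_inner by (simp add: pd_const)
  then have d: "e k x \<bullet> pd i (e l) x + pd i (e k) x \<bullet> e l x = 0" for k l
    by (simp add: pd_inner[OF s s])
  show "pd i (e k) x \<bullet> e k x = 0" using d[of k k] by (simp add: inner_commute)
  show "pd i (e 2) x \<bullet> e 1 x = - \<omega> i x" using d[of 1 2] by (simp add: \<omega>_def inner_commute)
qed

lemma pd_coframe:
  "pd i (coframe \<Phi> e j) x = - \<i> * of_real (\<omega> i x) * coframe \<Phi> e j x
     + (of_real (e 1 x \<bullet> pd i (pd j \<Phi>) x) + \<i> * of_real (e 2 x \<bullet> pd i (pd j \<Phi>) x))"
proof -
  note s = torus_smoothD(1)[OF frame_torus] and f = torus_smoothD(1)[OF torus_immersionD[OF immersion]]
  let ?P = "pd j \<Phi>"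
  have "pd i (coframe \<Phi> e j) x =
     of_real (e 1 x \<bullet> pd i ?P x + pd i (e 1) x \<bullet> ?P x)
     + \<i> * of_real (e 2 x \<bullet> pd i ?P x + pd i (e 2) x \<bullet> ?P x)"
    unfolding coframe_def[abs_def]
    by (simp add: pd_add pd_mult pd_const pd_of_real pd_inner smooth_const smooth_mult smooth_of_real smooth_inner smooth_partial s f)
  also have "pd i (e 1) x \<bullet> ?P x = \<omega> i x * Im (coframe \<Phi> e j x)"
    unfolding frame_expansion(1)[OF immersion frame, of j x] by (simp add: inner_add_right frame_deriv \<omega>_def)
  also have "pd i (e 2) x \<bullet> ?P x = - \<omega> i x * Re (coframe \<Phi> e j x)"
    unfolding frame_expansion(1)[OF immersion frame, of j x] by (simp add: inner_add_right frame_deriv)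
  finally show ?thesis by (simp add: complex_eq_iff)
qed

text \<open>The exterior derivative of the coframe is computed twice: once from the symmetry of the
  second derivatives of \<Phi>, giving the connection form, and once from the representation as
  \<kappa> times the exact form \<open>d\<psi>\<close>. Division by \<kappa> leaves its logarithmic
  derivative.\<close>

lemma structure_equation:
  "Complex (pd 1 log_scale x) (\<beta> 1 x + \<omega> 1 x) * q x = Complex (pd 2 log_scale x) (\<beta> 2 x + \<omega> 2 x) * p x"
proof -
  note s = torus_smoothD(1)[OF \<kappa>_torus]
  have f: "smooth \<Phi>" by (rule torus_smoothD(1)[OF torus_immersionD[OF immersion]])
  have c: "coframe \<Phi> e 1 = (\<lambda>x. \<kappa> x * p x)" "coframe \<Phi> e 2 = (\<lambda>x. \<kappa> x * q x)"
    by (rule ext, rule coframe_\<kappa>)+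
  have s1: "pd 1 (coframe \<Phi> e 2) x - pd 2 (coframe \<Phi> e 1) x
     = - \<i> * of_real (\<omega> 1 x) * coframe \<Phi> e 2 x + \<i> * of_real (\<omega> 2 x) * coframe \<Phi> e 1 x"
    unfolding pd_coframe pd_swap[OF f, of 1 2] by simp
  have s2: "pd 1 (coframe \<Phi> e 2) x - pd 2 (coframe \<Phi> e 1) x
     = pd 1 \<kappa> x * q x - pd 2 \<kappa> x * p x"
    unfolding c pd_mult[OF s smooth_partial[OF chart_smooth]] pd_swap[OF chart_smooth, of 1 2] by simp
  have "(pd 1 \<kappa> x + \<i> * of_real (\<omega> 1 x) * \<kappa> x) * q x = (pd 2 \<kappa> x + \<i> * of_real (\<omega> 2 x) * \<kappa> x) * p x"
    using trans[OF s2[symmetric] s1] unfolding coframe_\<kappa> by (simp add: algebra_simps)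
  then have "(pd 1 \<kappa> x / \<kappa> x + \<i> * of_real (\<omega> 1 x)) * q x = (pd 2 \<kappa> x / \<kappa> x + \<i> * of_real (\<omega> 2 x)) * p x"
    using \<kappa>_nz[of x] by (simp add: field_simps)
  moreover have "Complex (pd i log_scale x) (\<beta> i x + \<omega> i x) = pd i \<kappa> x / \<kappa> x + \<i> * of_real (\<omega> i x)" for i
    unfolding pd_log_scale \<beta>_def by (simp add: complex_eq_iff)
  ultimately show ?thesis by simp
qed

abbreviation energy_dens :: "2 \<Rightarrow> real^2 \<Rightarrow> real" where
  "energy_dens k x \<equiv> conf_energy (p x) (q x) (pd 1 (e k) x) (pd 2 (e k) x)"

lemma energy_dens_torus: "torus_smooth (energy_dens k)"
  unfolding conf_energy_def cmod_power2
  by (intro torus_intros torus_pd_chart frame_torus) (use Jpos in \<open>auto simp: less_le\<close>)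

lemma frame_energy_eq: "4 * frame_energy \<Phi> e = tint (\<lambda>x. energy_dens 1 x + energy_dens 2 x)"
proof -
  have "frame_norm_sq (pullback_metric \<Phi>) e x * sqrt (det (pullback_metric \<Phi> x)) = energy_dens 1 x + energy_dens 2 x" for x
  proof -
    obtain c where c: "c > 0" "\<And>i j. Re (cnj (pd i \<psi> x) * pd j \<psi> x) = c * pullback_metric \<Phi> x $ i $ j"
      using metric_conformal[of x] by blast
    have sq: "(cmod z)\<^sup>2 = Re (cnj z * z)" for z unfolding cmod_power2 by (simp add: power2_eq_square)
    have sym: "Re (cnj (p x) * q x) = Re (cnj (q x) * p x)" by (simp add: algebra_simps)
    show ?thesis
      using frame_energy_density[OF Jpos[of x] c(1), of "pullback_metric \<Phi>" x e]
      unfolding sq sum_2 using c(2) sym by metis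
  qed
  then show ?thesis by (simp add: frame_energy_def tint_def)
qed

text \<open>By orthonormality the connection form is, up to sign, a component of the derivative of
  each frame vector. Its energy is thus bounded by that of either vector, hence by half the
  sum.\<close>

lemma rotation_energy:
  "conf_energy (p x) (q x) (\<beta> 1 x) (\<beta> 2 x) \<le> (1/2) * (energy_dens 1 x + energy_dens 2 x)
     + 2 * (pd 1 log_scale x * \<beta> 2 x - pd 2 log_scale x * \<beta> 1 x)"
proof -
  have n: "norm (e k x) = 1" for k by (simp add: norm_eq_sqrt_inner frame_inner)
  have 1: "conf_energy (p x) (q x) (\<omega> 1 x) (\<omega> 2 x) \<le> energy_dens 1 x"
    using conf_energy_inner[OF Jpos n, of x "pd 1 (e 1) x" 2 "pd 2 (e 1) x"] by (simp add: \<omega>_def)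
  have "conf_energy (p x) (q x) (- \<omega> 1 x) (- \<omega> 2 x) \<le> energy_dens 2 x"
    using conf_energy_inner[OF Jpos n, of x "pd 1 (e 2) x" 1 "pd 2 (e 2) x"] by (simp add: frame_deriv)
  then have 2: "conf_energy (p x) (q x) (\<omega> 1 x) (\<omega> 2 x) \<le> energy_dens 2 x"
    by (simp add: conf_energy_def)
  have "X \<le> (1/2) * (E1 + E2) + Z" if "Y \<le> E1" "Y \<le> E2" "X \<le> Y + Z" for X Y Z E1 E2 :: real
    using that by (simp add: field_simps)
  from this[OF 1 2 conf_energy_rotation[OF Jpos structure_equation]] show ?thesis .
qed

lemma pd_tangent: "pd i tangent x = \<beta> i x *\<^sub>R (Re (N x) *\<^sub>R e 2 x - Im (N x) *\<^sub>R e 1 x)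
    + (Re (N x) *\<^sub>R pd i (e 1) x + Im (N x) *\<^sub>R pd i (e 2) x)"
proof -
  note s = torus_smoothD(1)[OF frame_torus] and n = torus_smoothD(1)[OF N_torus]
  have "pd i tangent x = Re (N x) *\<^sub>R pd i (e 1) x + Re (pd i N x) *\<^sub>R e 1 x
     + (Im (N x) *\<^sub>R pd i (e 2) x + Im (pd i N x) *\<^sub>R e 2 x)"
    unfolding tangent_def[abs_def]
    by (simp add: pd_add pd_scaleR pd_Re pd_Im smooth_scaleR smooth_Re smooth_Im s n)
  then show ?thesis unfolding pd_N by (simp add: algebra_simps)
qed

text \<open>The derivative of \<open>tangent\<close> is a rotation term plus a combination of the
  frame derivatives with the components of the unit number \<open>N\<close> as coefficients. The
  factors 2 come from separating these terms; Cauchy-Schwarz handles the combination.\<close>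

lemma tangent_energy:
  "H x * jac \<psi> x \<le> 2 * conf_energy (p x) (q x) (\<beta> 1 x) (\<beta> 2 x) + 2 * (energy_dens 1 x + energy_dens 2 x)"
proof -
  define R where "R = Re (N x) *\<^sub>R e 2 x - Im (N x) *\<^sub>R e 1 x"
  let ?d = "dual1 (p x) (q x)"
  define b where "b = ?d (\<beta> 1 x) (\<beta> 2 x)"
  define u where "u k = ?d (pd 1 (e k) x) (pd 2 (e k) x)" for k
  have D: "D1 tangent x = b *\<^sub>R R + (Re (N x) *\<^sub>R u 1 + Im (N x) *\<^sub>R u 2)"
    unfolding D1_def pd_tangent R_def[symmetric] b_def u_def dual1_add dual1_vec dual1_scaleR ..
  have R1: "norm R = 1"
  proof -
    have "R \<bullet> R = (Re (N x))\<^sup>2 + (Im (N x))\<^sup>2"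
      unfolding R_def by (simp add: inner_diff_left inner_diff_right frame_inner power2_eq_square)
    then show ?thesis by (simp add: norm_eq_sqrt_inner N_sq)
  qed
  have "norm (D1 tangent x) \<le> \<bar>b\<bar> + (\<bar>Re (N x)\<bar> * norm (u 1) + \<bar>Im (N x)\<bar> * norm (u 2))"
    unfolding D using R1
    by (intro order_trans[OF norm_triangle_ineq] add_mono order_trans[OF norm_triangle_ineq]) auto
  then have "(norm (D1 tangent x))\<^sup>2 \<le> (\<bar>b\<bar> + (\<bar>Re (N x)\<bar> * norm (u 1) + \<bar>Im (N x)\<bar> * norm (u 2)))\<^sup>2"
    by (intro power_mono) auto
  also have "\<dots> \<le> 2 * b\<^sup>2 + 2 * (\<bar>Re (N x)\<bar> * norm (u 1) + \<bar>Im (N x)\<bar> * norm (u 2))\<^sup>2"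
  proof -
    have "(y + z)\<^sup>2 \<le> 2 * y\<^sup>2 + 2 * z\<^sup>2" for y z :: real
      using zero_le_power2[of "y - z"] by (simp add: power2_sum power2_diff)
    from this[of "\<bar>b\<bar>"] show ?thesis by simp
  qed
  also have "(\<bar>Re (N x)\<bar> * norm (u 1) + \<bar>Im (N x)\<bar> * norm (u 2))\<^sup>2 \<le> (norm (u 1))\<^sup>2 + (norm (u 2))\<^sup>2"
  proof -
    have "(a * y + c * z)\<^sup>2 + (a * z - c * y)\<^sup>2 = (a\<^sup>2 + c\<^sup>2) * (y\<^sup>2 + z\<^sup>2)" for a c y z :: real
      by (simp add: power2_eq_square algebra_simps)
    from this[of "\<bar>Re (N x)\<bar>" "norm (u 1)" "\<bar>Im (N x)\<bar>" "norm (u 2)"]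
    have "(\<bar>Re (N x)\<bar> * norm (u 1) + \<bar>Im (N x)\<bar> * norm (u 2))\<^sup>2
        + (\<bar>Re (N x)\<bar> * norm (u 2) - \<bar>Im (N x)\<bar> * norm (u 1))\<^sup>2 = (norm (u 1))\<^sup>2 + (norm (u 2))\<^sup>2"
      by (simp add: N_sq)
    then show ?thesis by (metis le_add_same_cancel1 zero_le_power2)
  qed
  finally have "(norm (D1 tangent x))\<^sup>2 \<le> 2 * b\<^sup>2 + 2 * ((norm (u 1))\<^sup>2 + (norm (u 2))\<^sup>2)" by simp
  then have "H x \<le> 2 * b\<^sup>2 + 2 * ((norm (u 1))\<^sup>2 + (norm (u 2))\<^sup>2)"
    by (simp add: H_def power2_norm_eq_inner)
  then have "H x * jac \<psi> x \<le> (2 * b\<^sup>2 + 2 * ((norm (u 1))\<^sup>2 + (norm (u 2))\<^sup>2)) * jac \<psi> x"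
    using jac_pos[of x] by (intro mult_right_mono) auto
  also have "\<dots> = 2 * (jac \<psi> x * (norm b)\<^sup>2) + 2 * (jac \<psi> x * (norm (u 1))\<^sup>2 + jac \<psi> x * (norm (u 2))\<^sup>2)"
    by (simp add: algebra_simps)
  also have "\<dots> \<le> 2 * conf_energy (p x) (q x) (\<beta> 1 x) (\<beta> 2 x) + 2 * (energy_dens 1 x + energy_dens 2 x)"
    unfolding b_def u_def jac_def
    by (intro add_mono mult_left_mono conf_energy_ge Jpos) auto
  finally show ?thesis .
qed

text \<open>The two preceding bounds combine to 3 times the frame density plus a multiple of
  \<open>?L\<close>. The latter is exact because \<beta> is closed, and its primitive is periodic
  because \<open>log_scale\<close> and \<beta> are.\<close>

lemma tint_H_le: "tint (\<lambda>x. H x * jac \<psi> x) \<le> 12 * frame_energy \<Phi> e"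
proof -
  let ?E = "\<lambda>x. energy_dens 1 x + energy_dens 2 x"
  let ?L = "\<lambda>x. pd 1 log_scale x * \<beta> 2 x - pd 2 log_scale x * \<beta> 1 x"
  have E: "torus_smooth ?E" by (intro torus_intros energy_dens_torus)
  have L: "torus_smooth ?L" by (intro torus_intros)
  note l = torus_smoothD(1)[OF log_scale_torus] and b = torus_smoothD(1)[OF \<beta>_torus]
  have "?L x = pd 1 (\<lambda>x. log_scale x * \<beta> 2 x) x - pd 2 (\<lambda>x. log_scale x * \<beta> 1 x) x" for x
    by (simp add: pd_mult[OF l b] \<beta>_closed)
  then have "tint ?L = tint (pd 1 (\<lambda>x. log_scale x * \<beta> 2 x)) - tint (pd 2 (\<lambda>x. log_scale x * \<beta> 1 x))"
    by (simp only:) (intro tint_diff torus_continuous torus_intros)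
  then have L0: "tint ?L = 0" by (simp add: tint_partial torus_mult log_scale_torus \<beta>_torus)
  have "H x * jac \<psi> x \<le> 3 * ?E x + 4 * ?L x" for x
    using tangent_energy[of x] rotation_energy[of x] by argo
  then have "tint (\<lambda>x. H x * jac \<psi> x) \<le> tint (\<lambda>x. 3 * ?E x + 4 * ?L x)"
    by (intro tint_mono torus_continuous torus_intros torus_jac energy_dens_torus)
  also have "\<dots> = 3 * tint ?E + 4 * tint ?L"
    by (subst tint_add) (intro continuous_on_mult continuous_on_const torus_continuous E L | simp only: tint_cmult_real)+
  finally show ?thesis unfolding L0 frame_energy_eq[symmetric] by simp
qed

text \<open>The curve \<open>\<Phi> (flow s x)\<close> has velocity
  \<open>exp (log_scale (flow s x))\<close> times \<open>tangent\<close>. It closes at time 1, when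
  the flow has moved the point by a lattice vector.\<close>

lemma orbit_ge: "2 \<le> integral {0..1} (\<lambda>s. H (flow s x))"
proof -
  note T = torus_smoothD(1)[OF tangent_torus] and f = torus_smoothD(1)[OF torus_immersionD[OF immersion]]
  have D: "D1 \<Phi> y = exp (log_scale y) *\<^sub>R tangent y" for y
  proof -
    obtain a b where p: "p y = Complex a b" by (cases "p y")
    obtain c d where q: "q y = Complex c d" by (cases "q y")
    obtain k l where k: "\<kappa> y = Complex k l" by (cases "\<kappa> y")
    define J where "J = a * d - b * c"
    have J: "J > 0" using Jpos[of y] by (simp add: J_def p q)
    have "D1 \<Phi> y = (1/J) *\<^sub>R (J *\<^sub>R (k *\<^sub>R e 1 y + l *\<^sub>R e 2 y))"
      unfolding D1_def dual1_def frame_expansion(1)[OF immersion frame] coframe_\<kappa> p q k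
      by (simp add: J_def algebra_simps)
    also have "\<dots> = Re (\<kappa> y) *\<^sub>R e 1 y + Im (\<kappa> y) *\<^sub>R e 2 y" using J by (simp add: k)
    also have "\<dots> = exp (log_scale y) *\<^sub>R tangent y"
      unfolding N_eq(1)[of y] tangent_def by (simp add: algebra_simps)
    finally show ?thesis .
  qed
  obtain n where n: "n \<in> int_lattice" "flow 1 x = x + n" by (rule flow_1)
  have cfl: "continuous_on S (\<lambda>s. flow s x)" for S by (intro continuous_flow continuous_intros)
  have "2 \<le> integral {0..1} (\<lambda>s. (norm (D1 tangent (flow s x)))\<^sup>2)"
  proof (rule closed_curve_tangent)
    show "((\<lambda>s. \<Phi> (flow s x)) has_vector_derivative exp (log_scale (flow s x)) *\<^sub>R tangent (flow s x)) (at s)" for s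
      using flow_deriv[OF f] unfolding D[symmetric] D1_def .
    show "((\<lambda>s. tangent (flow s x)) has_vector_derivative D1 tangent (flow s x)) (at s)" for s
      unfolding D1_def by (rule flow_deriv[OF T])
    show "continuous_on UNIV (\<lambda>s. exp (log_scale (flow s x)))"
      by (intro continuous_intros smooth_continuous_on_compose[OF torus_smoothD(1)[OF log_scale_torus]] cfl)
    show "continuous_on UNIV (\<lambda>s. D1 tangent (flow s x))"
      by (intro smooth_continuous_on_compose[OF torus_smoothD(1)[OF torus_D1[OF tangent_torus]]] cfl)
    show "norm (tangent (flow s x)) = 1" for s
    proof -
      have "tangent y \<bullet> tangent y = (Re (N y))\<^sup>2 + (Im (N y))\<^sup>2" for y
        unfolding tangent_def by (simp add: inner_add_left inner_add_right frame_inner power2_eq_square)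
      then show ?thesis by (simp add: norm_eq_sqrt_inner N_sq)
    qed
    show "\<Phi> (flow 1 x) = \<Phi> (flow 0 x)"
      using periodicD[OF torus_smoothD(2)[OF torus_immersionD[OF immersion]] n(1), of x] n(2) by (simp add: flow_def)
  qed simp
  then show ?thesis by (simp add: H_def power2_norm_eq_inner)
qed

text \<open>After the order of integration is exchanged, \<open>tint_flow\<close> makes the inner
  integral independent of the flow time, so the average over all orbits becomes the integral bounded
  in \<open>tint_H_le\<close>.\<close>

theorem Im_le_frame_energy: "Im \<tau> \<le> 6 * frame_energy \<Phi> e"
proof -
  have cH: "continuous_on S (\<lambda>z. H (flow (f z) (g z)))" if "continuous_on S f" "continuous_on S g" for S :: "'z::topological_space set" and f g
    by (intro smooth_continuous_on_compose[OF torus_smoothD(1)[OF H_torus]] continuous_flow that)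
  have cJ: "continuous_on S (\<lambda>z. jac \<psi> (g z))" if "continuous_on S g" for S :: "'z::topological_space set" and g
    by (intro smooth_continuous_on_compose[OF torus_smoothD(1)[OF torus_jac]] that)
  have swap: "integral (cbox 0 1) (\<lambda>x. integral (cbox 0 1) (\<lambda>s. H (flow s x) * jac \<psi> x)) =
      integral (cbox 0 1) (\<lambda>s. integral (cbox 0 1) (\<lambda>x. H (flow s x) * jac \<psi> x))"
    by (rule integral_swap_continuous) (unfold split_def, intro continuous_intros cH cJ)
  have "2 * Im \<tau> \<le> 2 * tint (jac \<psi>)" using Im_le_area by simp
  also have "\<dots> = tint (\<lambda>x. 2 * jac \<psi> x)" by (simp add: tint_cmult_real)
  also have "\<dots> \<le> tint (\<lambda>x. integral (cbox 0 1) (\<lambda>s. H (flow s x) * jac \<psi> x))"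
  proof (rule tint_mono)
    show "continuous_on UNIV (\<lambda>x. 2 * jac \<psi> x)" by (intro continuous_intros cJ)
    show "continuous_on UNIV (\<lambda>x. integral (cbox 0 1) (\<lambda>s. H (flow s x) * jac \<psi> x))"
      by (rule integral_continuous_on_param) (unfold split_def, intro continuous_intros cH cJ)
    show "2 * jac \<psi> x \<le> integral (cbox 0 1) (\<lambda>s. H (flow s x) * jac \<psi> x)" for x
      using orbit_ge[of x] jac_pos[of x] by (simp add: cbox_interval)
  qed
  also have "\<dots> = integral (cbox 0 1) (\<lambda>s::real. tint (\<lambda>x. H (flow s x) * jac \<psi> x))"
    using swap by (simp only: tint_def)
  also have "\<dots> = integral (cbox 0 1) (\<lambda>s::real. tint (\<lambda>x. H x * jac \<psi> x))"
    by (simp only: tint_flow[OF H_torus])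
  also have "\<dots> = tint (\<lambda>x. H x * jac \<psi> x)" by (simp add: cbox_interval)
  also have "\<dots> \<le> 12 * frame_energy \<Phi> e" by (rule tint_H_le)
  finally show ?thesis by simp
qed

end

section \<open>The conformal modulus is a point of the moduli space\<close>

lemma pd_inv_right:
  assumes "jac f x \<noteq> 0"
  shows "(pd_inv f x z)$1 *\<^sub>R pd 1 f x + (pd_inv f x z)$2 *\<^sub>R pd 2 f x = z"
proof -
  obtain a b where a: "pd 1 f x = Complex a b" by (cases "pd 1 f x")
  obtain c d where c: "pd 2 f x = Complex c d" by (cases "pd 2 f x")
  obtain y w where z: "z = Complex y w" by (cases z)
  define J where "J = jac f x"
  have J: "J = a * d - b * c" "J \<noteq> 0" using assms by (simp_all add: J_def jac_def a c)
  have "pd_inv f x z = plane_pt ((y * d - w * c) / J) ((a * w - b * y) / J)"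
    by (simp add: pd_inv_def J_def[symmetric] a c z)
  moreover have "(y * d - w * c) / J * a + (a * w - b * y) / J * c = y * ((a * d - b * c) / J)"
    "(y * d - w * c) / J * b + (a * w - b * y) / J * d = w * ((a * d - b * c) / J)"
    by (simp_all add: algebra_simps add_divide_distrib diff_divide_distrib)
  ultimately show ?thesis
    using J(2) unfolding J(1)[symmetric] by (simp add: a c z complex_eq_iff)
qed

text \<open>Numerator and denominator of the Moebius transform form another basis of the same
  lattice; dividing by the denominator normalises it.\<close>

lemma torus_lattice_scale:
  fixes a b c d :: int
  assumes det: "a * d - b * c = 1" and nz: "of_int c * \<tau> + of_int d \<noteq> 0"
  shows "z \<in> torus_lattice \<tau> \<longleftrightarrow> z / (of_int c * \<tau> + of_int d) \<in> torus_lattice ((of_int a * \<tau> + of_int b) / (of_int c * \<tau> + of_int d))"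
proof -
  let ?D = "of_int c * \<tau> + of_int d" and ?N = "of_int a * \<tau> + of_int b"
  have eq: "z / ?D = of_int m + of_int n * (?N / ?D) \<longleftrightarrow> z = of_int (m * d + n * b) + of_int (m * c + n * a) * \<tau>" for m n :: int
    using nz by (simp add: field_simps)
  show ?thesis
  proof
    assume "z \<in> torus_lattice \<tau>"
    then obtain k l where kl: "z = of_int k + of_int l * \<tau>" unfolding torus_lattice_def by blast
    \<comment> \<open>Coordinates in the new basis, from the inverse matrix, which is integral
      because the determinant is 1.\<close>
    define m n where "m = a * k - b * l" and "n = d * l - c * k"
    have "m * d + n * b = (a * d - b * c) * k" "m * c + n * a = (a * d - b * c) * l"
      by (simp_all add: m_def n_def algebra_simps)
    then have "z = of_int (m * d + n * b) + of_int (m * c + n * a) * \<tau>" unfolding det kl by simp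
    then show "z / ?D \<in> torus_lattice (?N / ?D)" unfolding eq[symmetric] torus_lattice_def by blast
  next
    assume "z / ?D \<in> torus_lattice (?N / ?D)"
    then obtain m n where "z / ?D = of_int m + of_int n * (?N / ?D)" unfolding torus_lattice_def by blast
    then show "z \<in> torus_lattice \<tau>" unfolding eq torus_lattice_def by blast
  qed
qed

text \<open>Dividing the flat coordinate by \<open>c * \<tau> + d\<close> replaces its lattice by
  that of \<open>\<tau>'\<close> and multiplies the pulled-back metric by a constant.\<close>

lemma conformal_modulus_closed:
  fixes g :: "real^2 \<Rightarrow> real^2^2"
  assumes \<tau>: "\<tau> \<in> conformal_modulus g" and r: "(\<tau>, \<tau>') \<in> modular_rel"
  shows "\<tau>' \<in> conformal_modulus g"
proof -
  obtain \<psi> where \<psi>: "torus_diffeo \<tau> \<psi>" "\<And>x. \<exists>c>0. pullback_metric \<psi> x = c *\<^sub>R g x" and up: "\<tau> \<in> upper_half_plane"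
    using \<tau> unfolding conformal_modulus_def by blast
  interpret torus_chart \<tau> \<psi> by unfold_locales (use \<psi> up in auto)
  obtain a b c d :: int where det: "a * d - b * c = 1" and \<tau>': "\<tau>' = (of_int a * \<tau> + of_int b) / (of_int c * \<tau> + of_int d)"
    and up': "\<tau>' \<in> upper_half_plane"
    using r unfolding modular_rel_def by blast
  define D where "D = of_int c * \<tau> + of_int d"
  have D: "D \<noteq> 0" using up' unfolding \<tau>' D_def[symmetric] upper_half_plane_def by auto
  define f where "f x = (1 / D) * \<psi> x" for x
  have sm: "smooth f" unfolding f_def[abs_def] by (intro smooth_intros chart_smooth)
  have pd: "pd i f = (\<lambda>x. (1 / D) * pd i \<psi> x)" for i
    unfolding f_def[abs_def] pd_mult[OF smooth_const chart_smooth] pd_const by simp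
  have conj: "cnj (pd i f x) * pd j f x = of_real ((cmod (1/D))\<^sup>2) * (cnj (pd i \<psi> x) * pd j \<psi> x)" for i j x
  proof -
    have "cnj (pd i f x) * pd j f x = (cnj (1/D) * (1/D)) * (cnj (pd i \<psi> x) * pd j \<psi> x)"
      by (simp add: pd)
    also have "cnj (1/D) * (1/D) = of_real ((cmod (1/D))\<^sup>2)" by (metis complex_norm_square mult.commute)
    finally show ?thesis .
  qed
  have J: "jac f x > 0" for x
  proof -
    have "jac f x = (cmod (1/D))\<^sup>2 * jac \<psi> x" unfolding jac_def conj by simp
    then show ?thesis using jac_pos[of x] D by simp
  qed
  have bij: "bij f"
  proof -
    have "bij (\<lambda>z. (1 / D) * z)"
      by (rule o_bij[of "\<lambda>z. D * z"]) (use D in \<open>auto simp: fun_eq_iff\<close>)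
    from bij_comp[OF chart_bij this] show ?thesis by (simp add: f_def[abs_def] o_def)
  qed
  have Jnz: "jac f x \<noteq> 0" for x using J[of x] by simp
  have "torus_diffeo \<tau>' f"
    unfolding torus_diffeo_def
  proof (intro conjI allI bij sm smooth_inv[OF sm Jnz bij])
    fix x y
    have "f x - f y = (\<psi> x - \<psi> y) / D" by (simp add: f_def diff_divide_distrib)
    then show "f x - f y \<in> torus_lattice \<tau>' \<longleftrightarrow> x - y \<in> int_lattice"
      using torus_lattice_scale[OF det D[unfolded D_def], of "\<psi> x - \<psi> y"] chart_lattice[of x y]
      by (simp add: \<tau>' D_def)
    show "0 < Im (cnj (pd 1 f x) * pd 2 f x)" for x using J[of x] by (simp add: jac_def)
  qed
  moreover have "\<exists>c>0. pullback_metric f x = c *\<^sub>R g x" for x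
  proof -
    obtain c where c: "c > 0" "pullback_metric \<psi> x = c *\<^sub>R g x" using \<psi>(2) by blast
    have "pullback_metric f x $ i $ j = ((cmod (1/D))\<^sup>2 * c) * (g x $ i $ j)" for i j
    proof -
      have "pullback_metric f x $ i $ j = (cmod (1/D))\<^sup>2 * pullback_metric \<psi> x $ i $ j"
        unfolding pullback_complex conj by simp
      then show ?thesis unfolding c(2) by simp
    qed
    then have "pullback_metric f x = ((cmod (1/D))\<^sup>2 * c) *\<^sub>R g x" by (simp add: vec_eq_iff)
    then show ?thesis using c(1) D by (intro exI[of _ "(cmod (1/D))\<^sup>2 * c"]) simp
  qed
  ultimately show ?thesis using up' unfolding conformal_modulus_def by blast
qed

text \<open>Multiplication by \<open>k\<close> maps one lattice onto the other, so both changes of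
  basis are integer matrices. Comparing oriented areas shows that their determinants have product 1
  and that one is positive, so it equals 1.\<close>

lemma lattice_scaling_modular:
  assumes up: "\<tau> \<in> upper_half_plane" "\<tau>' \<in> upper_half_plane"
    and k: "\<And>l. l \<in> torus_lattice \<tau> \<Longrightarrow> k * l \<in> torus_lattice \<tau>'"
    and k': "\<And>l. l \<in> torus_lattice \<tau>' \<Longrightarrow> \<exists>l'\<in>torus_lattice \<tau>. l = k * l'"
  shows "(\<tau>, \<tau>') \<in> modular_rel" "(\<tau>', \<tau>) \<in> modular_rel"
proof -
  have im: "Im \<tau> > 0" "Im \<tau>' > 0" using up by (simp_all add: upper_half_plane_def)
  have mem: "1 \<in> torus_lattice t" "t \<in> torus_lattice t" for t
  proof -
    have "1 = of_int 1 + of_int 0 * t" "t = of_int 0 + of_int 1 * t" by simp_all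
    then show "1 \<in> torus_lattice t" "t \<in> torus_lattice t" unfolding torus_lattice_def by blast+
  qed
  obtain l1 where "l1 \<in> torus_lattice \<tau>" "1 = k * l1" using k'[OF mem(1)] by blast
  then have k0: "k \<noteq> 0" by auto
  obtain p q :: int where pq: "k = of_int p + of_int q * \<tau>'"
    using k[OF mem(1)] unfolding torus_lattice_def by auto
  obtain r s :: int where rs: "k * \<tau> = of_int r + of_int s * \<tau>'"
    using k[OF mem(2)] unfolding torus_lattice_def by auto
  obtain p' q' :: int where pq': "1 = k * (of_int p' + of_int q' * \<tau>)"
    using k'[OF mem(1)] unfolding torus_lattice_def by auto
  obtain r' s' :: int where rs': "\<tau>' = k * (of_int r' + of_int s' * \<tau>)"
    using k'[OF mem(2)] unfolding torus_lattice_def by auto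
  have area: "Im (cnj (of_int a + of_int b * t) * (of_int c + of_int d * t)) = of_int (a * d - b * c) * Im t" for a b c d :: int and t
    by (simp add: algebra_simps)
  have kk: "Im (cnj (k * u) * (k * v)) = (cmod k)\<^sup>2 * Im (cnj u * v)" for u v
  proof -
    have "cnj (k * u) * (k * v) = (k * cnj k) * (cnj u * v)" by simp
    also have "k * cnj k = of_real ((cmod k)\<^sup>2)" by (rule complex_norm_square[symmetric])
    finally have "Im (cnj (k * u) * (k * v)) = Im (of_real ((cmod k)\<^sup>2) * (cnj u * v))" by (rule arg_cong)
    then show ?thesis by (simp only: scaleR_conv_of_real[symmetric] scaleR_complex.sel)
  qed
  have 1: "(cmod k)\<^sup>2 * Im \<tau> = of_int (p * s - q * r) * Im \<tau>'"
    using kk[of 1 \<tau>] unfolding rs area[symmetric] pq[symmetric] by simp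
  have 2: "Im \<tau>' = (cmod k)\<^sup>2 * (of_int (p' * s' - q' * r') * Im \<tau>)"
  proof -
    have "Im \<tau>' = Im (cnj 1 * \<tau>')" by simp
    also have "\<dots> = Im (cnj (k * (of_int p' + of_int q' * \<tau>)) * (k * (of_int r' + of_int s' * \<tau>)))"
      unfolding pq'[symmetric] rs'[symmetric] ..
    finally show ?thesis unfolding kk area .
  qed
  define m n where "m = p * s - q * r" and "n = p' * s' - q' * r'"
  have "(cmod k)\<^sup>2 * Im \<tau> > 0" using k0 im by simp
  then have m0: "m > 0" using im(2) unfolding 1 m_def[symmetric] by (simp add: zero_less_mult_iff)
  have "Im \<tau>' = of_int n * ((cmod k)\<^sup>2 * Im \<tau>)" using 2 by (simp add: n_def)
  also have "\<dots> = of_int (n * m) * Im \<tau>'" unfolding 1 m_def[symmetric] by simp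
  finally have "n * m = 1" using im(2) by simp (metis of_int_eq_1_iff of_int_mult)
  then have m1: "m = 1" using m0 by (simp add: zmult_eq_1_iff)
  have \<tau>: "\<tau> = (of_int s * \<tau>' + of_int r) / (of_int q * \<tau>' + of_int p)"
    using k0 rs pq by (simp add: field_simps)
  have det: "s * p - r * q = 1" using m1 by (simp add: m_def algebra_simps)
  show "(\<tau>', \<tau>) \<in> modular_rel" unfolding modular_rel_def using up \<tau> det by blast
  have nz: "of_int q * \<tau>' + of_int p \<noteq> 0" using k0 pq by (simp add: add.commute)
  \<comment> \<open>The reverse transformation is read off from the adjugate matrix; its numerators
    contain the determinant, which is 1.\<close>
  have "(of_int p * \<tau> + of_int (- r)) = \<tau>' * (of_int (s * p - r * q) / (of_int q * \<tau>' + of_int p))"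
    unfolding \<tau> using nz by (simp add: field_simps)
  moreover have "(of_int (- q) * \<tau> + of_int s) = of_int (s * p - r * q) / (of_int q * \<tau>' + of_int p)"
    unfolding \<tau> using nz by (simp add: field_simps)
  ultimately have "\<tau>' = (of_int p * \<tau> + of_int (- r)) / (of_int (- q) * \<tau> + of_int s)"
    unfolding det using nz by simp
  moreover have "p * s - (- r) * (- q) = 1" using det by (simp add: algebra_simps)
  ultimately show "(\<tau>, \<tau>') \<in> modular_rel" unfolding modular_rel_def using up by blast
qed

text \<open>The transition map between two flat coordinates of the same conformal structure is entire
  with bounded derivative, hence affine by Liouville's theorem.\<close>

lemma conformal_modulus_unique:
  assumes \<tau>: "\<tau> \<in> conformal_modulus g" and \<tau>': "\<tau>' \<in> conformal_modulus g"
  shows "(\<tau>, \<tau>') \<in> modular_rel"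
proof -
  obtain \<psi> where \<psi>: "torus_diffeo \<tau> \<psi>" "\<And>x. \<exists>c>0. pullback_metric \<psi> x = c *\<^sub>R g x" and up: "\<tau> \<in> upper_half_plane"
    using \<tau> unfolding conformal_modulus_def by blast
  obtain \<phi> where \<phi>: "torus_diffeo \<tau>' \<phi>" "\<And>x. \<exists>c>0. pullback_metric \<phi> x = c *\<^sub>R g x" and up': "\<tau>' \<in> upper_half_plane"
    using \<tau>' unfolding conformal_modulus_def by blast
  interpret A: torus_chart \<tau> \<psi> by unfold_locales (use \<psi> up in auto)
  interpret B: torus_chart \<tau>' \<phi> by unfold_locales (use \<phi> up' in auto)
  have Jp: "Im (cnj (pd 1 \<psi> x) * pd 2 \<psi> x) > 0" "Im (cnj (pd 1 \<phi> x) * pd 2 \<phi> x) > 0" for x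
    using A.jac_pos[of x] B.jac_pos[of x] by (simp_all add: jac_def)
  define r where "r x = pd 1 \<phi> x / pd 1 \<psi> x" for x
  have nz: "pd 1 \<psi> x \<noteq> 0" for x using Jp(1)[of x] by auto
  have r: "pd i \<phi> x = r x * pd i \<psi> x" for i x
  proof -
    obtain c where c: "c > 0" "pullback_metric \<psi> x = c *\<^sub>R g x" using \<psi>(2) by blast
    obtain c' where c': "c' > 0" "pullback_metric \<phi> x = c' *\<^sub>R g x" using \<phi>(2) by blast
    have "pullback_metric \<psi> x $ i $ j = (c / c') * pullback_metric \<phi> x $ i $ j" for i j
      unfolding c(2) c'(2) using c'(1) by simp
    then have h: "Re (cnj (pd i \<psi> x) * pd j \<psi> x) = (c / c') * Re (cnj (pd i \<phi> x) * pd j \<phi> x)" for i j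
      unfolding pullback_complex .
    have sq: "(cmod z)\<^sup>2 = Re (cnj z * z)" for z unfolding cmod_power2 by (simp add: power2_eq_square)
    have "c / c' > 0" using c c' by simp
    from conformal_factor(2,3)[OF Jp(2) Jp(1) this, unfolded sq, OF h h h]
    show ?thesis using exhaust_2[of i] unfolding r_def by metis
  qed
  have rt: "torus_smooth r" unfolding r_def[abs_def] by (intro torus_intros A.torus_pd_chart B.torus_pd_chart nz)
  define F where "F w = \<phi> (inv \<psi> w)" for w
  have F: "(F has_field_derivative r (inv \<psi> w)) (at w)" for w
  proof -
    let ?x = "inv \<psi> w"
    have "(F has_derivative (\<lambda>z. (pd_inv \<psi> ?x z)$1 *\<^sub>R pd 1 \<phi> ?x + (pd_inv \<psi> ?x z)$2 *\<^sub>R pd 2 \<phi> ?x)) (at w)"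
      unfolding F_def[abs_def]
      by (rule has_derivative_compose[OF inv_has_derivative[OF A.chart_smooth A.jac_nz A.chart_bij] smooth_has_derivative2[OF B.chart_smooth]])
    moreover have "(pd_inv \<psi> ?x z)$1 *\<^sub>R pd 1 \<phi> ?x + (pd_inv \<psi> ?x z)$2 *\<^sub>R pd 2 \<phi> ?x = r ?x * z" for z
    proof -
      have "(pd_inv \<psi> ?x z)$1 *\<^sub>R pd 1 \<phi> ?x + (pd_inv \<psi> ?x z)$2 *\<^sub>R pd 2 \<phi> ?x
        = r ?x * ((pd_inv \<psi> ?x z)$1 *\<^sub>R pd 1 \<psi> ?x + (pd_inv \<psi> ?x z)$2 *\<^sub>R pd 2 \<psi> ?x)"
        unfolding r by (simp add: algebra_simps)
      then show ?thesis unfolding pd_inv_right[OF A.jac_nz] .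
    qed
    ultimately show ?thesis by (simp add: has_field_derivative_def)
  qed
  have Fhol: "F holomorphic_on UNIV" using F by (auto simp: holomorphic_on_open)
  have dF: "deriv F w = r (inv \<psi> w)" for w by (rule DERIV_imp_deriv[OF F])
  obtain x0 where x0: "\<And>x. cmod (r x) \<le> cmod (r x0)"
    using torus_bounded[OF torus_continuous[OF rt] torus_smoothD(2)[OF rt]] by blast
  have "deriv F constant_on UNIV"
  proof (rule Liouville_theorem)
    show "deriv F holomorphic_on UNIV" by (rule holomorphic_deriv[OF Fhol open_UNIV])
    show "bounded (range (deriv F))" unfolding bounded_iff using x0 dF by (auto intro!: exI[of _ "cmod (r x0)"])
  qed
  then obtain k where k: "\<And>w. deriv F w = k" unfolding constant_on_def by auto
  have aff: "F w = k * w + F 0" for w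
  proof -
    have "((\<lambda>w. F w - k * w) has_field_derivative 0) (at w)" for w
    proof -
      have "((\<lambda>w. F w - k * w) has_field_derivative r (inv \<psi> w) - k) (at w)"
        using F[of w] by (auto intro!: derivative_eq_intros)
      then show ?thesis using dF[of w] k[of w] by simp
    qed
    then obtain c where "\<And>w. F w - k * w = c"
      using has_field_derivative_zero_constant[of UNIV "\<lambda>w. F w - k * w"] by auto
    from this[of w] this[of 0] show ?thesis by (simp add: algebra_simps)
  qed
  have Fpsi: "F (\<psi> x) = \<phi> x" for x by (simp add: F_def)
  \<comment> \<open>An affine transition map multiplies all periods by its slope, hence carries one
    period lattice onto the other.\<close>
  have shift: "\<phi> n - \<phi> 0 = k * (\<psi> n - \<psi> 0)" for n
    using aff[of "\<psi> n"] aff[of "\<psi> 0"] unfolding Fpsi by (simp add: algebra_simps)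
  show ?thesis
  proof (rule lattice_scaling_modular(1)[OF up up'])
    show "k * l \<in> torus_lattice \<tau>'" if l: "l \<in> torus_lattice \<tau>" for l
    proof -
      obtain n where n: "n \<in> int_lattice" "\<psi> n - \<psi> 0 = l" using A.lattice_translate[OF l] by blast
      show ?thesis using B.chart_translate(2)[OF n(1)] unfolding shift n(2) .
    qed
    show "\<exists>l'\<in>torus_lattice \<tau>. l = k * l'" if l: "l \<in> torus_lattice \<tau>'" for l
    proof -
      obtain n where n: "n \<in> int_lattice" "\<phi> n - \<phi> 0 = l" using B.lattice_translate[OF l] by blast
      show ?thesis using A.chart_translate(2)[OF n(1)] n(2) unfolding shift by blast
    qed
  qed
qed

lemma conformal_modulus_eq_orbit:
  assumes "\<tau> \<in> conformal_modulus g"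
  shows "conformal_modulus g = modular_rel `` {\<tau>}"
  using conformal_modulus_closed[OF assms] conformal_modulus_unique[OF assms] by blast

text \<open>Uniformization enters here: a coordinate whose partial derivatives are a complex
  multiple of the coframe pulls the flat metric back to the squared modulus of that multiple times
  the given metric.\<close>

lemma conformal_modulus_nonempty:
  assumes "torus_immersion \<Phi>" "moving_frame \<Phi> e"
  shows "conformal_modulus (pullback_metric \<Phi>) \<noteq> {}"
proof -
  obtain \<tau> \<psi> r where u: "\<tau> \<in> upper_half_plane" "torus_diffeo \<tau> \<psi>"
    "\<And>x. pd 1 \<psi> x = r x * coframe \<Phi> e 1 x" "\<And>x. pd 2 \<psi> x = r x * coframe \<Phi> e 2 x" "\<And>x. r x \<noteq> 0"
    using torus_uniformization[OF coframe_torus[OF assms, of 1] coframe_torus[OF assms, of 2] frame_expansion(2)[OF assms]] by metis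
  have pd: "pd i \<psi> x = r x * coframe \<Phi> e i x" for i x using exhaust_2[of i] u(3,4) by auto
  have "\<exists>c>0. pullback_metric \<psi> x = c *\<^sub>R pullback_metric \<Phi> x" for x
  proof (intro exI conjI)
    show "(cmod (r x))\<^sup>2 > 0" using u(5)[of x] by simp
    have "pullback_metric \<psi> x $ i $ j = (cmod (r x))\<^sup>2 * pullback_metric \<Phi> x $ i $ j" for i j
    proof -
      have "cnj (pd i \<psi> x) * pd j \<psi> x = (r x * cnj (r x)) * (cnj (coframe \<Phi> e i x) * coframe \<Phi> e j x)"
        by (simp add: pd)
      also have "r x * cnj (r x) = of_real ((cmod (r x))\<^sup>2)" by (rule complex_norm_square[symmetric])
      finally have "Re (cnj (pd i \<psi> x) * pd j \<psi> x) = (cmod (r x))\<^sup>2 * Re (cnj (coframe \<Phi> e i x) * coframe \<Phi> e j x)"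
        by simp
      then show ?thesis unfolding pullback_complex pullback_coframe[OF assms] .
    qed
    then show "pullback_metric \<psi> x = (cmod (r x))\<^sup>2 *\<^sub>R pullback_metric \<Phi> x" by (simp add: vec_eq_iff)
  qed
  then show ?thesis using u unfolding conformal_modulus_def by blast
qed

section \<open>From the energy bound to a compact set of orbits\<close>

lemma frame_energy_bounds_modulus:
  fixes \<Phi> :: "real^2 \<Rightarrow> real^'m"
  assumes "torus_immersion \<Phi>" "moving_frame \<Phi> e" "\<tau> \<in> conformal_modulus (pullback_metric \<Phi>)"
  shows "Im \<tau> \<le> 6 * frame_energy \<Phi> e"
proof -
  obtain \<psi> where \<psi>: "torus_diffeo \<tau> \<psi>" "\<And>x. \<exists>c>0. pullback_metric \<psi> x = c *\<^sub>R pullback_metric \<Phi> x" and up: "\<tau> \<in> upper_half_plane"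
    using assms(3) unfolding conformal_modulus_def by blast
  interpret conformal_torus \<tau> \<psi> \<Phi> e
    by unfold_locales (use assms \<psi> up in auto)
  show ?thesis by (rule Im_le_frame_energy)
qed

text \<open>If the imaginary part of \<open>\<tau>\<close> is within the factor \<open>3/4\<close> of the supremum over its orbit
  and \<open>\<bar>Re \<tau>\<bar> \<le> 1/2\<close>, comparison with \<open>-1/\<tau>\<close> bounds \<open>Im \<tau>\<close> from below.\<close>

lemma bounded_orbit_representative:
  assumes "\<tau>\<^sub>0 \<in> M" and up: "M \<subseteq> upper_half_plane" and B: "\<And>\<tau>. \<tau> \<in> M \<Longrightarrow> Im \<tau> \<le> B"
    and M: "\<And>\<tau> \<tau>'. \<tau> \<in> M \<Longrightarrow> (\<tau>, \<tau>') \<in> modular_rel \<Longrightarrow> \<tau>' \<in> M"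
  obtains \<tau> where "\<tau> \<in> M" "\<bar>Re \<tau>\<bar> \<le> 1/2" "1/2 \<le> Im \<tau>" "Im \<tau> \<le> B"
proof -
  define S where "S = Sup (Im ` M)"
  have bdd: "bdd_above (Im ` M)" using B by (auto intro: bdd_aboveI[of _ B])
  have S: "Im \<tau> \<le> S" if "\<tau> \<in> M" for \<tau> unfolding S_def using that bdd by (intro cSup_upper) auto
  have S0: "S > 0" using S[OF assms(1)] up assms(1) by (auto simp: upper_half_plane_def)
  \<comment> \<open>The supremum is only approached. With this factor, comparison with
    \<open>- 1 / \<tau>\<close> gives \<open>3/4 < (cmod \<tau>)\<^sup>2\<close>, and subtracting
    \<open>(Re \<tau>)\<^sup>2 \<le> 1/4\<close> leaves more than the square of 1/2.\<close>
  then have "3/4 * S < S" by simp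
  then obtain \<tau>1 where \<tau>1: "\<tau>1 \<in> M" "3/4 * S < Im \<tau>1"
    using less_cSup_iff[of "Im ` M" "3/4 * S"] assms(1) bdd unfolding S_def by blast
  define k where "k = round (Re \<tau>1)"
  define \<tau> where "\<tau> = \<tau>1 - of_int k"
  have im1: "Im \<tau> = Im \<tau>1" by (simp add: \<tau>_def)
  have im0: "Im \<tau> > 0" using up \<tau>1(1) im1 by (auto simp: upper_half_plane_def)
  have "\<tau> = (of_int 1 * \<tau>1 + of_int (- k)) / (of_int 0 * \<tau>1 + of_int 1)" by (simp add: \<tau>_def)
  moreover have "(1::int) * 1 - (- k) * 0 = 1" by simp
  moreover have "\<tau> \<in> upper_half_plane" using im0 by (simp add: upper_half_plane_def)
  ultimately have "(\<tau>1, \<tau>) \<in> modular_rel"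
    unfolding modular_rel_def using up \<tau>1(1) by blast
  then have \<tau>: "\<tau> \<in> M" using M \<tau>1(1) by blast
  have re: "\<bar>Re \<tau>\<bar> \<le> 1/2"
    using of_int_round_abs_le[of "Re \<tau>1"] by (simp add: \<tau>_def k_def abs_minus_commute)
  have nz: "\<tau> \<noteq> 0" using im0 by auto
  have imi: "Im (- 1 / \<tau>) = Im \<tau> / (cmod \<tau>)\<^sup>2"
    by (simp add: Im_divide cmod_power2)
  have "- 1 / \<tau> = (of_int 0 * \<tau> + of_int (- 1)) / (of_int 1 * \<tau> + of_int 0)" by simp
  moreover have "(0::int) * 0 - (- 1) * 1 = 1" by simp
  moreover have "- 1 / \<tau> \<in> upper_half_plane" unfolding upper_half_plane_def using imi im0 nz by simp
  ultimately have "(\<tau>, - 1 / \<tau>) \<in> modular_rel"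
    unfolding modular_rel_def using up \<tau> by blast
  from S[OF M[OF \<tau> this]] have "Im \<tau> / (cmod \<tau>)\<^sup>2 \<le> S" unfolding imi .
  then have "Im \<tau> \<le> S * (cmod \<tau>)\<^sup>2" using nz by (simp add: pos_divide_le_eq)
  then have "3/4 * S < S * (cmod \<tau>)\<^sup>2" using \<tau>1(2) im1 by simp
  then have "3/4 < (cmod \<tau>)\<^sup>2" using S0 by (simp add: mult.commute)
  moreover have "(Re \<tau>)\<^sup>2 \<le> (1/2)\<^sup>2" using re by (metis abs_le_square_iff abs_of_nonneg zero_le_divide_1_iff zero_le_numeral)
  ultimately have "(1/2)\<^sup>2 \<le> (Im \<tau>)\<^sup>2" unfolding cmod_power2 by (simp add: power2_eq_square)
  then have "1/2 \<le> Im \<tau>" by (rule power2_le_imp_le) (use im0 in simp)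
  then show ?thesis using that[OF \<tau> re] B[OF \<tau>] by blast
qed

lemma continuous_map_moduli: "continuous_map (top_of_set upper_half_plane) moduli_topology (\<lambda>\<tau>. modular_rel `` {\<tau>})"
  unfolding continuous_map_def
  by (auto simp: openin_moduli_topology topspace_moduli_topology moduli_space_def intro: quotientI)

theorem proposition1:
  fixes C :: real
  assumes "CARD('m::finite) \<ge> 3"
    and "C > 0"
  shows "\<exists>K. compactin moduli_topology K \<and>
    (\<forall>(\<Phi> :: real^2 \<Rightarrow> real^'m) (e :: 2 \<Rightarrow> real^2 \<Rightarrow> real^'m).
       torus_immersion \<Phi> \<and> moving_frame \<Phi> e \<and> frame_energy \<Phi> e \<in> {0..C} \<longrightarrow>
       conformal_modulus (pullback_metric \<Phi>) \<in> K)"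
proof -
  \<comment> \<open>The sides and the lower edge are those of the chosen representative, the upper
    edge is the energy bound. For \<open>6 * C < 1/2\<close> the rectangle is empty, and the claim
    then says that no frame has such small energy.\<close>
  let ?R = "cbox (Complex (- 1/2) (1/2)) (Complex (1/2) (6 * C))"
  let ?orb = "\<lambda>\<tau>. modular_rel `` {\<tau>}"
  have "?R \<subseteq> upper_half_plane" by (auto simp: in_cbox_complex_iff upper_half_plane_def)
  then have "compactin (top_of_set upper_half_plane) ?R"
    by (simp add: compactin_subtopology)
  then have "compactin moduli_topology (?orb ` ?R)"
    by (rule image_compactin[OF _ continuous_map_moduli])
  moreover have "conformal_modulus (pullback_metric \<Phi>) \<in> ?orb ` ?R"
    if \<Phi>: "torus_immersion \<Phi>" "moving_frame \<Phi> e" and E: "frame_energy \<Phi> e \<in> {0..C}"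
    for \<Phi> :: "real^2 \<Rightarrow> real^'m" and e
  proof -
    let ?M = "conformal_modulus (pullback_metric \<Phi>)"
    obtain \<tau>0 where \<tau>0: "\<tau>0 \<in> ?M" using conformal_modulus_nonempty[OF \<Phi>] by blast
    obtain \<tau> where \<tau>: "\<tau> \<in> ?M" "\<bar>Re \<tau>\<bar> \<le> 1/2" "1/2 \<le> Im \<tau>" "Im \<tau> \<le> 6 * C"
    proof (rule bounded_orbit_representative[OF \<tau>0, of "6 * C"])
      show "?M \<subseteq> upper_half_plane" by (auto simp: conformal_modulus_def)
      show "Im \<tau> \<le> 6 * C" if "\<tau> \<in> ?M" for \<tau>
        using frame_energy_bounds_modulus[OF \<Phi> that] E by simp
      show "\<tau>' \<in> ?M" if "\<tau> \<in> ?M" "(\<tau>, \<tau>') \<in> modular_rel" for \<tau> \<tau>'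
        by (rule conformal_modulus_closed[OF that])
    qed (rule that)
    have "\<tau> \<in> ?R" using \<tau>(2-4) by (auto simp: in_cbox_complex_iff)
    then show ?thesis using conformal_modulus_eq_orbit[OF \<tau>(1)] by blast
  qed
  ultimately show ?thesis by blast
qed

end
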